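(* Let $K$ be a compact metrizable hypergroup and let $1<p\le 2$. There is a constant $C>0$ such that for every function $\varphi:\widehat K\to(0,\infty)$ with $$M_\varphi:=\sup_{y>0}\,y\sum_{\pi\in\widehat K,\ \varphi(\pi)\ge y}k_\pi^2<\infty$$ and every $f\in L^p(K)$, $$\left(\sum_{\pi\in\widehat K}k_\pi^2\left(\frac{\|\widehat f(\pi)\|_{\mathrm{HS}}}{\sqrt{k_\pi}}\right)^p\varphi(\pi)^{2-p}\right)^{\frac1p}\le C\,M_\varphi^{\frac{2-p}{p}}\,\|f\|_{L^p(K)} .$$
   Context: A compact hypergroup is a nonempty compact Hausdorff space $K$ with a weakly continuous associative convolution $*$ on the Banach space $M(K)$ of bounded regular (complex) Borel measures, making $(M(K),* )$ a Banach algebra, such that: (i) for $x,y\in K$, $\delta_x*\delta_y$ is a probability measure with compact support and $(x,y)\mapsto\operatorname{supp}(\delta_x*\delta_y)$ is continuous from $K\times K$ into the space of nonempty compact subsets of $K$ with the Michael (Vietoris) topology; (ii) there is a unique $e\in K$ with $\delta_x*\delta_e=\delta_e*\delta_x=\delta_x$ for all $x$; (iii) there is a homeomorphism $x\mapsto\check x$ of $K$ of order two inducing an involution on $M(K)$, where $\check\mu(E)=\mu(\check E)$ for Borel $E$, and $e\in\operatorname{supp}(\delta_x*\delta_y)$ if and only if $x=\check y$. $\lambda$ denotes the normalized Haar measure of $K$ (the left-invariant one: $\int_K f(x*y)\,d\lambda(y)=\int_K f(y)\,d\lambda(y)$ for all $x\in K$ and continuous $f$, where $f(x*y)=\int f\,d(\delta_x*\delta_y)$),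 and $L^p(K)=L^p(K,\lambda)$. $\widehat K$ is the set of equivalence classes of irreducible representations of $K$, i.e. irreducible $*$-algebra representations $\pi$ of $M(K)$ on a Hilbert space $\mathcal H_\pi$ with $\pi(\delta_e)=I$ and $\mu\mapsto\langle\pi(\mu)u,v\rangle$ continuous on the cone $M(K)^+$ of positive measures with the weak topology; write $\pi(x)=\pi(\delta_x)$. All such $\pi$ are finite dimensional; $d_\pi=\dim\mathcal H_\pi$, and $\pi(x)=[\pi_{i,j}(x)]$ is the matrix in a fixed orthonormal basis. $\widehat K$ is countable since $K$ is metrizable. The hyperdimension $k_\pi\ge d_\pi$ is the constant with $\int_K\pi_{i,j}\overline{\pi'_{m,l}}\,d\lambda=1/k_\pi$ if $i=m$, $j=l$, $\pi=\pi'$, and $0$ otherwise. The Fourier transform is $\widehat f(\pi)=\int_K f(x)\,\bar\pi(x)\,d\lambda(x)\in\mathbb C^{d_\pi\times d_\pi}$ with $\bar\pi$ the conjugate representation (entries $\overline{\pi_{i,j}}$), and $\|\cdot\|_{\mathrm{HS}}$ is the Hilbert–Schmidt norm. Empty sums are zero. *)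

theory Defs
  imports
    "HOL-Analysis.Analysis"
    "HOL-Library.Nonpos_Ints"
    "Jordan_Normal_Form.Schur_Decomposition"
begin

section \<open>Bounded regular complex Borel measures\<close>

text \<open>
  A complex Borel measure is a countably additive set function on the Borel sets. It is given
  the value 0 off the Borel sets, so that equal measures are equal as functions.
\<close>

type_synonym 'a cmeasure = "'a set \<Rightarrow> complex"

definition total_variation :: "'a::topological_space cmeasure \<Rightarrow> 'a set \<Rightarrow> ennreal" where
  "total_variation \<mu> A =
     (SUP P\<in>{P. finite P \<and> P \<subseteq> sets borel \<and> disjoint P \<and> \<Union>P \<subseteq> A}. \<Sum>B\<in>P. ennreal (cmod (\<mu> B)))"

definition cmeasures :: "'a::t2_space cmeasure set" where
  "cmeasures = {\<mu>.
     (\<forall>A. A \<notin> sets borel \<longrightarrow> \<mu> A = 0) \<and>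
     (\<forall>A::nat \<Rightarrow> 'a set. range A \<subseteq> sets borel \<longrightarrow> disjoint_family A \<longrightarrow>
        (\<lambda>n. \<mu> (A n)) sums \<mu> (\<Union>n. A n)) \<and>
     total_variation \<mu> UNIV < \<infinity> \<and>
     (\<forall>A\<in>sets borel. \<forall>\<epsilon>>0. \<exists>C U. compact C \<and> open U \<and> C \<subseteq> A \<and> A \<subseteq> U \<and>
        total_variation \<mu> (U - C) < ennreal \<epsilon>)}"

definition cnorm :: "'a::t2_space cmeasure \<Rightarrow> real" where
  "cnorm \<mu> = enn2real (total_variation \<mu> UNIV)"

definition pos_cmeasures :: "'a::t2_space cmeasure set" where
  "pos_cmeasures = {\<mu> \<in> cmeasures. \<forall>A. \<mu> A \<in> \<real>\<^sub>\<ge>\<^sub>0}"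

definition prob_cmeasures :: "'a::t2_space cmeasure set" where
  "prob_cmeasures = {\<mu> \<in> pos_cmeasures. \<mu> UNIV = 1}"

definition dirac :: "'a::t2_space \<Rightarrow> 'a cmeasure" where
  "dirac x = (\<lambda>A. if A \<in> sets borel \<and> x \<in> A then 1 else 0)"

definition csupp :: "'a::t2_space cmeasure \<Rightarrow> 'a set" where
  "csupp \<mu> = {x. \<forall>U. open U \<longrightarrow> x \<in> U \<longrightarrow> total_variation \<mu> U \<noteq> 0}"

text \<open>Meaningful for positive \<open>\<mu>\<close> only: the same measure as an object of type \<^typ>\<open>'a measure\<close>.\<close>

definition to_measure :: "'a::t2_space cmeasure \<Rightarrow> 'a measure" where
  "to_measure \<mu> = measure_of UNIV (sets borel) (\<lambda>A. ennreal (Re (\<mu> A)))"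

text \<open>
  The cone of positive measures with the weak topology, i.e. the initial topology of the maps
  \<open>\<mu> \<mapsto> \<integral> f d\<mu>\<close>. All continuous \<open>f\<close> are admitted, which are exactly the bounded continuous
  ones since the underlying space will be compact.
\<close>

definition weak_cone :: "'a::t2_space cmeasure topology" where
  "weak_cone = topology_generated_by
     {{\<mu> \<in> pos_cmeasures. (\<integral>x. f x \<partial>to_measure \<mu>) \<in> U} | (f :: 'a \<Rightarrow> complex) U.
        continuous_on UNIV f \<and> open U}"

text \<open>The nonempty compact sets with the Michael topology.\<close>

definition michael_topology :: "'a::topological_space set topology" where
  "michael_topology = topology_generated_by
     {{A. A \<noteq> {} \<and> compact A \<and> A \<inter> U \<noteq> {} \<and> A \<subseteq> V} | U V. open U \<and> open V}"


section \<open>Compact hypergroups\<close>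

record 'a hypergroup =
  conv :: "'a cmeasure \<Rightarrow> 'a cmeasure \<Rightarrow> 'a cmeasure"
  unit :: 'a
  invol :: "'a \<Rightarrow> 'a"

definition check_measure :: "('a, 'b) hypergroup_scheme \<Rightarrow> 'a cmeasure \<Rightarrow> 'a cmeasure" where
  "check_measure H \<mu> = (\<lambda>A. \<mu> (invol H ` A))"

text \<open>
  The adjoint of the *-algebra of measures; the conjugation makes it conjugate linear, as
  required of *-representations.
\<close>

definition star_measure :: "('a, 'b) hypergroup_scheme \<Rightarrow> 'a cmeasure \<Rightarrow> 'a cmeasure" where
  "star_measure H \<mu> = (\<lambda>A. cnj (check_measure H \<mu> A))"

text \<open>
  Weak continuity of the convolution is joint continuity on the cone of positive measures
  (Jewett's positive-continuity); joint weak continuity on the space of all measures already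
  fails for infinite compact groups.
\<close>

locale compact_hypergroup =
  fixes H :: "('a::t2_space, 'b) hypergroup_scheme" (structure)
  assumes compact_space: "compact (UNIV :: 'a set)"
    and conv_closed: "\<mu> \<in> cmeasures \<Longrightarrow> \<nu> \<in> cmeasures \<Longrightarrow> conv H \<mu> \<nu> \<in> cmeasures"
    and conv_add_left: "\<mu> \<in> cmeasures \<Longrightarrow> \<mu>' \<in> cmeasures \<Longrightarrow> \<nu> \<in> cmeasures \<Longrightarrow>
      conv H (\<lambda>A. \<mu> A + \<mu>' A) \<nu> = (\<lambda>A. conv H \<mu> \<nu> A + conv H \<mu>' \<nu> A)"
    and conv_add_right: "\<mu> \<in> cmeasures \<Longrightarrow> \<nu> \<in> cmeasures \<Longrightarrow> \<nu>' \<in> cmeasures \<Longrightarrow>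
      conv H \<mu> (\<lambda>A. \<nu> A + \<nu>' A) = (\<lambda>A. conv H \<mu> \<nu> A + conv H \<mu> \<nu>' A)"
    and conv_scale_left: "\<mu> \<in> cmeasures \<Longrightarrow> \<nu> \<in> cmeasures \<Longrightarrow>
      conv H (\<lambda>A. c * \<mu> A) \<nu> = (\<lambda>A. c * conv H \<mu> \<nu> A)"
    and conv_scale_right: "\<mu> \<in> cmeasures \<Longrightarrow> \<nu> \<in> cmeasures \<Longrightarrow>
      conv H \<mu> (\<lambda>A. c * \<nu> A) = (\<lambda>A. c * conv H \<mu> \<nu> A)"
    and conv_assoc: "\<mu> \<in> cmeasures \<Longrightarrow> \<nu> \<in> cmeasures \<Longrightarrow> \<kappa> \<in> cmeasures \<Longrightarrow>
      conv H (conv H \<mu> \<nu>) \<kappa> = conv H \<mu> (conv H \<nu> \<kappa>)"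
    and conv_norm: "\<mu> \<in> cmeasures \<Longrightarrow> \<nu> \<in> cmeasures \<Longrightarrow>
      cnorm (conv H \<mu> \<nu>) \<le> cnorm \<mu> * cnorm \<nu>"
    and conv_weakly_continuous:
      "continuous_map (prod_topology weak_cone weak_cone) weak_cone (\<lambda>(\<mu>, \<nu>). conv H \<mu> \<nu>)"
    and conv_dirac: "conv H (dirac x) (dirac y) \<in> prob_cmeasures"
    and compact_csupp: "compact (csupp (conv H (dirac x) (dirac y)))"
    and csupp_continuous:
      "continuous_map (prod_topology euclidean euclidean) michael_topology
         (\<lambda>(x, y). csupp (conv H (dirac x) (dirac y)))"
    and unit_unique:
      "(\<forall>x. conv H (dirac x) (dirac u) = dirac x \<and> conv H (dirac u) (dirac x) = dirac x)
         \<longleftrightarrow> u = unit H"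
    and invol_continuous: "continuous_on UNIV (invol H)"
    and invol_invol: "invol H (invol H x) = x"
    and check_conv: "\<mu> \<in> cmeasures \<Longrightarrow> \<nu> \<in> cmeasures \<Longrightarrow>
      check_measure H (conv H \<mu> \<nu>) = conv H (check_measure H \<nu>) (check_measure H \<mu>)"
    and unit_in_csupp:
      "unit H \<in> csupp (conv H (dirac x) (dirac y)) \<longleftrightarrow> x = invol H y"

definition is_haar_measure :: "('a::t2_space, 'b) hypergroup_scheme \<Rightarrow> 'a measure \<Rightarrow> bool" where
  "is_haar_measure H lam \<longleftrightarrow>
     sets lam = sets borel \<and> emeasure lam UNIV = 1 \<and>
     (\<lambda>A. complex_of_real (measure lam A)) \<in> cmeasures \<and>
     (\<forall>x. \<forall>f :: 'a \<Rightarrow> complex. continuous_on UNIV f \<longrightarrow>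
        (\<integral>y. (\<integral>t. f t \<partial>to_measure (conv H (dirac x) (dirac y))) \<partial>lam) = (\<integral>y. f y \<partial>lam))"


section \<open>Representations and the dual\<close>

text \<open>
  Irreducible representations of compact hypergroups are finite dimensional, so they are given
  as matrix representations with respect to an orthonormal basis; \<open>\<bullet>c\<close> is the standard
  Hermitian inner product.
\<close>

type_synonym 'a mrep = "'a cmeasure \<Rightarrow> complex mat"

definition rdim :: "('a::t2_space, 'b) hypergroup_scheme \<Rightarrow> 'a mrep \<Rightarrow> nat" where
  "rdim H \<pi> = dim_row (\<pi> (dirac (unit H)))"

definition representation :: "('a::t2_space, 'b) hypergroup_scheme \<Rightarrow> 'a mrep \<Rightarrow> bool" where
  "representation H \<pi> \<longleftrightarrow>
     (\<forall>\<mu>\<in>cmeasures. \<pi> \<mu> \<in> carrier_mat (rdim H \<pi>) (rdim H \<pi>)) \<and>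
     (\<forall>\<mu>\<in>cmeasures. \<forall>\<nu>\<in>cmeasures. \<pi> (\<lambda>A. \<mu> A + \<nu> A) = \<pi> \<mu> + \<pi> \<nu>) \<and>
     (\<forall>c. \<forall>\<mu>\<in>cmeasures. \<pi> (\<lambda>A. c * \<mu> A) = c \<cdot>\<^sub>m \<pi> \<mu>) \<and>
     (\<forall>\<mu>\<in>cmeasures. \<forall>\<nu>\<in>cmeasures. \<pi> (conv H \<mu> \<nu>) = \<pi> \<mu> * \<pi> \<nu>) \<and>
     (\<forall>\<mu>\<in>cmeasures. \<pi> (star_measure H \<mu>) = mat_adjoint (\<pi> \<mu>)) \<and>
     \<pi> (dirac (unit H)) = 1\<^sub>m (rdim H \<pi>) \<and>
     (\<forall>u\<in>carrier_vec (rdim H \<pi>). \<forall>v\<in>carrier_vec (rdim H \<pi>).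
        continuous_map weak_cone euclidean (\<lambda>\<mu>. (\<pi> \<mu> *\<^sub>v u) \<bullet>c v))"

definition invariant_subspace ::
    "('a::t2_space, 'b) hypergroup_scheme \<Rightarrow> 'a mrep \<Rightarrow> complex Matrix.vec set \<Rightarrow> bool" where
  "invariant_subspace H \<pi> W \<longleftrightarrow>
     W \<subseteq> carrier_vec (rdim H \<pi>) \<and> 0\<^sub>v (rdim H \<pi>) \<in> W \<and>
     (\<forall>u\<in>W. \<forall>v\<in>W. u + v \<in> W) \<and> (\<forall>c. \<forall>v\<in>W. c \<cdot>\<^sub>v v \<in> W) \<and>
     (\<forall>\<mu>\<in>cmeasures. \<forall>v\<in>W. \<pi> \<mu> *\<^sub>v v \<in> W)"

definition irreducible_rep :: "('a::t2_space, 'b) hypergroup_scheme \<Rightarrow> 'a mrep \<Rightarrow> bool" where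
  "irreducible_rep H \<pi> \<longleftrightarrow>
     representation H \<pi> \<and> 0 < rdim H \<pi> \<and>
     (\<forall>W. invariant_subspace H \<pi> W \<longrightarrow> W = {0\<^sub>v (rdim H \<pi>)} \<or> W = carrier_vec (rdim H \<pi>))"

definition equivalent_reps ::
    "('a::t2_space, 'b) hypergroup_scheme \<Rightarrow> 'a mrep \<Rightarrow> 'a mrep \<Rightarrow> bool" where
  "equivalent_reps H \<pi> \<rho> \<longleftrightarrow>
     rdim H \<pi> = rdim H \<rho> \<and>
     (\<exists>U\<in>carrier_mat (rdim H \<pi>) (rdim H \<pi>).
        U * mat_adjoint U = 1\<^sub>m (rdim H \<pi>) \<and> mat_adjoint U * U = 1\<^sub>m (rdim H \<pi>) \<and>
        (\<forall>\<mu>\<in>cmeasures. \<rho> \<mu> = U * \<pi> \<mu> * mat_adjoint U))"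

definition dual :: "('a::t2_space, 'b) hypergroup_scheme \<Rightarrow> 'a mrep set set" where
  "dual H = {\<pi>. irreducible_rep H \<pi>} //
     {(\<pi>, \<rho>). irreducible_rep H \<pi> \<and> irreducible_rep H \<rho> \<and> equivalent_reps H \<pi> \<rho>}"

text \<open>
  Choosing a representative of a class amounts to fixing a representation space and an
  orthonormal basis of it.
\<close>

definition rep_of :: "'a mrep set \<Rightarrow> 'a mrep" where
  "rep_of c = (SOME \<pi>. \<pi> \<in> c)"

definition class_dim :: "('a::t2_space, 'b) hypergroup_scheme \<Rightarrow> 'a mrep set \<Rightarrow> nat" where
  "class_dim H c = rdim H (rep_of c)"

definition mcoeff :: "'a::t2_space mrep set \<Rightarrow> nat \<Rightarrow> nat \<Rightarrow> 'a \<Rightarrow> complex" where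
  "mcoeff c i j x = rep_of c (dirac x) $$ (i, j)"

definition hyperdim ::
    "('a::t2_space, 'b) hypergroup_scheme \<Rightarrow> 'a measure \<Rightarrow> 'a mrep set \<Rightarrow> real" where
  "hyperdim H lam c = (THE k. 0 < k \<and>
     (\<forall>c'\<in>dual H. \<forall>i<class_dim H c. \<forall>j<class_dim H c. \<forall>m<class_dim H c'. \<forall>l<class_dim H c'.
        (\<integral>x. mcoeff c i j x * cnj (mcoeff c' m l x) \<partial>lam) =
          (if i = m \<and> j = l \<and> c = c' then complex_of_real (1 / k) else 0)))"


section \<open>Fourier transform\<close>

definition fourier ::
    "('a::t2_space, 'b) hypergroup_scheme \<Rightarrow> 'a measure \<Rightarrow> ('a \<Rightarrow> complex) \<Rightarrow> 'a mrep set \<Rightarrow> complex mat"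
  where
  "fourier H lam f c = Matrix.mat (class_dim H c) (class_dim H c)
     (\<lambda>(i, j). \<integral>x. f x * cnj (mcoeff c i j x) \<partial>lam)"

definition hs_norm :: "complex mat \<Rightarrow> real" where
  "hs_norm A = sqrt (\<Sum>i<dim_row A. \<Sum>j<dim_col A. (cmod (A $$ (i, j)))\<^sup>2)"

definition in_Lp :: "'a measure \<Rightarrow> real \<Rightarrow> ('a \<Rightarrow> complex) \<Rightarrow> bool" where
  "in_Lp lam p f \<longleftrightarrow> f \<in> borel_measurable lam \<and> integrable lam (\<lambda>x. cmod (f x) powr p)"

definition Lp_norm :: "'a measure \<Rightarrow> real \<Rightarrow> ('a \<Rightarrow> complex) \<Rightarrow> real" where
  "Lp_norm lam p f = (\<integral>x. cmod (f x) powr p \<partial>lam) powr (1 / p)"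

definition M_weight ::
    "('a::t2_space, 'b) hypergroup_scheme \<Rightarrow> 'a measure \<Rightarrow> ('a mrep set \<Rightarrow> real) \<Rightarrow> ennreal" where
  "M_weight H lam \<phi> = (SUP y\<in>{0<..}. ennreal y *
     (\<Sum>\<^sub>\<infinity>c\<in>{c\<in>dual H. y \<le> \<phi> c}. ennreal ((hyperdim H lam c)\<^sup>2)))"

end

theory Submission
  imports Defs "Jordan_Normal_Form.Spectral_Radius"
begin

text \<open>The inequality is a Marcinkiewicz interpolation for \<open>f \<mapsto> \<parallel>F f(\<pi>)\<parallel> / (\<surd>k\<^sub>\<pi> \<phi>(\<pi>))\<close> with respect to the
  weights \<open>k\<^sub>\<pi>\<^sup>2 \<phi>(\<pi>)\<^sup>2\<close>: Bessel's inequality gives strong type \<open>(2,2)\<close>, and \<open>\<parallel>\<pi>(x)\<parallel>\<^sup>2 \<le> d\<^sub>\<pi> \<le> k\<^sub>\<pi>\<close> together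
  with the hypothesis on \<open>M\<^sub>\<phi>\<close> gives weak type \<open>(1,1)\<close>. That the hyperdimensions exist is Schur's lemma
  applied to \<open>\<integral> \<pi>(x) A \<rho>(x)\<^sup>* dx\<close>, which intertwines because of the adjoint identity
  \<open>\<integral> f(x * y) g(y) dy = \<integral> f(y) g(x\<^sup>- * y) dy\<close>; here \<open>x\<^sup>-\<close> is the involution.\<close>

section \<open>Positive measures and the weak cone\<close>

text \<open>The obstacle throughout is that x * y is a measure and not a point. A product of
  functions is not translated factor by factor, so left invariance alone does not yield the adjoint
  identity; a bump at the unit is needed, and the axiom \<open>unit_in_csupp\<close> with the
  continuity of supports makes it act near the diagonal. Likewise \<pi>(x) need not be unitary, and
  its Hilbert-Schmidt bound comes from a maximum argument. Representations live on all complex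
  measures while Haar integrals see only points: on the positive cone entries are integrals of their
  values at point masses, and complex measures are combinations of positive ones. The inequality d
  \<le> k follows by integrating the Hilbert-Schmidt bound: each of the d^2 entries has squared L2
  norm 1/k, and their squares add up to at most d. The weak (1,1) estimate rests on a dyadic sum:
  under the weights k^2 \<phi>^2 the set where \<phi> \<le> w has mass at most 4 w M. All estimates
  are made on finite sets of classes, with a constant depending on p only; the sum over the whole
  dual comes last.\<close>

lemma fine_step_functions:
  assumes "compact (UNIV :: 'a::metric_space set)"
  obtains T :: "nat \<Rightarrow> 'a::metric_space set" and s :: "nat \<Rightarrow> 'a \<Rightarrow> 'a"
  where "\<And>n. finite (T n)" "\<And>n x. s n x \<in> T n" "\<And>n x. dist (s n x) x < inverse (Suc n)"
    "\<And>n a. s n -` {a} \<in> sets borel"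
proof -
  have "\<exists>(T :: 'a set) s. finite T \<and> (\<forall>x. s x \<in> T) \<and> (\<forall>x. dist (s x) x < \<delta>) \<and> (\<forall>a. s -` {a} \<in> sets borel)"
    if "\<delta> > 0" for \<delta> :: real
  proof -
    have "UNIV \<subseteq> (\<Union>x\<in>UNIV. ball (x :: 'a) \<delta>)"
    proof
      fix x :: 'a
      have "x \<in> ball x \<delta>" using that by simp
      then show "x \<in> (\<Union>x\<in>UNIV. ball x \<delta>)" by blast
    qed
    then obtain k :: "'a set" where k: "finite k" "UNIV \<subseteq> (\<Union>x\<in>k. ball x \<delta>)"
      using compactE_image[OF assms, of UNIV "\<lambda>x. ball x \<delta>"] by auto
    obtain xs where xs: "set xs = k" using finite_list[OF k(1)] by auto
    \<comment> \<open>Taking the first ball that contains \<open>x\<close> makes the choice of a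
      centre Borel measurable.\<close>
    define j where "j x = (LEAST i. i < length xs \<and> dist (xs ! i) x < \<delta>)" for x
    have ex: "\<exists>i. i < length xs \<and> dist (xs ! i) x < \<delta>" for x
      using k(2) xs by (force simp: in_set_conv_nth)
    have j: "j x < length xs \<and> dist (xs ! j x) x < \<delta>" for x
      unfolding j_def by (rule LeastI_ex[OF ex])
    have "Measurable.pred borel (\<lambda>x. i < length xs \<and> dist (xs ! i) x < \<delta>)" for i
    proof -
      have "{x. dist (xs ! i) x < \<delta>} \<in> sets borel"
        using borel_open[OF open_ball, of "xs ! i" \<delta>] by (simp add: ball_def)
      then show ?thesis by (cases "i < length xs") (auto simp: pred_def)
    qed
    then have jm: "j \<in> measurable borel (count_space UNIV)"
      unfolding j_def by (rule measurable_Least)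
    have "(\<lambda>x. xs ! j x) -` {a} \<in> sets borel" for a
    proof -
      have "(\<lambda>x. xs ! j x) -` {a} = j -` {i. xs ! i = a} \<inter> space borel" by auto
      also have "\<dots> \<in> sets borel" by (rule measurable_sets[OF jm]) simp
      finally show ?thesis .
    qed
    moreover have "\<forall>x. xs ! j x \<in> k" using j xs by (metis nth_mem)
    moreover have "\<forall>x. dist (xs ! j x) x < \<delta>" using j by blast
    ultimately show ?thesis using k(1)
      by (intro exI[of _ k] exI[of _ "(\<lambda>x. xs ! j x) :: 'a \<Rightarrow> 'a"] conjI) blast+
  qed
  then have "\<forall>n. \<exists>T s. finite T \<and> (\<forall>x. s x \<in> T) \<and> (\<forall>x. dist (s x) x < inverse (Suc n))
      \<and> (\<forall>a. s -` {a} \<in> sets (borel :: 'a measure))" by simp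
  then show ?thesis using that by metis
qed

lemma cmod_integral_le:
  fixes f :: "'a \<Rightarrow> complex"
  assumes "integrable M f" "integrable M g" "\<And>x. cmod (f x) \<le> g x"
  shows "cmod (\<integral>x. f x \<partial>M) \<le> (\<integral>x. g x \<partial>M)"
proof -
  have "cmod (\<integral>x. f x \<partial>M) \<le> (\<integral>x. cmod (f x) \<partial>M)" by (rule integral_norm_bound)
  also have "\<dots> \<le> (\<integral>x. g x \<partial>M)" using assms by (intro integral_mono) auto
  finally show ?thesis .
qed

text \<open>Composed with \<open>s\<close>, any \<open>h\<close> takes finitely many values, each on
  a Borel fibre, so the composite is a simple function.\<close>

lemma integral_step_function:
  fixes h :: "'a::topological_space \<Rightarrow> complex"
  assumes "finite_measure M" "sets M = sets borel" "finite T" "\<And>x. s x \<in> T"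
    "\<And>a. s -` {a} \<in> sets borel"
  shows "integrable M (\<lambda>x. h (s x))"
    and "(\<integral>x. h (s x) \<partial>M) = (\<Sum>a\<in>T. complex_of_real (measure M (s -` {a})) * h a)"
proof -
  interpret finite_measure M by fact
  have eq: "h (s x) = (\<Sum>a\<in>T. indicator (s -` {a}) x *\<^sub>R h a)" for x
  proof -
    have "(\<Sum>a\<in>T. indicator (s -` {a}) x *\<^sub>R h a) = (\<Sum>a\<in>T. if a = s x then h a else 0)"
      by (intro sum.cong) auto
    also have "\<dots> = h (s x)" using assms(3,4) by simp
    finally show ?thesis by simp
  qed
  have int: "has_bochner_integral M (\<lambda>x. indicator (s -` {a}) x *\<^sub>R h a) (measure M (s -` {a}) *\<^sub>R h a)"
    for a
    using assms(2,5) by (intro has_bochner_integral_scaleR_left has_bochner_integral_real_indicator)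
      (auto simp: less_top[symmetric])
  have "has_bochner_integral M (\<lambda>x. \<Sum>a\<in>T. indicator (s -` {a}) x *\<^sub>R h a)
      (\<Sum>a\<in>T. measure M (s -` {a}) *\<^sub>R h a)"
    by (intro has_bochner_integral_sum int)
  then have *: "has_bochner_integral M (\<lambda>x. h (s x)) (\<Sum>a\<in>T. measure M (s -` {a}) *\<^sub>R h a)"
    unfolding eq[symmetric] .
  show "integrable M (\<lambda>x. h (s x))" using * by (rule has_bochner_integral_iff[THEN iffD1, THEN conjunct1])
  show "(\<integral>x. h (s x) \<partial>M) = (\<Sum>a\<in>T. complex_of_real (measure M (s -` {a})) * h a)"
    using has_bochner_integral_integral_eq[OF *] by (simp add: scaleR_conv_of_real)
qed

lemma measurable_continuous_borel:
  assumes "sets M = sets borel" "continuous_on UNIV f"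
  shows "f \<in> borel_measurable M"
  using borel_measurable_continuous_onI[OF assms(2)] measurable_cong_sets[OF assms(1) refl] by blast

lemma continuous_compact_bounded:
  fixes f :: "'a::topological_space \<Rightarrow> 'b::real_normed_vector"
  assumes "compact (UNIV :: 'a set)" "continuous_on UNIV f"
  obtains B where "B > 0" "\<And>x. norm (f x) \<le> B"
proof -
  have "bounded (range f)" using compact_continuous_image[OF assms(2,1)] compact_imp_bounded by blast
  then show ?thesis using that by (auto simp: bounded_pos)
qed

lemma integrable_continuous_compact:
  fixes f :: "'a::topological_space \<Rightarrow> complex"
  assumes "compact (UNIV :: 'a set)" "continuous_on UNIV f" "finite_measure M" "sets M = sets borel"
  shows "integrable M f"
proof -
  obtain B where "B > 0" "\<And>x. norm (f x) \<le> B" using continuous_compact_bounded[OF assms(1,2)] by blast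
  then show ?thesis
    by (intro finite_measure.integrable_const_bound[OF assms(3), where B = B]
        measurable_continuous_borel assms) auto
qed

lemma step_functions_tendsto:
  fixes x :: "'a::metric_space"
  assumes "\<And>n x. dist (s n x) x < inverse (Suc n)"
  shows "(\<lambda>n. s n x) \<longlonglongrightarrow> x"
proof (rule metric_LIMSEQ_I)
  fix r :: real assume "r > 0"
  then obtain N where "inverse (Suc N) < r" using reals_Archimedean by blast
  moreover have "inverse (Suc n) \<le> inverse (Suc N)" if "n \<ge> N" for n
    using that by (simp add: field_simps)
  ultimately show "\<exists>N. \<forall>n\<ge>N. dist (s n x) x < r"
    using assms by (meson less_le_trans order.strict_trans)
qed

lemma continuous_step_functions_tendsto:
  fixes f :: "'a::metric_space \<Rightarrow> 'b::topological_space"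
  assumes "\<And>n x. dist (s n x) x < inverse (Suc n)" "continuous_on UNIV f"
  shows "(\<lambda>n. f (s n x)) \<longlonglongrightarrow> f x"
  using continuous_on_tendsto_compose[OF assms(2) step_functions_tendsto[OF assms(1)]] by simp

text \<open>Dominated convergence along \<open>s n\<close>. The sums see \<open>M\<close> only
  through the masses of the fibres, which later makes them linear in the measure.\<close>

lemma integral_step_tendsto:
  fixes f :: "'a::metric_space \<Rightarrow> complex"
  assumes K: "compact (UNIV :: 'a set)" and f: "continuous_on UNIV f"
    and M: "finite_measure M" "sets M = sets borel"
    and s: "\<And>n. finite (T n)" "\<And>n x. s n x \<in> T n" "\<And>n x. dist (s n x) x < inverse (Suc n)"
    "\<And>n a. s n -` {a} \<in> sets borel"
  shows "(\<lambda>n. \<Sum>a\<in>T n. complex_of_real (measure M (s n -` {a})) * f a) \<longlonglongrightarrow> (\<integral>x. f x \<partial>M)"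
proof -
  obtain B where B: "\<And>x. norm (f x) \<le> B" using continuous_compact_bounded[OF K f] by blast
  have step: "integrable M (\<lambda>x. f (s n x))"
    "(\<integral>x. f (s n x) \<partial>M) = (\<Sum>a\<in>T n. complex_of_real (measure M (s n -` {a})) * f a)" for n
    using integral_step_function[OF M s(1,2,4)] by blast+
  have "(\<lambda>n. \<integral>x. f (s n x) \<partial>M) \<longlonglongrightarrow> (\<integral>x. f x \<partial>M)"
  proof (rule integral_dominated_convergence[where w = "\<lambda>_. B"])
    show "integrable M (\<lambda>_. B)" by (rule finite_measure.integrable_const[OF M(1)])
  qed (use B step(1) continuous_step_functions_tendsto[OF s(3) f] measurable_continuous_borel[OF M(2) f] in auto)
  then show ?thesis by (simp add: step(2))
qed

text \<open>The spaces carry no second countability instance, so the library's Fubini theorem for the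
  Borel sets of the product is not available; continuous functions are approximated in one
  variable by step functions instead.\<close>

lemma Fubini_continuous_compact:
  fixes F :: "'a::metric_space \<Rightarrow> 'a \<Rightarrow> complex"
  assumes K: "compact (UNIV :: 'a set)" and F: "continuous_on UNIV (\<lambda>(x, y). F x y)"
    and M: "finite_measure M" "sets M = sets borel" and N: "finite_measure N" "sets N = sets borel"
  shows "(\<integral>x. (\<integral>y. F x y \<partial>N) \<partial>M) = (\<integral>y. (\<integral>x. F x y \<partial>M) \<partial>N)" (is ?fub)
    and "continuous_on UNIV (\<lambda>x. \<integral>y. F x y \<partial>N)" (is ?cont)
proof -
  have KK: "compact (UNIV :: ('a \<times> 'a) set)" using compact_Times[OF K K] by simp
  obtain B where B: "\<And>z. norm (case z of (x, y) \<Rightarrow> F x y) \<le> B"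
    using continuous_compact_bounded[OF KK F] by blast
  have B': "norm (F x y) \<le> B" for x y using B[of "(x, y)"] by simp
  have F1: "continuous_on UNIV (\<lambda>x. F x y)" for y
    using continuous_on_compose2[OF F, of UNIV "\<lambda>x. (x, y)"] by (simp add: continuous_intros)
  have F2: "continuous_on UNIV (\<lambda>y. F x y)" for x
    using continuous_on_compose2[OF F, of UNIV "\<lambda>y. (x, y)"] by (simp add: continuous_intros)
  \<comment> \<open>On a metric space continuity can be tested on sequences, and there dominated
    convergence with the bound \<open>B\<close> applies.\<close>
  show c: ?cont
    unfolding continuous_on_sequentially
  proof safe
    fix u :: "nat \<Rightarrow> 'a" and x assume u: "u \<longlonglongrightarrow> x"
    show "((\<lambda>x. \<integral>y. F x y \<partial>N) \<circ> u) \<longlonglongrightarrow> (\<integral>y. F x y \<partial>N)"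
      unfolding o_def
    proof (rule integral_dominated_convergence[where w = "\<lambda>_. B"])
      show "integrable N (\<lambda>_. B)" by (rule finite_measure.integrable_const[OF N(1)])
    qed (use B' measurable_continuous_borel[OF N(2) F2] continuous_on_tendsto_compose[OF F1 u] in auto)
  qed
  obtain T :: "nat \<Rightarrow> 'a set" and s :: "nat \<Rightarrow> 'a \<Rightarrow> 'a"
    where s: "\<And>n. finite (T n)" "\<And>n x. s n x \<in> T n" "\<And>n x. dist (s n x) x < inverse (Suc n)"
    "\<And>n a. s n -` {a} \<in> sets borel"
    using fine_step_functions[OF K] by blast
  let ?S = "\<lambda>n y. \<Sum>a\<in>T n. complex_of_real (measure M (s n -` {a})) * F a y"
  have lim: "(\<lambda>n. ?S n y) \<longlonglongrightarrow> (\<integral>x. F x y \<partial>M)" for y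
    by (rule integral_step_tendsto[OF K F1 M s])
  have Sm: "?S n \<in> borel_measurable N" for n
    by (intro borel_measurable_sum borel_measurable_times measurable_continuous_borel[OF N(2) F2]) auto
  have "(\<lambda>n. \<integral>y. ?S n y \<partial>N) \<longlonglongrightarrow> (\<integral>y. (\<integral>x. F x y \<partial>M) \<partial>N)"
  proof (rule integral_dominated_convergence[where w = "\<lambda>_. measure M UNIV * B"])
    show "integrable N (\<lambda>_. measure M UNIV * B)" by (rule finite_measure.integrable_const[OF N(1)])
    \<comment> \<open>Measurable as a pointwise limit of the step sums.\<close>
    show "(\<lambda>y. \<integral>x. F x y \<partial>M) \<in> borel_measurable N"
      by (rule borel_measurable_LIMSEQ_metric[OF Sm lim])
    show "AE y in N. cmod (?S n y) \<le> measure M UNIV * B" for n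
    proof (rule AE_I2)
      fix y
      have "cmod (?S n y) = cmod (\<integral>x. F (s n x) y \<partial>M)"
        using integral_step_function(2)[OF M s(1,2,4), of "\<lambda>x. F x y" n] by simp
      also have "\<dots> \<le> (\<integral>x. B \<partial>M)"
        using integral_step_function(1)[OF M s(1,2,4), of "\<lambda>x. F x y" n] B'
        by (intro cmod_integral_le finite_measure.integrable_const[OF M(1)]) auto
      also have "\<dots> = measure M UNIV * B"
        using sets_eq_imp_space_eq[OF M(2)] by simp
      finally show "cmod (?S n y) \<le> measure M UNIV * B" .
    qed
  qed (use Sm lim in auto)
  also have "(\<lambda>n. \<integral>y. ?S n y \<partial>N) =
      (\<lambda>n. \<Sum>a\<in>T n. complex_of_real (measure M (s n -` {a})) * (\<integral>y. F a y \<partial>N))"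
    by (intro ext, subst Bochner_Integration.integral_sum)
      (auto intro!: integrable_continuous_compact[OF K F2 N])
  \<comment> \<open>The integrated step sums are also the step sums of the inner integral over
    \<open>N\<close>, which is continuous by \<open>c\<close>; both iterated integrals are limits of
    one sequence.\<close>
  finally show ?fub
    using integral_step_tendsto[OF K c M s] LIMSEQ_unique by blast
qed

section \<open>Sums, multiples and point masses among the regular complex measures\<close>

lemma total_variation_upper:
  assumes "finite P" "P \<subseteq> sets borel" "disjoint P" "\<Union>P \<subseteq> A"
  shows "(\<Sum>B\<in>P. ennreal (cmod (\<mu> B))) \<le> total_variation \<mu> A"
  unfolding total_variation_def using assms by (intro SUP_upper) auto

lemma total_variation_least:
  assumes "\<And>P. finite P \<Longrightarrow> P \<subseteq> sets borel \<Longrightarrow> disjoint P \<Longrightarrow> \<Union>P \<subseteq> A \<Longrightarrow>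
    (\<Sum>B\<in>P. ennreal (cmod (\<mu> B))) \<le> c"
  shows "total_variation \<mu> A \<le> c"
  unfolding total_variation_def using assms by (intro SUP_least) auto

lemma total_variation_mono: "A \<subseteq> B \<Longrightarrow> total_variation \<mu> A \<le> total_variation \<mu> B"
  by (intro total_variation_least total_variation_upper) auto

lemma cmod_le_total_variation: "A \<in> sets borel \<Longrightarrow> ennreal (cmod (\<mu> A)) \<le> total_variation \<mu> A"
  using total_variation_upper[of "{A}" A \<mu>] by simp

lemma total_variation_add:
  "total_variation (\<lambda>A. \<mu> A + \<nu> A) A \<le> total_variation \<mu> A + total_variation \<nu> A"
proof (rule total_variation_least)
  fix P :: "'a set set" assume P: "finite P" "P \<subseteq> sets borel" "disjoint P" "\<Union>P \<subseteq> A"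
  have "(\<Sum>B\<in>P. ennreal (cmod (\<mu> B + \<nu> B))) \<le>
      (\<Sum>B\<in>P. ennreal (cmod (\<mu> B)) + ennreal (cmod (\<nu> B)))"
    by (intro sum_mono) (simp add: ennreal_plus[symmetric] norm_triangle_ineq del: ennreal_plus)
  also have "\<dots> \<le> total_variation \<mu> A + total_variation \<nu> A"
    unfolding sum.distrib by (intro add_mono total_variation_upper P)
  finally show "(\<Sum>B\<in>P. ennreal (cmod (\<mu> B + \<nu> B))) \<le> total_variation \<mu> A + total_variation \<nu> A" .
qed

lemma total_variation_dominated:
  assumes "\<And>B. B \<in> sets borel \<Longrightarrow> cmod (\<mu> B) \<le> r * cmod (\<nu> B)" "r \<ge> 0"
  shows "total_variation \<mu> A \<le> ennreal r * total_variation \<nu> A"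
proof (rule total_variation_least)
  fix P :: "'a set set" assume P: "finite P" "P \<subseteq> sets borel" "disjoint P" "\<Union>P \<subseteq> A"
  have "(\<Sum>B\<in>P. ennreal (cmod (\<mu> B))) \<le> (\<Sum>B\<in>P. ennreal r * ennreal (cmod (\<nu> B)))"
    using assms P by (intro sum_mono) (auto simp: ennreal_mult[symmetric] intro!: ennreal_leI)
  also have "\<dots> \<le> ennreal r * total_variation \<nu> A"
    unfolding sum_distrib_left[symmetric] by (intro mult_left_mono total_variation_upper P) auto
  finally show "(\<Sum>B\<in>P. ennreal (cmod (\<mu> B))) \<le> ennreal r * total_variation \<nu> A" .
qed

lemma cmeasuresI:
  assumes "\<And>A. A \<notin> sets borel \<Longrightarrow> \<mu> A = 0"
    and "\<And>A :: nat \<Rightarrow> 'a::t2_space set. range A \<subseteq> sets borel \<Longrightarrow> disjoint_family A \<Longrightarrow>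
      (\<lambda>n. \<mu> (A n)) sums \<mu> (\<Union>n. A n)"
    and "total_variation \<mu> UNIV < \<infinity>"
    and "\<And>A \<epsilon>. A \<in> sets borel \<Longrightarrow> 0 < \<epsilon> \<Longrightarrow> \<exists>C U. compact C \<and> open U \<and> C \<subseteq> A \<and> A \<subseteq> U \<and>
      total_variation \<mu> (U - C) < ennreal \<epsilon>"
  shows "\<mu> \<in> cmeasures"
  unfolding cmeasures_def mem_Collect_eq using assms by (intro conjI allI impI ballI)

lemma
  assumes "\<mu> \<in> cmeasures"
  shows cmeasures_notin: "A \<notin> sets borel \<Longrightarrow> \<mu> A = 0"
    and cmeasures_sums: "range F \<subseteq> sets borel \<Longrightarrow> disjoint_family F \<Longrightarrow>
      (\<lambda>n. \<mu> (F n)) sums \<mu> (\<Union>n::nat. F n)"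
    and cmeasures_finite: "total_variation \<mu> UNIV < \<infinity>"
  using assms unfolding cmeasures_def mem_Collect_eq by (elim conjE, simp)+

lemma cmeasures_regularE:
  assumes "\<mu> \<in> cmeasures" "A \<in> sets borel" "\<epsilon> > 0"
  obtains C U where "compact C" "open U" "C \<subseteq> A" "A \<subseteq> U" "total_variation \<mu> (U - C) < ennreal \<epsilon>"
proof -
  have "\<forall>A\<in>sets borel. \<forall>\<epsilon>>0. \<exists>C U. compact C \<and> open U \<and> C \<subseteq> A \<and> A \<subseteq> U \<and>
      total_variation \<mu> (U - C) < ennreal \<epsilon>"
    using assms(1) unfolding cmeasures_def mem_Collect_eq by (elim conjE)
  from this[rule_format, OF assms(2,3)] show ?thesis using that by (elim exE conjE)
qed

lemma cmeasures_add:
  assumes \<mu>: "\<mu> \<in> cmeasures" and \<nu>: "\<nu> \<in> cmeasures"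
  shows "(\<lambda>A. \<mu> A + \<nu> A) \<in> cmeasures"
proof -
  have "\<exists>C U. compact C \<and> open U \<and> C \<subseteq> A \<and> A \<subseteq> U \<and>
      total_variation (\<lambda>A. \<mu> A + \<nu> A) (U - C) < ennreal \<epsilon>"
    if A: "A \<in> sets borel" "\<epsilon> > 0" for A \<epsilon>
  proof -
    from A have "\<epsilon>/2 > 0" by simp
    obtain C1 U1 where 1: "compact C1" "open U1" "C1 \<subseteq> A" "A \<subseteq> U1"
        "total_variation \<mu> (U1 - C1) < ennreal (\<epsilon>/2)"
      using cmeasures_regularE[OF \<mu> A(1) \<open>\<epsilon>/2 > 0\<close>] .
    obtain C2 U2 where 2: "compact C2" "open U2" "C2 \<subseteq> A" "A \<subseteq> U2"
        "total_variation \<nu> (U2 - C2) < ennreal (\<epsilon>/2)"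
      using cmeasures_regularE[OF \<nu> A(1) \<open>\<epsilon>/2 > 0\<close>] .
    have "total_variation (\<lambda>A. \<mu> A + \<nu> A) ((U1 \<inter> U2) - (C1 \<union> C2)) \<le>
        total_variation \<mu> (U1 - C1) + total_variation \<nu> (U2 - C2)"
      by (rule order_trans[OF total_variation_add]) (intro add_mono total_variation_mono; auto)
    also have "\<dots> < ennreal (\<epsilon>/2) + ennreal (\<epsilon>/2)" using 1(5) 2(5) by (rule add_strict_mono)
    also have "\<dots> = ennreal \<epsilon>" using A(2) by (simp add: ennreal_plus[symmetric] del: ennreal_plus)
    finally show ?thesis using 1 2
      by (intro exI[of _ "C1 \<union> C2"] exI[of _ "U1 \<inter> U2"]) auto
  qed
  moreover have "total_variation (\<lambda>A. \<mu> A + \<nu> A) UNIV < \<infinity>"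
    by (rule le_less_trans[OF total_variation_add])
      (use cmeasures_finite[OF \<mu>] cmeasures_finite[OF \<nu>] in \<open>simp add: ennreal_add_less_top\<close>)
  ultimately show ?thesis
    by (intro cmeasuresI sums_add)
      (simp_all add: cmeasures_notin[OF \<mu>] cmeasures_notin[OF \<nu>] cmeasures_sums[OF \<mu>] cmeasures_sums[OF \<nu>])
qed

lemma cmeasures_scale:
  assumes \<mu>: "\<mu> \<in> cmeasures"
  shows "(\<lambda>A. c * \<mu> A) \<in> cmeasures"
proof -
  have tv: "total_variation (\<lambda>A. c * \<mu> A) A \<le> ennreal (cmod c) * total_variation \<mu> A" for A
    by (rule total_variation_dominated) (auto simp: norm_mult)
  have "\<exists>C U. compact C \<and> open U \<and> C \<subseteq> A \<and> A \<subseteq> U \<and>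
      total_variation (\<lambda>A. c * \<mu> A) (U - C) < ennreal \<epsilon>"
    if A: "A \<in> sets borel" "\<epsilon> > 0" for A \<epsilon>
  proof -
    \<comment> \<open>The denominator \<open>cmod c + 1\<close> also serves for
      \<open>c = 0\<close>.\<close>
    have e: "\<epsilon> / (cmod c + 1) > 0" using A by (simp add: add_nonneg_pos)
    obtain C U where 1: "compact C" "open U" "C \<subseteq> A" "A \<subseteq> U"
        "total_variation \<mu> (U - C) < ennreal (\<epsilon> / (cmod c + 1))"
      using cmeasures_regularE[OF \<mu> A(1) e] .
    have "total_variation (\<lambda>A. c * \<mu> A) (U - C) \<le> ennreal (cmod c) * ennreal (\<epsilon> / (cmod c + 1))"
      by (rule order_trans[OF tv]) (intro mult_left_mono; use 1 in auto)
    also have "\<dots> = ennreal (cmod c * (\<epsilon> / (cmod c + 1)))"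
      using e by (intro ennreal_mult[symmetric]) (auto intro: less_imp_le)
    also have "\<dots> < ennreal \<epsilon>"
      using A(2) by (intro ennreal_lessI) (auto simp: field_simps add_pos_nonneg)
    finally show ?thesis using 1 by blast
  qed
  moreover have "total_variation (\<lambda>A. c * \<mu> A) UNIV < \<infinity>"
    by (rule le_less_trans[OF tv])
      (use cmeasures_finite[OF \<mu>] in \<open>simp add: ennreal_mult_less_top\<close>)
  ultimately show ?thesis
    by (intro cmeasuresI sums_mult) (simp_all add: cmeasures_notin[OF \<mu>] cmeasures_sums[OF \<mu>])
qed

lemma pos_cmeasures_add:
  "\<mu> \<in> pos_cmeasures \<Longrightarrow> \<nu> \<in> pos_cmeasures \<Longrightarrow> (\<lambda>A. \<mu> A + \<nu> A) \<in> pos_cmeasures"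
  unfolding pos_cmeasures_def by (auto intro: cmeasures_add)

lemma pos_cmeasures_scale:
  "\<mu> \<in> pos_cmeasures \<Longrightarrow> r \<ge> 0 \<Longrightarrow> (\<lambda>A. complex_of_real r * \<mu> A) \<in> pos_cmeasures"
  unfolding pos_cmeasures_def by (auto intro!: cmeasures_scale)

lemma zero_pos_cmeasures: "(\<lambda>A. 0) \<in> pos_cmeasures"
proof -
  have "total_variation (\<lambda>A. 0) A = 0" for A :: "'a set"
    by (intro antisym total_variation_least) auto
  moreover have "\<exists>C U. compact C \<and> open U \<and> C \<subseteq> A \<and> A \<subseteq> U \<and>
      total_variation (\<lambda>A. 0) (U - C) < ennreal \<epsilon>" if "\<epsilon> > 0" for A :: "'a set" and \<epsilon>
    using that \<open>\<And>A. total_variation (\<lambda>A. 0) A = 0\<close>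
    by (intro exI[of _ "{}"] exI[of _ UNIV]) auto
  ultimately have "(\<lambda>A :: 'a set. 0) \<in> cmeasures" by (intro cmeasuresI) simp_all
  then show ?thesis by (simp add: pos_cmeasures_def)
qed

lemma pos_cmeasures_sum:
  assumes "finite I" "\<And>i. i \<in> I \<Longrightarrow> \<mu> i \<in> pos_cmeasures" "\<And>i. i \<in> I \<Longrightarrow> r i \<ge> 0"
  shows "(\<lambda>A. \<Sum>i\<in>I. complex_of_real (r i) * \<mu> i A) \<in> pos_cmeasures"
  using assms by (induction I) (auto intro!: zero_pos_cmeasures pos_cmeasures_add pos_cmeasures_scale)

lemma dirac_prob_cmeasures: "dirac (x :: 'a::t2_space) \<in> prob_cmeasures"
proof -
  have tv: "total_variation (dirac x) A = 0" if "x \<notin> A" for A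
  proof (intro antisym total_variation_least)
    fix P :: "'a set set" assume "\<Union>P \<subseteq> A"
    then have "(\<Sum>B\<in>P. ennreal (cmod (dirac x B))) = 0" using that
      by (intro sum.neutral) (auto simp: dirac_def)
    then show "(\<Sum>B\<in>P. ennreal (cmod (dirac x B))) \<le> 0" by simp
  qed auto
  have "total_variation (dirac x) UNIV \<le> 1"
  proof (rule total_variation_least)
    fix P :: "'a set set" assume P: "finite P" "disjoint P"
    have "(\<Sum>B\<in>P. ennreal (cmod (dirac x B))) \<le> (\<Sum>B\<in>P. if x \<in> B then 1 else 0)"
      by (intro sum_mono) (auto simp: dirac_def)
    also have "\<dots> = ennreal (card {B\<in>P. x \<in> B})" using P
      by (simp add: sum.If_cases Int_def ennreal_of_nat_eq_real_of_nat)
    also have "\<dots> \<le> ennreal 1"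
    proof -
      \<comment> \<open>The members of \<open>P\<close> are disjoint, so at most one of them
        contains \<open>x\<close>.\<close>
      have "card {B\<in>P. x \<in> B} \<le> 1"
        using P by (intro card_le_Suc0_iff_eq[THEN iffD2, unfolded One_nat_def[symmetric]])
          (auto simp: disjoint_def)
      then show ?thesis by (intro ennreal_leI) simp
    qed
    finally show "(\<Sum>B\<in>P. ennreal (cmod (dirac x B))) \<le> 1" by simp
  qed
  then have 1: "total_variation (dirac x) UNIV < \<infinity>" by (auto intro: le_less_trans)
  have 2: "(\<lambda>n. dirac x (A n)) sums dirac x (\<Union>n. A n)"
    if A: "range A \<subseteq> sets borel" "disjoint_family A" for A :: "nat \<Rightarrow> 'a set"
  proof (cases "x \<in> (\<Union>n. A n)")
    case True
    then obtain m where m: "x \<in> A m" by auto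
    then have "dirac x (A n) = (if n = m then 1 else 0)" for n
      using A by (auto simp: dirac_def disjoint_family_on_def)
    moreover have "dirac x (\<Union>n. A n) = 1" using True A by (auto simp: dirac_def)
    ultimately show ?thesis using sums_single[of m "\<lambda>_. 1::complex"] by simp
  next
    case False
    then show ?thesis by (auto simp: dirac_def)
  qed
  \<comment> \<open>Sets without \<open>x\<close> carry no variation, so \<open>{x}\<close> or the
    empty set inside, and the whole space or the complement of \<open>x\<close> outside, approximate
    well enough.\<close>
  have 3: "\<exists>C U. compact C \<and> open U \<and> C \<subseteq> A \<and> A \<subseteq> U \<and> total_variation (dirac x) (U - C) < ennreal \<epsilon>"
    if "\<epsilon> > 0" for A \<epsilon>
  proof (cases "x \<in> A")
    case True
    then show ?thesis using that tv[of "UNIV - {x}"]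
      by (intro exI[of _ "{x}"] exI[of _ UNIV]) auto
  next
    case False
    then show ?thesis using that tv[of "UNIV - {x}"]
      by (intro exI[of _ "{}"] exI[of _ "UNIV - {x}"]) auto
  qed
  have "dirac x \<in> cmeasures"
  proof (rule cmeasuresI)
    show "dirac x A = 0" if "A \<notin> sets borel" for A using that by (simp add: dirac_def)
    show "\<exists>C U. compact C \<and> open U \<and> C \<subseteq> A \<and> A \<subseteq> U \<and> total_variation (dirac x) (U - C) < ennreal \<epsilon>"
      if "\<epsilon> > 0" for A \<epsilon>
      using that by (rule 3)
  qed (fact 1 2)+
  then show ?thesis by (simp add: prob_cmeasures_def pos_cmeasures_def dirac_def)
qed

lemma dirac_pos_cmeasures: "dirac x \<in> pos_cmeasures"
  using dirac_prob_cmeasures by (auto simp: prob_cmeasures_def)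

lemma dirac_cmeasures: "dirac x \<in> cmeasures"
  using dirac_pos_cmeasures by (auto simp: pos_cmeasures_def)

section \<open>Integration against positive measures and the weak topology\<close>

lemma sets_to_measure [simp, measurable_cong]: "sets (to_measure \<mu>) = sets borel"
  unfolding to_measure_def by (simp add: sigma_algebra.sets_measure_of_eq sets.sigma_algebra_axioms
      sets.sigma_sets_eq[of borel, simplified])

lemma space_to_measure [simp]: "space (to_measure \<mu>) = UNIV"
  unfolding to_measure_def by (simp add: space_measure_of_conv)

lemma
  assumes \<mu>: "\<mu> \<in> pos_cmeasures"
  shows finite_to_measure: "finite_measure (to_measure \<mu>)"
    and measure_to_measure: "complex_of_real (measure (to_measure \<mu>) A) = \<mu> A"
proof -
  have nn: "0 \<le> Re (\<mu> A)" "complex_of_real (Re (\<mu> A)) = \<mu> A" for A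
    using \<mu> by (auto simp: pos_cmeasures_def complex_nonneg_Reals_iff complex_eq_iff)
  have em: "emeasure (to_measure \<mu>) A = ennreal (Re (\<mu> A))" if "A \<in> sets borel" for A
    unfolding to_measure_def
  proof (rule emeasure_measure_of_sigma)
    show "sigma_algebra UNIV (sets (borel::'a measure))"
      using sets.sigma_algebra_axioms[of borel] by simp
    have s: "(\<lambda>n. \<mu> (A n)) sums \<mu> (\<Union>n. A n)"
      if "range A \<subseteq> sets borel" "disjoint_family A" for A :: "nat \<Rightarrow> 'a set"
      using \<mu> that by (intro cmeasures_sums) (simp_all add: pos_cmeasures_def)
    have "\<mu> {} = 0"
    proof -
      \<comment> \<open>The empty set repeated is a disjoint family, and a constant series converges
        only for the constant 0.\<close>
      have "(\<lambda>n::nat. \<mu> {}) sums \<mu> {}" using s[of "\<lambda>_. {}"] by (auto simp: disjoint_family_on_def)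
      then show ?thesis using sums_summable summable_const_iff by blast
    qed
    then show "positive (sets borel) (\<lambda>A. ennreal (Re (\<mu> A)))" by (auto simp: positive_def)
    show "countably_additive (sets borel) (\<lambda>A. ennreal (Re (\<mu> A)))"
    proof (rule countably_additiveI)
      fix A :: "nat \<Rightarrow> 'a set" assume A: "range A \<subseteq> sets borel" "disjoint_family A"
      have "(\<lambda>n. Re (\<mu> (A n))) sums Re (\<mu> (\<Union>n. A n))" using s[OF A] by (rule sums_Re)
      then show "(\<Sum>n. ennreal (Re (\<mu> (A n)))) = ennreal (Re (\<mu> (\<Union>n. A n)))"
        using nn(1) by (intro suminf_ennreal_eq) auto
    qed
  qed fact
  show "finite_measure (to_measure \<mu>)" by (rule finite_measureI) (simp add: em)
  show "complex_of_real (measure (to_measure \<mu>) A) = \<mu> A"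
  proof (cases "A \<in> sets borel")
    case True then show ?thesis using nn by (simp add: measure_def em)
  next
    case False
    then have "\<mu> A = 0" using \<mu> by (intro cmeasures_notin) (simp_all add: pos_cmeasures_def)
    then show ?thesis using False by (simp add: measure_notin_sets)
  qed
qed

lemma integrable_to_measure:
  fixes f :: "'a::t2_space \<Rightarrow> complex"
  assumes "compact (UNIV :: 'a set)" "continuous_on UNIV f" "\<mu> \<in> pos_cmeasures"
  shows "integrable (to_measure \<mu>) f"
  by (rule integrable_continuous_compact[OF assms(1,2) finite_to_measure[OF assms(3)]]) simp

definition weak_subbasis :: "'a::t2_space cmeasure set set" where
  "weak_subbasis = {{\<mu> \<in> pos_cmeasures. (\<integral>x. f x \<partial>to_measure \<mu>) \<in> U} | (f :: 'a \<Rightarrow> complex) U.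
        continuous_on UNIV f \<and> open U}"

lemma weak_cone_eq: "weak_cone = topology_generated_by weak_subbasis"
  by (simp only: weak_cone_def weak_subbasis_def)

lemma weak_subbasisI:
  "continuous_on UNIV (f :: 'a::t2_space \<Rightarrow> complex) \<Longrightarrow> open U \<Longrightarrow>
    {\<mu> \<in> pos_cmeasures. (\<integral>x. f x \<partial>to_measure \<mu>) \<in> U} \<in> weak_subbasis"
  unfolding weak_subbasis_def by blast

lemma weak_subbasisE:
  assumes "V \<in> weak_subbasis"
  obtains f :: "'a::t2_space \<Rightarrow> complex" and U where "continuous_on UNIV f" "open U"
    "V = {\<mu> \<in> pos_cmeasures. (\<integral>x. f x \<partial>to_measure \<mu>) \<in> U}"
  using assms unfolding weak_subbasis_def by blast

lemma Union_weak_subbasis: "\<Union>weak_subbasis = pos_cmeasures"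
proof
  show "\<Union>weak_subbasis \<subseteq> pos_cmeasures" unfolding weak_subbasis_def by blast
  have "{\<mu> \<in> pos_cmeasures. (\<integral>x. 0 \<partial>to_measure \<mu>) \<in> (UNIV :: complex set)} \<in> weak_subbasis"
    by (intro weak_subbasisI) auto
  then show "pos_cmeasures \<subseteq> \<Union>weak_subbasis" by auto
qed

lemma topspace_weak_cone [simp]: "topspace weak_cone = pos_cmeasures"
  by (simp only: weak_cone_eq topology_generated_by_topspace Union_weak_subbasis)

lemma continuous_integral_weak_cone:
  fixes f :: "'a::t2_space \<Rightarrow> complex"
  assumes "continuous_on UNIV f"
  shows "continuous_map weak_cone euclidean (\<lambda>\<mu>. \<integral>x. f x \<partial>to_measure \<mu>)"
  unfolding continuous_map
proof safe
  fix U :: "complex set" assume "openin euclidean U"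
  then show "openin weak_cone {\<mu> \<in> topspace weak_cone. (\<integral>x. f x \<partial>to_measure \<mu>) \<in> U}"
    using topology_generated_by_Basis[OF weak_subbasisI[OF assms, of U]]
    by (simp only: weak_cone_eq[symmetric] topspace_weak_cone open_openin)
qed auto

lemma integral_dirac:
  fixes f :: "'a::metric_space \<Rightarrow> complex"
  assumes K: "compact (UNIV :: 'a set)" and f: "continuous_on UNIV f"
  shows "(\<integral>t. f t \<partial>to_measure (dirac x)) = f x"
proof -
  let ?M = "to_measure (dirac x)"
  interpret finite_measure ?M by (rule finite_to_measure[OF dirac_pos_cmeasures])
  have "measure ?M {x} = measure ?M UNIV"
    using measure_to_measure[OF dirac_pos_cmeasures, of x "{x}"]
      measure_to_measure[OF dirac_pos_cmeasures, of x UNIV] by (simp add: dirac_def)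
  then have "emeasure ?M (UNIV - {x}) = 0"
    using finite_measure_Diff[of UNIV "{x}"] by (simp add: emeasure_eq_measure)
  then have "AE t in ?M. t = x" by (intro AE_I[of _ _ "UNIV - {x}"]) auto
  then have "(\<integral>t. f t \<partial>?M) = (\<integral>t. f x \<partial>?M)"
    using measurable_continuous_borel[OF _ f, of ?M] by (intro integral_cong_AE) auto
  then show ?thesis using measure_to_measure[OF dirac_pos_cmeasures, of x UNIV]
    by (simp add: dirac_def scaleR_conv_of_real)
qed

text \<open>Integration against a point mass is evaluation, so a subbasic set given by
  \<open>f\<close> and \<open>V\<close> pulls back to the preimage of \<open>V\<close> under
  \<open>f\<close>.\<close>

lemma continuous_dirac:
  assumes K: "compact (UNIV :: 'a::metric_space set)"
  shows "continuous_map euclidean weak_cone (dirac :: 'a \<Rightarrow> _)"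
  unfolding weak_cone_eq
proof (rule continuous_on_generated_topo)
  fix U :: "'a cmeasure set"
  assume "U \<in> weak_subbasis"
  then obtain f :: "'a \<Rightarrow> complex" and V where f: "continuous_on UNIV f" "open V"
    "U = {\<mu> \<in> pos_cmeasures. (\<integral>x. f x \<partial>to_measure \<mu>) \<in> V}" by (rule weak_subbasisE)
  have "dirac -` U = f -` V" using integral_dirac[OF K f(1)] dirac_pos_cmeasures f(3) by auto
  then show "openin euclidean (dirac -` U \<inter> topspace euclidean)"
    using open_vimage[OF f(2,1)] by simp
qed (auto simp: Union_weak_subbasis dirac_pos_cmeasures)

text \<open>Eventual membership passes to finite intersections and to unions, so an induction over
  the generated topology reduces convergence to the subbasis.\<close>

lemma limitin_topology_generated_by:
  assumes "l \<in> \<Union>S" "\<And>U. U \<in> S \<Longrightarrow> l \<in> U \<Longrightarrow> eventually (\<lambda>x. f x \<in> U) F"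
  shows "limitin (topology_generated_by S) f l F"
  unfolding limitin_def topology_generated_by_topspace
proof safe
  show "l \<in> \<Union>S" by fact
  fix U assume "openin (topology_generated_by S) U" "l \<in> U"
  then have "generate_topology_on S U" by (simp add: openin_topology_generated_by_iff)
  then show "eventually (\<lambda>x. f x \<in> U) F" using \<open>l \<in> U\<close>
  proof induction
    case (UN K)
    then obtain k where k: "k \<in> K" "l \<in> k" by auto
    with UN have "eventually (\<lambda>x. f x \<in> k) F" by auto
    then show ?case by eventually_elim (use k in auto)
  qed (auto intro: eventually_conj assms(2))
qed

text \<open>Partial sums stay in the cone, where additivity is known. Applied both to integrals and
  to an abstract functional, at the same discrete measures.\<close>

lemma additive_sum:
  fixes \<Lambda> :: "'a::t2_space cmeasure \<Rightarrow> complex"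
  assumes add: "\<And>\<mu> \<nu>. \<mu> \<in> pos_cmeasures \<Longrightarrow> \<nu> \<in> pos_cmeasures \<Longrightarrow> \<Lambda> (\<lambda>A. \<mu> A + \<nu> A) = \<Lambda> \<mu> + \<Lambda> \<nu>"
    and scale: "\<And>r \<mu>. r \<ge> 0 \<Longrightarrow> \<mu> \<in> pos_cmeasures \<Longrightarrow>
      \<Lambda> (\<lambda>A. complex_of_real r * \<mu> A) = complex_of_real r * \<Lambda> \<mu>"
    and "finite I" "\<And>i. i \<in> I \<Longrightarrow> \<mu> i \<in> pos_cmeasures" "\<And>i. i \<in> I \<Longrightarrow> r i \<ge> 0"
  shows "\<Lambda> (\<lambda>A. \<Sum>i\<in>I. complex_of_real (r i) * \<mu> i A) = (\<Sum>i\<in>I. complex_of_real (r i) * \<Lambda> (\<mu> i))"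
  using assms(3-)
proof (induction I)
  case empty
  \<comment> \<open>Homogeneity with factor 0 gives the value at the zero measure.\<close>
  then show ?case using scale[OF _ zero_pos_cmeasures, of 0] by simp
next
  case (insert i I)
  then show ?case
    by (simp add: add scale pos_cmeasures_scale pos_cmeasures_sum)
qed

text \<open>The step sums converging to each integral are linear in the values of the measure on the
  fibres of \<open>s n\<close>, and the identity passes to the limit.\<close>

lemma integral_to_measure_add:
  fixes f :: "'a::metric_space \<Rightarrow> complex"
  assumes K: "compact (UNIV :: 'a set)" and f: "continuous_on UNIV f"
    and \<mu>: "\<mu> \<in> pos_cmeasures" and \<nu>: "\<nu> \<in> pos_cmeasures"
  shows "(\<integral>x. f x \<partial>to_measure (\<lambda>A. \<mu> A + \<nu> A)) = (\<integral>x. f x \<partial>to_measure \<mu>) + (\<integral>x. f x \<partial>to_measure \<nu>)"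
proof -
  obtain T :: "nat \<Rightarrow> 'a set" and s :: "nat \<Rightarrow> 'a \<Rightarrow> 'a"
    where s: "\<And>n. finite (T n)" "\<And>n x. s n x \<in> T n" "\<And>n x. dist (s n x) x < inverse (Suc n)"
    "\<And>n a. s n -` {a} \<in> sets borel"
    using fine_step_functions[OF K] by blast
  note lim = integral_step_tendsto[OF K f finite_to_measure sets_to_measure s,
      unfolded measure_to_measure]
  have "(\<lambda>n. (\<Sum>a\<in>T n. \<mu> (s n -` {a}) * f a) + (\<Sum>a\<in>T n. \<nu> (s n -` {a}) * f a))
      \<longlonglongrightarrow> (\<integral>x. f x \<partial>to_measure \<mu>) + (\<integral>x. f x \<partial>to_measure \<nu>)"
    using lim[OF \<mu>] lim[OF \<nu>] \<mu> \<nu> by (intro tendsto_add) (simp_all add: measure_to_measure)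
  moreover have "(\<lambda>n. \<Sum>a\<in>T n. (\<mu> (s n -` {a}) + \<nu> (s n -` {a})) * f a)
      \<longlonglongrightarrow> (\<integral>x. f x \<partial>to_measure (\<lambda>A. \<mu> A + \<nu> A))"
    using lim[OF pos_cmeasures_add[OF \<mu> \<nu>]]
    by (simp add: measure_to_measure[OF pos_cmeasures_add[OF \<mu> \<nu>]])
  ultimately show ?thesis
    using LIMSEQ_unique by (fastforce simp: distrib_right sum.distrib)
qed

lemma integral_to_measure_scale:
  fixes f :: "'a::metric_space \<Rightarrow> complex"
  assumes K: "compact (UNIV :: 'a set)" and f: "continuous_on UNIV f"
    and \<mu>: "\<mu> \<in> pos_cmeasures" and "r \<ge> 0"
  shows "(\<integral>x. f x \<partial>to_measure (\<lambda>A. complex_of_real r * \<mu> A)) = complex_of_real r * (\<integral>x. f x \<partial>to_measure \<mu>)"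
proof -
  obtain T :: "nat \<Rightarrow> 'a set" and s :: "nat \<Rightarrow> 'a \<Rightarrow> 'a"
    where s: "\<And>n. finite (T n)" "\<And>n x. s n x \<in> T n" "\<And>n x. dist (s n x) x < inverse (Suc n)"
    "\<And>n a. s n -` {a} \<in> sets borel"
    using fine_step_functions[OF K] by blast
  note lim = integral_step_tendsto[OF K f finite_to_measure sets_to_measure s]
  note r\<mu> = pos_cmeasures_scale[OF \<mu> \<open>r \<ge> 0\<close>]
  have "(\<lambda>n. complex_of_real r * (\<Sum>a\<in>T n. \<mu> (s n -` {a}) * f a))
      \<longlonglongrightarrow> complex_of_real r * (\<integral>x. f x \<partial>to_measure \<mu>)"
    using lim[OF \<mu>] \<mu> by (intro tendsto_mult_left) (simp_all add: measure_to_measure)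
  moreover have "(\<lambda>n. \<Sum>a\<in>T n. (complex_of_real r * \<mu> (s n -` {a})) * f a)
      \<longlonglongrightarrow> (\<integral>x. f x \<partial>to_measure (\<lambda>A. complex_of_real r * \<mu> A))"
    using lim[OF r\<mu>] by (simp add: measure_to_measure[OF r\<mu>])
  ultimately show ?thesis
    using LIMSEQ_unique by (fastforce simp: sum_distrib_left mult.assoc)
qed

text \<open>Discrete measures are weakly dense in the cone, so a continuous linear functional is determined
  by its values at point measures.\<close>

lemma weak_cone_functional_eq_integral:
  fixes \<Lambda> :: "'a::metric_space cmeasure \<Rightarrow> complex"
  assumes K: "compact (UNIV :: 'a set)"
    and cont: "continuous_map weak_cone euclidean \<Lambda>"
    and add: "\<And>\<mu> \<nu>. \<mu> \<in> pos_cmeasures \<Longrightarrow> \<nu> \<in> pos_cmeasures \<Longrightarrow> \<Lambda> (\<lambda>A. \<mu> A + \<nu> A) = \<Lambda> \<mu> + \<Lambda> \<nu>"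
    and scale: "\<And>r \<mu>. r \<ge> 0 \<Longrightarrow> \<mu> \<in> pos_cmeasures \<Longrightarrow>
      \<Lambda> (\<lambda>A. complex_of_real r * \<mu> A) = complex_of_real r * \<Lambda> \<mu>"
    and \<mu>: "\<mu> \<in> pos_cmeasures"
  shows "\<Lambda> \<mu> = (\<integral>t. \<Lambda> (dirac t) \<partial>to_measure \<mu>)"
    and "continuous_on UNIV (\<lambda>t. \<Lambda> (dirac t))"
proof -
  show c: "continuous_on UNIV (\<lambda>t. \<Lambda> (dirac t))"
    using continuous_map_compose[OF continuous_dirac[OF K] cont] by (simp add: o_def)
  obtain T :: "nat \<Rightarrow> 'a set" and s :: "nat \<Rightarrow> 'a \<Rightarrow> 'a"
    where s: "\<And>n. finite (T n)" "\<And>n x. s n x \<in> T n" "\<And>n x. dist (s n x) x < inverse (Suc n)"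
    "\<And>n a. s n -` {a} \<in> sets borel"
    using fine_step_functions[OF K] by blast
  note lim = integral_step_tendsto[OF K _ finite_to_measure[OF \<mu>] sets_to_measure s]
  \<comment> \<open>\<open>\<nu> n\<close> moves the mass of each fibre of \<open>s n\<close> to the
    value taken there; integrals against it are step sums for \<mu>.\<close>
  define \<nu> where "\<nu> n = (\<lambda>A. \<Sum>a\<in>T n. complex_of_real (measure (to_measure \<mu>) (s n -` {a})) * dirac a A)" for n
  have \<nu>: "\<nu> n \<in> pos_cmeasures" for n
    unfolding \<nu>_def by (intro pos_cmeasures_sum s dirac_pos_cmeasures) auto
  have int: "(\<integral>t. f t \<partial>to_measure (\<nu> n)) =
      (\<Sum>a\<in>T n. complex_of_real (measure (to_measure \<mu>) (s n -` {a})) * f a)"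
    if "continuous_on UNIV f" for f n
    unfolding \<nu>_def using that
    by (subst additive_sum[where \<Lambda> = "\<lambda>\<mu>. \<integral>t. f t \<partial>to_measure \<mu>"])
      (auto intro!: integral_to_measure_add[OF K] integral_to_measure_scale[OF K]
        simp: s dirac_pos_cmeasures integral_dirac[OF K])
  have "limitin weak_cone \<nu> \<mu> sequentially"
    unfolding weak_cone_eq
  proof (rule limitin_topology_generated_by)
    show "\<mu> \<in> \<Union>weak_subbasis" using \<mu> by (simp add: Union_weak_subbasis)
  next
    fix U :: "'a cmeasure set" assume U: "U \<in> weak_subbasis" "\<mu> \<in> U"
    from U(1) obtain f :: "'a \<Rightarrow> complex" and V where f: "continuous_on UNIV f" "open V"
      "U = {\<mu> \<in> pos_cmeasures. (\<integral>x. f x \<partial>to_measure \<mu>) \<in> V}" by (rule weak_subbasisE)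
    have "(\<lambda>n. \<integral>t. f t \<partial>to_measure (\<nu> n)) \<longlonglongrightarrow> (\<integral>t. f t \<partial>to_measure \<mu>)"
      using lim[OF f(1)] by (simp add: int[OF f(1)])
    then have "eventually (\<lambda>n. (\<integral>t. f t \<partial>to_measure (\<nu> n)) \<in> V) sequentially"
      using f U by (auto simp: tendsto_def)
    then show "eventually (\<lambda>n. \<nu> n \<in> U) sequentially" using \<nu> f by simp
  qed
  from continuous_map_limit[OF cont this] have "(\<lambda>n. \<Lambda> (\<nu> n)) \<longlonglongrightarrow> \<Lambda> \<mu>"
    by (simp add: o_def)
  \<comment> \<open>By linearity these values are the step sums of the continuous function sending t
    to \<open>\<Lambda> (dirac t)\<close>, so they also tend to its integral.\<close>
  also have "(\<lambda>n. \<Lambda> (\<nu> n)) = (\<lambda>n. \<Sum>a\<in>T n. complex_of_real (measure (to_measure \<mu>) (s n -` {a})) * \<Lambda> (dirac a))"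
    unfolding \<nu>_def by (intro ext additive_sum add scale s dirac_pos_cmeasures) auto
  finally show "\<Lambda> \<mu> = (\<integral>t. \<Lambda> (dirac t) \<partial>to_measure \<mu>)"
    using lim[OF c] LIMSEQ_unique by blast
qed

section \<open>Total variation\<close>

text \<open>Finite families inside \<open>A\<close> and inside \<open>B\<close> unite to one inside
  the union; they can share only the empty set, where \<mu> is 0.\<close>

lemma total_variation_superadditive:
  assumes "A \<inter> B = {}" "\<mu> {} = 0"
  shows "total_variation \<mu> A + total_variation \<mu> B \<le> total_variation \<mu> (A \<union> B)"
proof -
  let ?P = "\<lambda>A. {P. finite P \<and> P \<subseteq> sets borel \<and> disjoint P \<and> \<Union>P \<subseteq> A}"
  have le: "(\<Sum>C\<in>P. ennreal (cmod (\<mu> C))) + (\<Sum>C\<in>Q. ennreal (cmod (\<mu> C))) \<le> total_variation \<mu> (A \<union> B)"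
    if P: "P \<in> ?P A" and Q: "Q \<in> ?P B" for P Q
  proof -
    have "P \<inter> Q \<subseteq> {{}}"
    proof
      fix C assume "C \<in> P \<inter> Q"
      then have "C \<subseteq> A" "C \<subseteq> B" using P Q by blast+
      then show "C \<in> {{}}" using assms(1) by blast
    qed
    then have "(\<Sum>C\<in>P \<inter> Q. ennreal (cmod (\<mu> C))) = 0"
      using assms(2) by (intro sum.neutral) auto
    then have "(\<Sum>C\<in>P. ennreal (cmod (\<mu> C))) + (\<Sum>C\<in>Q. ennreal (cmod (\<mu> C))) = (\<Sum>C\<in>P \<union> Q. ennreal (cmod (\<mu> C)))"
      using P Q sum.union_inter[of P Q "\<lambda>C. ennreal (cmod (\<mu> C))"] by simp
    also have "\<dots> \<le> total_variation \<mu> (A \<union> B)"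
    proof (rule total_variation_upper)
      have "C \<inter> C' = {}" if "C \<in> P" "C' \<in> Q" for C C'
        using P Q that assms(1) by blast
      then show "disjoint (P \<union> Q)" using P Q by (intro disjoint_union) blast+
    qed (use P Q in auto)
    finally show ?thesis .
  qed
  have ne: "?P A \<noteq> {}" for A
    by (auto intro!: exI[of _ "{}"] simp: disjoint_def)
  have "total_variation \<mu> A + total_variation \<mu> B =
      (SUP P\<in>?P A. (\<Sum>C\<in>P. ennreal (cmod (\<mu> C))) + total_variation \<mu> B)"
    unfolding total_variation_def[of \<mu> A] by (rule ennreal_SUP_add_left[OF ne, symmetric])
  also have "\<dots> = (SUP P\<in>?P A. SUP Q\<in>?P B. (\<Sum>C\<in>P. ennreal (cmod (\<mu> C))) + (\<Sum>C\<in>Q. ennreal (cmod (\<mu> C))))"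
    unfolding total_variation_def[of \<mu> B] by (intro SUP_cong refl ennreal_SUP_add_right[OF ne])
  also have "\<dots> \<le> total_variation \<mu> (A \<union> B)"
    using le by (intro SUP_least)
  finally show ?thesis .
qed

lemma total_variation_sum_le:
  assumes "finite I" "disjoint_family_on A I" "\<mu> {} = 0"
  shows "(\<Sum>i\<in>I. total_variation \<mu> (A i)) \<le> total_variation \<mu> (\<Union>i\<in>I. A i)"
  using assms(1,2)
proof (induction I)
  case (insert i I)
  have "(\<Sum>i\<in>insert i I. total_variation \<mu> (A i)) \<le> total_variation \<mu> (A i) + total_variation \<mu> (\<Union>i\<in>I. A i)"
    using insert by (simp add: disjoint_family_on_mono[of I "insert i I"] subset_insertI add_left_mono)
  also have "\<dots> \<le> total_variation \<mu> (A i \<union> (\<Union>i\<in>I. A i))"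
    using insert by (intro total_variation_superadditive assms) (auto simp: disjoint_family_on_def)
  finally show ?case by simp
qed simp

lemma cmeasures_empty:
  assumes "\<mu> \<in> cmeasures"
  shows "\<mu> {} = 0"
proof -
  have "(\<lambda>n::nat. \<mu> {}) sums \<mu> (\<Union>n::nat. {})"
    by (rule cmeasures_sums[OF assms]) (auto simp: disjoint_family_on_def)
  then show ?thesis using sums_summable summable_const_iff by blast
qed

text \<open>One direction is finite superadditivity. For the other, each member of a finite family
  is cut along the \<open>A n\<close>, the triangle inequality is applied to the resulting series,
  and the two summations are exchanged.\<close>

lemma total_variation_countably_additive:
  fixes A :: "nat \<Rightarrow> 'a::t2_space set"
  assumes \<mu>: "\<mu> \<in> cmeasures" and A: "range A \<subseteq> sets borel" "disjoint_family A"
  shows "(\<Sum>n. total_variation \<mu> (A n)) = total_variation \<mu> (\<Union>n. A n)"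
proof (rule antisym)
  show "(\<Sum>n. total_variation \<mu> (A n)) \<le> total_variation \<mu> (\<Union>n. A n)"
  proof (rule suminf_le_const[OF summableI])
    fix n
    have "(\<Sum>i<n. total_variation \<mu> (A i)) \<le> total_variation \<mu> (\<Union>i<n. A i)"
      using A by (intro total_variation_sum_le cmeasures_empty \<mu>) (auto simp: disjoint_family_on_def)
    also have "\<dots> \<le> total_variation \<mu> (\<Union>n. A n)" by (intro total_variation_mono) auto
    finally show "(\<Sum>i<n. total_variation \<mu> (A i)) \<le> total_variation \<mu> (\<Union>n. A n)" .
  qed
  show "total_variation \<mu> (\<Union>n. A n) \<le> (\<Sum>n. total_variation \<mu> (A n))"
  proof (rule total_variation_least)
    fix P :: "'a set set" assume P: "finite P" "P \<subseteq> sets borel" "disjoint P" "\<Union>P \<subseteq> (\<Union>n. A n)"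
    have 1: "ennreal (cmod (\<mu> B)) \<le> (\<Sum>n. ennreal (cmod (\<mu> (B \<inter> A n))))" if B: "B \<in> P" for B
    proof -
      have "(\<lambda>n. \<mu> (B \<inter> A n)) sums \<mu> (\<Union>n. B \<inter> A n)"
        using A P B by (intro cmeasures_sums[OF \<mu>]) (auto simp: disjoint_family_on_def)
      moreover have "(\<Union>n. B \<inter> A n) = B" using P B by auto
      ultimately have s: "(\<lambda>n. \<mu> (B \<inter> A n)) sums \<mu> B" by simp
      have "(\<lambda>n. ennreal (cmod (\<Sum>i<n. \<mu> (B \<inter> A i)))) \<longlonglongrightarrow> ennreal (cmod (\<mu> B))"
        using s unfolding sums_def by (intro tendsto_ennrealI tendsto_norm)
      then show ?thesis
      proof (rule LIMSEQ_le_const2)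
        have "ennreal (cmod (\<Sum>i<n. \<mu> (B \<inter> A i))) \<le> (\<Sum>n. ennreal (cmod (\<mu> (B \<inter> A n))))" for n
        proof -
          have "ennreal (cmod (\<Sum>i<n. \<mu> (B \<inter> A i))) \<le> ennreal (\<Sum>i<n. cmod (\<mu> (B \<inter> A i)))"
            by (intro ennreal_leI norm_sum)
          also have "\<dots> = (\<Sum>i<n. ennreal (cmod (\<mu> (B \<inter> A i))))" by simp
          also have "\<dots> \<le> (\<Sum>n. ennreal (cmod (\<mu> (B \<inter> A n))))" by (rule sum_le_suminf) auto
          finally show ?thesis .
        qed
        then show "\<exists>N. \<forall>n\<ge>N. ennreal (cmod (\<Sum>i<n. \<mu> (B \<inter> A i))) \<le> (\<Sum>n. ennreal (cmod (\<mu> (B \<inter> A n))))"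
          by blast
      qed
    qed
    have 2: "(\<Sum>B\<in>P. ennreal (cmod (\<mu> (B \<inter> A n)))) \<le> total_variation \<mu> (A n)" for n
    proof -
      have "(\<Sum>B\<in>P. ennreal (cmod (\<mu> (B \<inter> A n)))) = (\<Sum>C\<in>(\<lambda>B. B \<inter> A n) ` P. ennreal (cmod (\<mu> C)))"
      proof (rule sum.reindex_nontrivial[symmetric, unfolded o_def])
        \<comment> \<open>Different members have the same trace on \<open>A n\<close> only if that
          trace is empty, and then its value is 0.\<close>
        fix B C assume BC: "B \<in> P" "C \<in> P" "B \<noteq> C" "B \<inter> A n = C \<inter> A n"
        then have "B \<inter> C = {}" using P by (auto simp: disjoint_def)
        then have "B \<inter> A n = {}" using BC by auto
        then show "ennreal (cmod (\<mu> (B \<inter> A n))) = 0" using cmeasures_empty[OF \<mu>] by simp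
      qed fact
      also have "\<dots> \<le> total_variation \<mu> (A n)"
      proof (rule total_variation_upper)
        show "(\<lambda>B. B \<inter> A n) ` P \<subseteq> sets borel" using P A by auto
        show "disjoint ((\<lambda>B. B \<inter> A n) ` P)" using P(3) unfolding disjoint_def by blast
      qed (use P in auto)
      finally show ?thesis .
    qed
    have "(\<Sum>B\<in>P. ennreal (cmod (\<mu> B))) \<le> (\<Sum>B\<in>P. \<Sum>n. ennreal (cmod (\<mu> (B \<inter> A n))))"
      by (intro sum_mono 1)
    also have "\<dots> = (\<Sum>n. \<Sum>B\<in>P. ennreal (cmod (\<mu> (B \<inter> A n))))"
      by (rule suminf_sum[symmetric]) (rule summableI)
    also have "\<dots> \<le> (\<Sum>n. total_variation \<mu> (A n))"
      by (intro suminf_le 2 summableI)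
    finally show "(\<Sum>B\<in>P. ennreal (cmod (\<mu> B))) \<le> (\<Sum>n. total_variation \<mu> (A n))" .
  qed
qed

text \<open>The measure |\<mu>|, set to 0 off the Borel sets because membership in
  \<open>cmeasures\<close> demands it.\<close>

definition variation_measure :: "'a::t2_space cmeasure \<Rightarrow> 'a cmeasure" where
  "variation_measure \<mu> = (\<lambda>A. if A \<in> sets borel then complex_of_real (enn2real (total_variation \<mu> A)) else 0)"

lemma total_variation_finite: "\<mu> \<in> cmeasures \<Longrightarrow> total_variation \<mu> A < \<infinity>"
  using cmeasures_finite total_variation_mono[OF subset_UNIV] le_less_trans by blast

text \<open>A consequence of superadditivity, through which |\<mu>| inherits the regularity of
  \<mu>.\<close>

lemma total_variation_variation_measure:
  assumes \<mu>: "\<mu> \<in> cmeasures"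
  shows "total_variation (variation_measure \<mu>) A \<le> total_variation \<mu> A"
proof (rule total_variation_least)
  fix P :: "'a set set" assume P: "finite P" "P \<subseteq> sets borel" "disjoint P" "\<Union>P \<subseteq> A"
  have "(\<Sum>B\<in>P. ennreal (cmod (variation_measure \<mu> B))) = (\<Sum>B\<in>P. total_variation \<mu> B)"
    using P total_variation_finite[OF \<mu>]
    by (intro sum.cong refl) (auto simp: variation_measure_def ennreal_enn2real)
  also have "\<dots> \<le> total_variation \<mu> (\<Union>B\<in>P. B)"
    using P by (intro total_variation_sum_le cmeasures_empty \<mu>)
      (auto simp: disjoint_family_on_def disjoint_def)
  also have "\<dots> \<le> total_variation \<mu> A" using P by (intro total_variation_mono) auto
  finally show "(\<Sum>B\<in>P. ennreal (cmod (variation_measure \<mu> B))) \<le> total_variation \<mu> A" .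
qed

text \<open>The compact and open approximants chosen for \<mu> serve \<nu> as well.\<close>

lemma cmeasures_dominated:
  assumes \<mu>: "\<mu> \<in> cmeasures"
    and "\<And>A. A \<notin> sets borel \<Longrightarrow> \<nu> A = 0"
    and "\<And>A :: nat \<Rightarrow> 'a::t2_space set. range A \<subseteq> sets borel \<Longrightarrow> disjoint_family A \<Longrightarrow>
      (\<lambda>n. \<nu> (A n)) sums \<nu> (\<Union>n. A n)"
    and tv: "\<And>A. total_variation \<nu> A \<le> total_variation \<mu> A"
  shows "\<nu> \<in> cmeasures"
proof (rule cmeasuresI)
  show "total_variation \<nu> UNIV < \<infinity>" using tv cmeasures_finite[OF \<mu>] by (rule le_less_trans)
  fix A :: "'a set" and \<epsilon> :: real assume A: "A \<in> sets borel" "\<epsilon> > 0"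
  obtain C U where 1: "compact C" "open U" "C \<subseteq> A" "A \<subseteq> U" "total_variation \<mu> (U - C) < ennreal \<epsilon>"
    using cmeasures_regularE[OF \<mu> A] .
  then show "\<exists>C U. compact C \<and> open U \<and> C \<subseteq> A \<and> A \<subseteq> U \<and> total_variation \<nu> (U - C) < ennreal \<epsilon>"
    using le_less_trans[OF tv] by blast
qed (use assms in auto)

lemma variation_measure_pos_cmeasures:
  assumes \<mu>: "\<mu> \<in> cmeasures"
  shows "variation_measure \<mu> \<in> pos_cmeasures"
proof -
  have "variation_measure \<mu> \<in> cmeasures"
  proof (rule cmeasures_dominated[OF \<mu> _ _ total_variation_variation_measure[OF \<mu>]])
    fix A :: "nat \<Rightarrow> 'a set" assume A: "range A \<subseteq> sets borel" "disjoint_family A"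
    have fin: "ennreal (enn2real (total_variation \<mu> B)) = total_variation \<mu> B" for B
      using total_variation_finite[OF \<mu>] by (simp add: ennreal_enn2real)
    have "(\<lambda>n. ennreal (enn2real (total_variation \<mu> (A n)))) sums ennreal (enn2real (total_variation \<mu> (\<Union>n. A n)))"
      unfolding fin using total_variation_countably_additive[OF \<mu> A] summableI summable_sums by metis
    then have "(\<lambda>n. enn2real (total_variation \<mu> (A n))) sums enn2real (total_variation \<mu> (\<Union>n. A n))"
      by (subst (asm) sums_ennreal) auto
    then have "(\<lambda>n. complex_of_real (enn2real (total_variation \<mu> (A n)))) sums complex_of_real (enn2real (total_variation \<mu> (\<Union>n. A n)))"
      by (rule sums_of_real)
    moreover have "(\<Union>n. A n) \<in> sets borel" "A n \<in> sets borel" for n using A by auto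
    ultimately show "(\<lambda>n. variation_measure \<mu> (A n)) sums variation_measure \<mu> (\<Union>n. A n)"
      by (simp add: variation_measure_def)
  qed (simp add: variation_measure_def)
  then show ?thesis by (auto simp: pos_cmeasures_def variation_measure_def)
qed

lemma cmeasures_Re:
  assumes \<mu>: "\<mu> \<in> cmeasures"
  shows "(\<lambda>A. complex_of_real (Re (\<mu> A))) \<in> cmeasures"
proof (rule cmeasures_dominated[OF \<mu>])
  show "total_variation (\<lambda>A. complex_of_real (Re (\<mu> A))) A \<le> total_variation \<mu> A" for A
    using total_variation_dominated[of "\<lambda>A. complex_of_real (Re (\<mu> A))" 1 \<mu> A] abs_Re_le_cmod by simp
qed (auto intro!: sums_of_real sums_Re cmeasures_sums[OF \<mu>] simp: cmeasures_notin[OF \<mu>])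

text \<open>|\<mu>| + Re \<mu> and |\<mu>| + Im \<mu> are positive; the excess in the first plus i
  times the second is (1 + i) |\<mu>|.\<close>

lemma cmeasures_pos_decomposition:
  assumes \<mu>: "\<mu> \<in> cmeasures"
  obtains \<alpha> \<beta> \<gamma> where "\<alpha> \<in> pos_cmeasures" "\<beta> \<in> pos_cmeasures" "\<gamma> \<in> pos_cmeasures"
    "\<mu> = (\<lambda>A. (\<alpha> A + \<i> * \<beta> A) + (- (1 + \<i>)) * \<gamma> A)"
proof -
  let ?v = "variation_measure \<mu>"
  have pos: "(\<lambda>A. ?v A + complex_of_real (Re (\<nu> A))) \<in> pos_cmeasures"
    if \<nu>: "\<nu> \<in> cmeasures" "\<And>A. cmod (\<nu> A) = cmod (\<mu> A)" for \<nu>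
  proof -
    have "?v A + complex_of_real (Re (\<nu> A)) \<in> \<real>\<^sub>\<ge>\<^sub>0" for A
    proof (cases "A \<in> sets borel")
      case True
      have "- Re (\<nu> A) \<le> cmod (\<mu> A)" using abs_Re_le_cmod[of "\<nu> A"] \<nu>(2)[of A] by simp
      also have "\<dots> \<le> enn2real (total_variation \<mu> A)"
        using cmod_le_total_variation[OF True, of \<mu>] total_variation_finite[OF \<mu>, of A]
        by (metis enn2real_mono enn2real_ennreal infinity_ennreal_def norm_ge_zero)
      finally show ?thesis using True
        by (simp add: variation_measure_def of_real_add[symmetric] del: of_real_add)
    next
      case False
      then show ?thesis using cmeasures_notin[OF \<nu>(1)] by (simp add: variation_measure_def)
    qed
    moreover have "(\<lambda>A. ?v A + complex_of_real (Re (\<nu> A))) \<in> cmeasures"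
      using variation_measure_pos_cmeasures[OF \<mu>] cmeasures_Re[OF \<nu>(1)]
      by (intro cmeasures_add) (auto simp: pos_cmeasures_def)
    ultimately show ?thesis by (simp add: pos_cmeasures_def)
  qed
  show ?thesis
  proof (rule that)
    show "(\<lambda>A. ?v A + complex_of_real (Re (\<mu> A))) \<in> pos_cmeasures" using \<mu> by (intro pos) auto
    \<comment> \<open>The real part of -i \<mu> is the imaginary part of \<mu>.\<close>
    show "(\<lambda>A. ?v A + complex_of_real (Re ((- \<i>) * \<mu> A))) \<in> pos_cmeasures"
      using \<mu> by (intro pos cmeasures_scale) (auto simp: norm_mult)
    show "?v \<in> pos_cmeasures" by (rule variation_measure_pos_cmeasures[OF \<mu>])
    show "\<mu> = (\<lambda>A. (?v A + complex_of_real (Re (\<mu> A)) +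
       \<i> * (?v A + complex_of_real (Re ((- \<i>) * \<mu> A)))) + (- (1 + \<i>)) * ?v A)"
      by (rule ext) (simp add: complex_eq_iff algebra_simps)
  qed
qed

section \<open>The adjoint identity for Haar measure\<close>

lemma euclidean_prod_topology:
  "prod_topology (euclidean :: 'a::topological_space topology) (euclidean :: 'b::topological_space topology) = euclidean"
  by (simp add: topology_eq openin_prod_topology_alt open_prod_def mem_Times_iff)

lemma
  assumes \<mu>: "\<mu> \<in> pos_cmeasures"
  shows Re_measure_to_measure: "measure (to_measure \<mu>) A = Re (\<mu> A)"
    and emeasure_to_measure: "emeasure (to_measure \<mu>) A = ennreal (Re (\<mu> A))"
  using arg_cong[OF measure_to_measure[OF \<mu>, of A], of Re]
  by (simp_all add: finite_measure.emeasure_eq_measure[OF finite_to_measure[OF \<mu>]])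

text \<open>Supports are defined by total variation, integrals by \<open>to_measure\<close>; this is
  the bridge between the two.\<close>

lemma total_variation_pos_cmeasures_le:
  assumes \<mu>: "\<mu> \<in> pos_cmeasures" and A: "A \<in> sets borel"
  shows "total_variation \<mu> A \<le> emeasure (to_measure \<mu>) A"
proof (rule total_variation_least)
  fix P :: "'a set set" assume P: "finite P" "P \<subseteq> sets borel" "disjoint P" "\<Union>P \<subseteq> A"
  have "(\<Sum>B\<in>P. ennreal (cmod (\<mu> B))) = (\<Sum>B\<in>P. emeasure (to_measure \<mu>) B)"
    using \<mu> by (intro sum.cong refl)
      (auto simp: emeasure_to_measure pos_cmeasures_def complex_nonneg_Reals_iff cmod_eq_Re)
  also have "\<dots> = emeasure (to_measure \<mu>) (\<Union>B\<in>P. B)"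
    using P by (intro sum_emeasure) (auto simp: disjoint_family_on_def disjoint_def)
  also have "\<dots> \<le> emeasure (to_measure \<mu>) A"
    using P A by (intro emeasure_mono) auto
  finally show "(\<Sum>B\<in>P. ennreal (cmod (\<mu> B))) \<le> emeasure (to_measure \<mu>) A" .
qed

lemma integrable_continuous_compact_real:
  fixes f :: "'a::topological_space \<Rightarrow> real"
  assumes "compact (UNIV :: 'a set)" "continuous_on UNIV f" "finite_measure M" "sets M = sets borel"
  shows "integrable M f"
proof -
  have "integrable M (\<lambda>x. complex_of_real (f x))"
    using assms by (intro integrable_continuous_compact continuous_intros)
  then show ?thesis by (simp add: complex_of_real_integrable_eq)
qed

lemma integral_pos_of_open:
  fixes g :: "'a::topological_space \<Rightarrow> real"
  assumes K: "compact (UNIV :: 'a set)" and g: "continuous_on UNIV g" "\<And>x. 0 \<le> g x"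
    and M: "finite_measure M" "sets M = sets borel"
    and "open U" "emeasure M U \<noteq> 0" "c > 0" "\<And>x. x \<in> U \<Longrightarrow> c \<le> g x"
  shows "0 < (\<integral>x. g x \<partial>M)"
proof -
  interpret finite_measure M by fact
  have U: "U \<in> sets M" using \<open>open U\<close> M by simp
  have "0 < c * measure M U"
    using assms(7,8) by (simp add: emeasure_eq_measure zero_less_measure_iff)
  also have "\<dots> = (\<integral>x. c * indicator U x \<partial>M)" using U by simp
  also have "\<dots> \<le> (\<integral>x. g x \<partial>M)"
  proof (rule integral_mono)
    show "integrable M (\<lambda>x. c * indicator U x)"
      using U by (intro integrable_mult_right integrable_real_indicator) (auto simp: less_top[symmetric])
    show "integrable M g" by (rule integrable_continuous_compact_real[OF K g(1) M])
    show "c * indicator U x \<le> g x" for x using g(2) assms(9) by (simp add: indicator_def)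
  qed
  finally show ?thesis .
qed

text \<open>The open neighbourhood of \<open>x\<close> on which \<open>g\<close> exceeds half of
  \<open>g x\<close> cannot be null, as \<open>x\<close> lies in the support.\<close>

lemma csupp_integral_pos:
  fixes g :: "'a::metric_space \<Rightarrow> real"
  assumes K: "compact (UNIV :: 'a set)" and g: "continuous_on UNIV g" "\<And>x. 0 \<le> g x"
    and \<mu>: "\<mu> \<in> pos_cmeasures" and x: "x \<in> csupp \<mu>" "g x > 0"
  shows "0 < (\<integral>x. g x \<partial>to_measure \<mu>)"
proof (rule integral_pos_of_open[OF K g finite_to_measure[OF \<mu>] sets_to_measure])
  let ?U = "g -` {g x / 2 <..}"
  show U: "open ?U" by (intro open_vimage open_greaterThan g)
  show "emeasure (to_measure \<mu>) ?U \<noteq> 0"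
  proof
    assume "emeasure (to_measure \<mu>) ?U = 0"
    then have "total_variation \<mu> ?U = 0"
      using total_variation_pos_cmeasures_le[OF \<mu> borel_open[OF U]] by simp
    then show False using x U by (auto simp: csupp_def)
  qed
  show "0 < g x / 2" using x by simp
qed auto

lemma emeasure_UN_eq_0_finite:
  assumes "finite I" "\<And>i. i \<in> I \<Longrightarrow> A i \<in> sets M" "\<And>i. i \<in> I \<Longrightarrow> emeasure M (A i) = 0"
  shows "emeasure M (\<Union>i\<in>I. A i) = 0"
proof -
  have "(\<Union>i\<in>I. A i) \<in> null_sets M"
    using assms by (intro null_sets_UN' countable_finite null_setsI)
  then show ?thesis by (rule null_setsD1)
qed

text \<open>Points off the support have null open neighbourhoods, and compactness of
  \<open>C\<close> leaves finitely many of them.\<close>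

lemma csupp_emeasure_compact:
  fixes \<mu> :: "'a::metric_space cmeasure"
  assumes \<mu>: "\<mu> \<in> pos_cmeasures" and C: "compact C" "C \<inter> csupp \<mu> = {}"
  shows "emeasure (to_measure \<mu>) C = 0"
proof -
  let ?\<U> = "{U. open U \<and> total_variation \<mu> U = 0}"
  have "C \<subseteq> \<Union>?\<U>"
  proof
    fix x assume "x \<in> C"
    then have "x \<notin> csupp \<mu>" using C(2) by blast
    then obtain U where "open U" "x \<in> U" "total_variation \<mu> U = 0"
      unfolding csupp_def mem_Collect_eq by meson
    then show "x \<in> \<Union>?\<U>" by blast
  qed
  then obtain \<V> where V: "\<V> \<subseteq> ?\<U>" "finite \<V>" "C \<subseteq> \<Union>\<V>"
    by (rule compactE[OF C(1)]) simp_all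
  have "emeasure (to_measure \<mu>) U = 0" if "U \<in> \<V>" for U
  proof -
    have U: "open U" "total_variation \<mu> U = 0" using V that by auto
    have "ennreal (cmod (\<mu> U)) \<le> 0"
      using cmod_le_total_variation[OF borel_open[OF U(1)], of \<mu>] U(2) by simp
    then show ?thesis by (simp add: emeasure_to_measure[OF \<mu>] ennreal_eq_0_iff)
  qed
  then have "emeasure (to_measure \<mu>) (\<Union>U\<in>\<V>. U) = 0"
    using V by (intro emeasure_UN_eq_0_finite) auto
  moreover have "emeasure (to_measure \<mu>) C \<le> emeasure (to_measure \<mu>) (\<Union>U\<in>\<V>. U)"
    using V by (intro emeasure_mono) (auto intro!: borel_open)
  ultimately show ?thesis by simp
qed

text \<open>Metrizability enters through the sort \<open>metric_space\<close>, which makes sequences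
  and the step functions available.\<close>

locale compact_metric_hypergroup = compact_hypergroup H
  for H :: "('a::metric_space, 'b) hypergroup_scheme" (structure)
begin

lemmas K = compact_space

text \<open>Positivity is hidden in the axiom of weak continuity: a continuous map into
  \<open>weak_cone\<close> takes its values in \<open>pos_cmeasures\<close>.\<close>

lemma conv_pos_cmeasures:
  assumes "\<mu> \<in> pos_cmeasures" "\<nu> \<in> pos_cmeasures"
  shows "conv H \<mu> \<nu> \<in> pos_cmeasures"
  using continuous_map_funspace[OF conv_weakly_continuous] assms by (auto simp: Pi_iff)

lemma conv_dirac_pos: "conv H (dirac x) (dirac y) \<in> pos_cmeasures"
  using conv_dirac by (auto simp: prob_cmeasures_def)

lemma conv_dirac_finite: "finite_measure (to_measure (conv H (dirac x) (dirac y)))"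
  by (rule finite_to_measure[OF conv_dirac_pos])

lemma conv_dirac_mass: "measure (to_measure (conv H (dirac x) (dirac y))) UNIV = 1"
  using conv_dirac[of x y] by (simp add: Re_measure_to_measure[OF conv_dirac_pos] prob_cmeasures_def)

lemma pos_cmeasuresD: "\<mu> \<in> pos_cmeasures \<Longrightarrow> \<mu> \<in> cmeasures"
  by (simp add: pos_cmeasures_def)

lemma continuous_map_conv:
  assumes "continuous_map X weak_cone f" "continuous_map X weak_cone g"
  shows "continuous_map X weak_cone (\<lambda>x. conv H (f x) (g x))"
  using continuous_map_compose[OF continuous_map_pairedI[OF assms] conv_weakly_continuous]
  by (simp add: o_def)

lemma continuous_map_integral:
  fixes h :: "'a \<Rightarrow> complex"
  assumes "continuous_on UNIV h" "continuous_map X weak_cone f"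
  shows "continuous_map X euclidean (\<lambda>x. \<integral>t. h t \<partial>to_measure (f x))"
  using continuous_map_compose[OF assms(2) continuous_integral_weak_cone[OF assms(1)]]
  by (simp add: o_def)

lemma continuous_map_dirac:
  fixes f :: "'c::topological_space \<Rightarrow> 'a"
  assumes "continuous_on UNIV f"
  shows "continuous_map euclidean weak_cone (\<lambda>x. dirac (f x))"
  using continuous_map_compose[OF _ continuous_dirac[OF K], of euclidean f] assms
  by (simp add: o_def)

text \<open>In hypergroup notation this is h(x * y).\<close>

definition translate :: "('a \<Rightarrow> complex) \<Rightarrow> 'a \<Rightarrow> 'a \<Rightarrow> complex" where
  "translate h x y = (\<integral>t. h t \<partial>to_measure (conv H (dirac x) (dirac y)))"

lemma continuous_translate:
  assumes h: "continuous_on UNIV h" and "continuous_on UNIV u" "continuous_on UNIV v"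
  shows "continuous_on UNIV (\<lambda>z. translate h (u z) (v z))"
  using continuous_map_integral[OF h continuous_map_conv[OF continuous_map_dirac continuous_map_dirac]] assms
  unfolding translate_def by simp

text \<open>For fixed \<mu> the left side is a weakly continuous, additive and homogeneous
  functional of \<nu>, hence the integral of its values at point masses.\<close>

lemma integral_conv_right:
  assumes h: "continuous_on UNIV h" and \<mu>: "\<mu> \<in> pos_cmeasures" and \<nu>: "\<nu> \<in> pos_cmeasures"
  shows "(\<integral>t. h t \<partial>to_measure (conv H \<mu> \<nu>)) =
    (\<integral>y. (\<integral>t. (h t :: complex) \<partial>to_measure (conv H \<mu> (dirac y))) \<partial>to_measure \<nu>)"
proof (rule weak_cone_functional_eq_integral(1)[OF K _ _ _ \<nu>])
  show "continuous_map weak_cone euclidean (\<lambda>\<nu>. \<integral>t. h t \<partial>to_measure (conv H \<mu> \<nu>))"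
    using \<mu> by (intro continuous_map_integral[OF h] continuous_map_conv)
      simp_all
qed (simp_all add: conv_add_right conv_scale_right pos_cmeasuresD \<mu> conv_pos_cmeasures
      integral_to_measure_add[OF K h] integral_to_measure_scale[OF K h])

lemma integral_conv_left:
  assumes h: "continuous_on UNIV h" and \<mu>: "\<mu> \<in> pos_cmeasures" and \<nu>: "\<nu> \<in> pos_cmeasures"
  shows "(\<integral>t. h t \<partial>to_measure (conv H \<mu> \<nu>)) =
    (\<integral>x. (\<integral>t. (h t :: complex) \<partial>to_measure (conv H (dirac x) \<nu>)) \<partial>to_measure \<mu>)"
proof (rule weak_cone_functional_eq_integral(1)[OF K _ _ _ \<mu>])
  show "continuous_map weak_cone euclidean (\<lambda>\<mu>. \<integral>t. h t \<partial>to_measure (conv H \<mu> \<nu>))"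
    using \<nu> by (intro continuous_map_integral[OF h] continuous_map_conv)
      simp_all
qed (simp_all add: conv_add_left conv_scale_left pos_cmeasuresD \<nu> conv_pos_cmeasures
      integral_to_measure_add[OF K h] integral_to_measure_scale[OF K h])

lemma vimage_invol: "invol H ` A = invol H -` A"
  by (auto simp: invol_invol image_iff) (metis invol_invol)

lemma measurable_invol: "invol H \<in> measurable borel borel"
  by (rule borel_measurable_continuous_onI[OF invol_continuous])

lemma check_dirac: "check_measure H (dirac x) = dirac (invol H x)"
proof
  fix A :: "'a set"
  have "invol H ` A \<in> sets borel \<longleftrightarrow> A \<in> sets borel"
  proof
    assume "invol H ` A \<in> sets borel"
    from measurable_sets[OF measurable_invol this] have "invol H -` invol H ` A \<in> sets borel" by simp
    also have "invol H -` invol H ` A = A"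
      by (auto simp: image_iff) (metis invol_invol)
    finally show "A \<in> sets borel" .
  next
    assume "A \<in> sets borel"
    from measurable_sets[OF measurable_invol this] show "invol H ` A \<in> sets borel"
      by (simp add: vimage_invol)
  qed
  then show "check_measure H (dirac x) A = dirac (invol H x) A"
    by (simp add: check_measure_def dirac_def vimage_invol)
qed

lemma check_conv_dirac:
  "check_measure H (conv H (dirac x) (dirac y)) = conv H (dirac (invol H y)) (dirac (invol H x))"
  by (simp add: check_conv dirac_cmeasures check_dirac)

text \<open>The involution carries x * y to y^- * x^-, so the measure on the right is the image of
  the one on the left.\<close>

lemma translate_invol:
  assumes h: "continuous_on UNIV h"
  shows "translate (\<lambda>t. h (invol H t)) x y = translate h (invol H y) (invol H x)"
proof -
  let ?\<mu> = "conv H (dirac x) (dirac y)" and ?\<nu> = "conv H (dirac (invol H y)) (dirac (invol H x))"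
  have m: "invol H \<in> measurable (to_measure ?\<mu>) borel"
    using measurable_invol by (simp add: measurable_cong_sets[OF sets_to_measure refl])
  have "to_measure ?\<nu> = distr (to_measure ?\<mu>) borel (invol H)"
  proof (rule measure_eqI)
    fix A assume "A \<in> sets (to_measure ?\<nu>)"
    then have "emeasure (distr (to_measure ?\<mu>) borel (invol H)) A = emeasure (to_measure ?\<mu>) (invol H ` A)"
      using m by (simp add: emeasure_distr vimage_invol)
    moreover have "?\<nu> A = ?\<mu> (invol H ` A)"
      using fun_cong[OF check_conv_dirac[of x y], of A] by (simp add: check_measure_def)
    ultimately show "emeasure (to_measure ?\<nu>) A = emeasure (distr (to_measure ?\<mu>) borel (invol H)) A"
      by (simp add: emeasure_to_measure conv_dirac_pos)
  qed simp
  then show ?thesis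
    unfolding translate_def using m borel_measurable_continuous_onI[OF h] by (simp add: integral_distr)
qed

text \<open>Both sides integrate \<open>h\<close> against the measure of \<open>z * x * y\<close>.\<close>

lemma translate_assoc:
  assumes h: "continuous_on UNIV h"
  shows "(\<integral>t. translate h z t \<partial>to_measure (conv H (dirac x) (dirac y))) =
    (\<integral>s. translate h s y \<partial>to_measure (conv H (dirac z) (dirac x)))"
  unfolding translate_def
  using integral_conv_right[OF h dirac_pos_cmeasures conv_dirac_pos, of z x y]
    integral_conv_left[OF h conv_dirac_pos dirac_pos_cmeasures, of z x y]
    conv_assoc[OF dirac_cmeasures dirac_cmeasures dirac_cmeasures, of z x y] by simp

text \<open>Where f(z) and f(t) are \<epsilon> apart, z and t differ and the unit lies off the
  closed support of z^- * t. Avoiding a given closed ball is an open condition in the Michael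
  topology, and the pairs concerned form a compact set, so one radius serves all of them.\<close>

lemma off_diagonal_csupp:
  assumes f: "continuous_on UNIV (f :: 'a \<Rightarrow> complex)" and "\<epsilon> > 0"
  obtains r where "r > 0"
    "\<And>z t. \<epsilon> \<le> dist (f z) (f t) \<Longrightarrow> cball (unit H) r \<inter> csupp (conv H (dirac (invol H z)) (dirac t)) = {}"
proof -
  let ?S = "\<lambda>(z, t). csupp (conv H (dirac (invol H z)) (dirac t))"
  have S: "continuous_map euclidean michael_topology ?S"
  proof -
    have "continuous_map (prod_topology euclidean euclidean) (prod_topology euclidean euclidean)
        (\<lambda>(z, t). (invol H z, t))"
      unfolding euclidean_prod_topology case_prod_unfold
      using invol_continuous continuous_on_compose2[OF invol_continuous continuous_on_fst[OF continuous_on_id]]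
      by (auto intro!: continuous_intros)
    from continuous_map_compose[OF this csupp_continuous] show ?thesis
      by (simp add: o_def case_prod_unfold euclidean_prod_topology)
  qed
  define W where "W n = {p. ?S p \<inter> cball (unit H) (inverse (Suc n)) = {}}" for n :: nat
  have W: "open (W n)" for n
  proof -
    let ?V = "- cball (unit H) (inverse (Suc n))"
    \<comment> \<open>A subbasic Michael set with \<open>U = UNIV\<close>: it says that the support
      avoids the ball.\<close>
    let ?A = "{A. A \<noteq> {} \<and> compact A \<and> A \<inter> UNIV \<noteq> {} \<and> A \<subseteq> ?V}"
    have "openin michael_topology ?A"
      unfolding michael_topology_def by (rule topology_generated_by_Basis) (use open_Compl[OF closed_cball] open_UNIV in blast)
    from openin_continuous_map_preimage[OF S this] have "open {p. ?S p \<in> ?A}" by simp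
    moreover have "?S p \<noteq> {} \<and> compact (?S p)" for p
    proof -
      have "topspace michael_topology \<subseteq> {A :: 'a set. A \<noteq> {} \<and> compact A}"
        unfolding michael_topology_def topology_generated_by_topspace by blast
      moreover have "?S p \<in> topspace michael_topology"
        using continuous_map_funspace[OF S] unfolding Pi_iff topspace_euclidean by (meson UNIV_I)
      ultimately show ?thesis by blast
    qed
    then have "{p. ?S p \<in> ?A} = W n" unfolding W_def by auto
    ultimately show ?thesis by simp
  qed
  let ?D = "{p. \<epsilon> \<le> dist (f (fst p)) (f (snd p))}"
  have "closed ?D"
    by (intro closed_Collect_le continuous_on_const continuous_on_dist
        continuous_on_compose2[OF f continuous_on_fst[OF continuous_on_id]]
        continuous_on_compose2[OF f continuous_on_snd[OF continuous_on_id]]) auto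
  then have D: "compact ?D"
    using compact_Int_closed[OF compact_Times[OF K K]] by simp
  have "?D \<subseteq> (\<Union>n. W n)"
  proof
    fix p assume p: "p \<in> ?D"
    obtain z t where zt: "p = (z, t)" by fastforce
    then have "z \<noteq> t" using p \<open>\<epsilon> > 0\<close> by auto
    then have "invol H z \<noteq> invol H t" by (metis invol_invol)
    then have e: "unit H \<notin> csupp (conv H (dirac (invol H z)) (dirac t))"
      by (simp add: unit_in_csupp)
    have "open (- csupp (conv H (dirac (invol H z)) (dirac t)))"
      using compact_imp_closed[OF compact_csupp] by auto
    then obtain \<delta> where \<delta>: "\<delta> > 0" "cball (unit H) \<delta> \<subseteq> - csupp (conv H (dirac (invol H z)) (dirac t))"
      using e by (auto simp: open_contains_cball)
    obtain n where n: "inverse (Suc n) < \<delta>" using reals_Archimedean[OF \<delta>(1)] by blast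
    then have "cball (unit H) (inverse (Suc n)) \<subseteq> cball (unit H) \<delta>" by (intro subset_cball) simp
    then have "p \<in> W n" using \<delta> unfolding W_def zt by auto
    then show "p \<in> (\<Union>n. W n)" by blast
  qed
  then obtain I where I: "finite I" "?D \<subseteq> (\<Union>n\<in>I. W n)"
    using compactE_image[OF D, of UNIV W] W by auto
  \<comment> \<open>\<open>W n\<close> grows with \<open>n\<close>, so the largest index of the
    subcover suffices; the inserted 0 keeps \<open>Max\<close> meaningful for an empty
    subcover.\<close>
  define N where "N = Max (insert 0 I)"
  have sub: "W n \<subseteq> W N" if "n \<in> I" for n
  proof -
    have "n \<le> N" unfolding N_def using I that by (intro Max_ge) auto
    then have "inverse (Suc N) \<le> inverse (real (Suc n))" by (simp add: field_simps)
    then have "cball (unit H) (inverse (Suc N)) \<subseteq> cball (unit H) (inverse (Suc n))" by (intro subset_cball)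
    then show ?thesis unfolding W_def by blast
  qed
  show ?thesis
  proof (rule that[of "inverse (Suc N)"])
    fix z t assume "\<epsilon> \<le> dist (f z) (f t)"
    then have "(z, t) \<in> ?D" by simp
    then have "(z, t) \<in> W N" using I(2) sub by blast
    then show "cball (unit H) (inverse (Suc N)) \<inter> csupp (conv H (dirac (invol H z)) (dirac t)) = {}"
      unfolding W_def by auto
  qed simp
qed

end

section \<open>Invariance and positivity of the Haar measure\<close>

locale haar_hypergroup = compact_metric_hypergroup +
  fixes lam :: "'a measure"
  assumes haar: "is_haar_measure H lam"
begin

lemma sets_lam [simp, measurable_cong]: "sets lam = sets borel"
  and emeasure_lam: "emeasure lam UNIV = 1"
  using haar by (auto simp: is_haar_measure_def)

lemma space_lam [simp]: "space lam = UNIV"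
  using sets_eq_imp_space_eq[OF sets_lam] by simp

lemma finite_lam: "finite_measure lam"
  by (rule finite_measureI) (simp add: emeasure_lam)

lemma measure_lam: "measure lam UNIV = 1"
  by (simp add: measure_def emeasure_lam)

lemma integrable_lam: "continuous_on UNIV f \<Longrightarrow> integrable lam (f :: 'a \<Rightarrow> complex)"
  by (rule integrable_continuous_compact[OF K _ finite_lam sets_lam])

lemma left_invariant:
  "continuous_on UNIV f \<Longrightarrow> (\<integral>y. translate f x y \<partial>lam) = (\<integral>y. f y \<partial>lam)"
  using haar by (simp add: is_haar_measure_def translate_def)

lemma continuous_comp_invol:
  assumes "continuous_on UNIV h"
  shows "continuous_on UNIV (\<lambda>t. h (invol H t))"
  using continuous_on_compose2[OF assms invol_continuous] by simp

lemma continuous_kernel: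
  assumes "continuous_on UNIV h"
  shows "continuous_on UNIV (\<lambda>(z, t). translate h (invol H z) t)"
  unfolding case_prod_unfold
  by (intro continuous_translate[OF assms] continuous_on_snd continuous_on_id
      continuous_on_compose2[OF invol_continuous continuous_on_fst[OF continuous_on_id]]) auto

text \<open>Since h((z^- * y)^-) = h(y^- * z), left invariance in y evaluates the double integral to
  the left side and left invariance in z to the right side; the idle outer integration has total
  mass 1.\<close>

lemma haar_invol:
  assumes h: "continuous_on UNIV h"
  shows "(\<integral>x. h (invol H x) \<partial>lam) = (\<integral>x. (h x :: complex) \<partial>lam)"
proof -
  let ?F = "\<lambda>z y. translate h (invol H z) y"
  have "(\<integral>x. h (invol H x) \<partial>lam) = (\<integral>z. (\<integral>y. translate (\<lambda>t. h (invol H t)) (invol H z) y \<partial>lam) \<partial>lam)"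
    using left_invariant[OF continuous_comp_invol[OF h]] by (simp add: measure_lam)
  also have "\<dots> = (\<integral>z. (\<integral>y. ?F y z \<partial>lam) \<partial>lam)"
    by (simp add: translate_invol[OF h] invol_invol)
  also have "\<dots> = (\<integral>y. (\<integral>z. ?F y z \<partial>lam) \<partial>lam)"
    by (rule Fubini_continuous_compact(1)[OF K continuous_kernel[OF h] finite_lam sets_lam finite_lam sets_lam, symmetric])
  also have "\<dots> = (\<integral>x. h x \<partial>lam)"
    using left_invariant[OF h] by (simp add: measure_lam)
  finally show ?thesis .
qed

text \<open>Left invariance of the reflected function, reflected back by
  \<open>haar_invol\<close>.\<close>

lemma right_invariant:
  assumes h: "continuous_on UNIV h"
  shows "(\<integral>z. translate h (invol H z) t \<partial>lam) = (\<integral>x. h x \<partial>lam)"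
proof -
  have "(\<integral>z. translate h (invol H z) t \<partial>lam) = (\<integral>z. translate (\<lambda>t. h (invol H t)) (invol H t) z \<partial>lam)"
    by (simp add: translate_invol[OF h] invol_invol)
  then show ?thesis
    using left_invariant[OF continuous_comp_invol[OF h]] haar_invol[OF h] by simp
qed

text \<open>Otherwise every function sending t to g(z^- * t) has integral 0 too. It is positive at t
  = z, because the unit lies in the support of z^- * z, so every z has a null neighbourhood and by
  compactness the space is null, against mass 1.\<close>

lemma haar_integral_pos:
  fixes g :: "'a \<Rightarrow> real"
  assumes g: "continuous_on UNIV g" "\<And>x. 0 \<le> g x" and e: "0 < g (unit H)"
  shows "0 < (\<integral>x. g x \<partial>lam)"
proof (rule ccontr)
  assume neg: "\<not> 0 < (\<integral>x. g x \<partial>lam)"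
  define G where "G z t = (\<integral>s. g s \<partial>to_measure (conv H (dirac (invol H z)) (dirac t)))" for z t
  have h: "continuous_on UNIV (\<lambda>x. complex_of_real (g x))" by (intro continuous_intros g)
  have G: "translate (\<lambda>x. complex_of_real (g x)) (invol H z) t = complex_of_real (G z t)" for z t
    by (simp add: translate_def G_def)
  have contG: "continuous_on UNIV (\<lambda>t. G z t)" for z
    using continuous_on_Re[OF continuous_translate[OF h continuous_on_const continuous_on_id, of "invol H z"]]
    by (simp add: G)
  have Gnn: "0 \<le> G z t" for z t unfolding G_def using g by (intro Bochner_Integration.integral_nonneg) auto
  have Gpos: "0 < G z z" for z
    unfolding G_def by (rule csupp_integral_pos[OF K g conv_dirac_pos _ e]) (simp add: unit_in_csupp)
  have int: "(\<integral>t. G z t \<partial>lam) = (\<integral>x. g x \<partial>lam)" for z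
    using left_invariant[OF h, of "invol H z"] by (simp add: G)
  have null: "emeasure lam (G z -` {G z z / 2 <..}) = 0" for z
  proof (rule ccontr)
    assume *: "emeasure lam (G z -` {G z z / 2 <..}) \<noteq> 0"
    have "0 < (\<integral>t. G z t \<partial>lam)"
      by (rule integral_pos_of_open[OF K contG Gnn finite_lam sets_lam open_vimage[OF open_greaterThan contG] *,
            where c = "G z z / 2"])
        (use Gpos[of z] in \<open>simp_all add: less_imp_le\<close>)
    then show False using neg int by simp
  qed
  let ?U = "\<lambda>z. G z -` {G z z / 2 <..}"
  have "(UNIV :: 'a set) \<subseteq> (\<Union>z\<in>UNIV. ?U z)"
  proof
    fix z :: 'a
    have "z \<in> ?U z" using Gpos[of z] by simp
    then show "z \<in> (\<Union>z\<in>UNIV. ?U z)" by blast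
  qed
  then obtain I where I: "finite I" "(UNIV :: 'a set) \<subseteq> (\<Union>z\<in>I. ?U z)"
    by (rule compactE_image[OF K, of UNIV ?U, rotated])
      (simp_all add: open_vimage[OF open_greaterThan contG])
  have "emeasure lam (\<Union>z\<in>I. ?U z) = 0"
    using null I(1) by (intro emeasure_UN_eq_0_finite) (auto intro!: borel_open open_vimage[OF open_greaterThan contG])
  moreover have "(\<Union>z\<in>I. ?U z) = UNIV" using I(2) by blast
  ultimately show False using emeasure_lam by simp
qed

text \<open>The kernel \<open>translate h (invol z) t\<close> of a bump \<open>h\<close> at the unit is concentrated near the diagonal,
  because the unit lies in the support of \<open>z\<^sup>- * t\<close> only for \<open>z = t\<close>.\<close>

lemma approximate_identity:
  assumes f: "continuous_on UNIV (f :: 'a \<Rightarrow> complex)" and g: "continuous_on UNIV (g :: 'a \<Rightarrow> complex)"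
    and \<epsilon>: "\<epsilon> > 0"
  obtains h :: "'a \<Rightarrow> complex" and c :: real where "continuous_on UNIV h" "c > 0"
    "\<And>t. cmod ((\<integral>z. f z * translate h (invol H z) t \<partial>lam) - f t * c) \<le> \<epsilon> * c"
    "\<And>z. cmod ((\<integral>t. g t * translate h (invol H z) t \<partial>lam) - g z * c) \<le> \<epsilon> * c"
proof -
  obtain r1 where r1: "r1 > 0"
    "\<And>z t. \<epsilon> \<le> dist (f z) (f t) \<Longrightarrow> cball (unit H) r1 \<inter> csupp (conv H (dirac (invol H z)) (dirac t)) = {}"
    using off_diagonal_csupp[OF f \<epsilon>] by blast
  obtain r2 where r2: "r2 > 0"
    "\<And>z t. \<epsilon> \<le> dist (g z) (g t) \<Longrightarrow> cball (unit H) r2 \<inter> csupp (conv H (dirac (invol H z)) (dirac t)) = {}"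
    using off_diagonal_csupp[OF g \<epsilon>] by blast
  \<comment> \<open>One bump has to serve both \<open>f\<close> and \<open>g\<close>, hence the
    smaller radius.\<close>
  define r where "r = min r1 r2"
  have r: "r > 0" "cball (unit H) r \<subseteq> cball (unit H) r1" "cball (unit H) r \<subseteq> cball (unit H) r2"
    unfolding r_def using r1 r2 by (auto intro: subset_cball)
  \<comment> \<open>A tent vanishing outside the ball of radius \<open>r\<close>; its integral
    \<open>c\<close> is carried along as a factor.\<close>
  define b where "b x = max 0 (r - dist (unit H) x)" for x
  have b: "continuous_on UNIV b" "\<And>x. 0 \<le> b x" "0 < b (unit H)"
    unfolding b_def using r by (auto intro!: continuous_intros)
  define h where "h x = complex_of_real (b x)" for x
  define c where "c = (\<integral>x. b x \<partial>lam)"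
  have h: "continuous_on UNIV h" unfolding h_def by (intro continuous_intros b)
  have c: "c > 0" unfolding c_def by (rule haar_integral_pos[OF b])
  define G where "G z t = (\<integral>s. b s \<partial>to_measure (conv H (dirac (invol H z)) (dirac t)))" for z t
  have G: "translate h (invol H z) t = complex_of_real (G z t)" for z t
    by (simp add: translate_def G_def h_def)
  have Gnn: "0 \<le> G z t" for z t unfolding G_def using b by (intro Bochner_Integration.integral_nonneg) auto
  have G0: "G z t = 0" if "cball (unit H) r \<inter> csupp (conv H (dirac (invol H z)) (dirac t)) = {}" for z t
  proof -
    let ?\<mu> = "conv H (dirac (invol H z)) (dirac t)"
    have "compact (cball (unit H) r)"
      using compact_Int_closed[OF K closed_cball] by simp
    then have "emeasure (to_measure ?\<mu>) (cball (unit H) r) = 0"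
      by (rule csupp_emeasure_compact[OF conv_dirac_pos _ that])
    then have "AE s in to_measure ?\<mu>. b s = 0"
      by (intro AE_I[of _ _ "cball (unit H) r"]) (auto simp: b_def max_def split: if_splits)
    then show ?thesis unfolding G_def by (rule integral_eq_zero_AE)
  qed
  have c1: "(\<integral>z. G z t \<partial>lam) = c" for t
    using right_invariant[OF h, of t] by (simp add: G h_def c_def)
  have c2: "(\<integral>t. G z t \<partial>lam) = c" for z
    using left_invariant[OF h, of "invol H z"] by (simp add: G h_def c_def)
  have Gc1: "continuous_on UNIV (\<lambda>z. G z t)" for t
    using continuous_on_Re[OF continuous_translate[OF h invol_continuous continuous_on_const, of t]]
    by (simp add: G)
  have Gc2: "continuous_on UNIV (\<lambda>t. G z t)" for z
    using continuous_on_Re[OF continuous_translate[OF h continuous_on_const continuous_on_id, of "invol H z"]]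
    by (simp add: G)
  \<comment> \<open>\<open>v\<close> has mass \<open>c\<close> and vanishes where \<open>u\<close>
    is \<epsilon> or more away from \<open>w\<close>. Formulated so as to cover both variables of
    the kernel.\<close>
  have est: "cmod ((\<integral>z. u z * complex_of_real (v z) \<partial>lam) - w * c) \<le> \<epsilon> * c"
    if u: "continuous_on UNIV u" and v: "continuous_on UNIV v" "\<And>z. 0 \<le> v z" "(\<integral>z. v z \<partial>lam) = c"
      and uw: "\<And>z. \<epsilon> \<le> dist (u z) w \<Longrightarrow> v z = 0" for u :: "'a \<Rightarrow> complex" and v w
  proof -
    have vi: "integrable lam v"
      by (rule integrable_continuous_compact_real[OF K v(1) finite_lam sets_lam])
    have i: "integrable lam (\<lambda>z. (u z - w) * complex_of_real (v z))"
      by (intro integrable_lam continuous_intros u v)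
    have "(\<integral>z. u z * complex_of_real (v z) \<partial>lam) - w * c =
        (\<integral>z. u z * complex_of_real (v z) \<partial>lam) - (\<integral>z. w * complex_of_real (v z) \<partial>lam)"
      by (simp add: v(3))
    also have "\<dots> = (\<integral>z. (u z - w) * complex_of_real (v z) \<partial>lam)"
      unfolding left_diff_distrib
      by (intro Bochner_Integration.integral_diff[symmetric] integrable_lam continuous_intros u v)
    also have "cmod \<dots> \<le> (\<integral>z. \<epsilon> * v z \<partial>lam)"
    proof (rule cmod_integral_le[OF i])
      show "integrable lam (\<lambda>z. \<epsilon> * v z)" using vi by simp
      show "cmod ((u z - w) * complex_of_real (v z)) \<le> \<epsilon> * v z" for z
        using uw[of z] v(2)[of z]
        by (cases "\<epsilon> \<le> dist (u z) w") (auto simp: norm_mult dist_norm intro: mult_right_mono)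
    qed
    finally show ?thesis by (simp add: v(3))
  qed
  show ?thesis
  proof (rule that[OF h c])
    show "cmod ((\<integral>z. f z * translate h (invol H z) t \<partial>lam) - f t * c) \<le> \<epsilon> * c" for t
      unfolding G
    proof (rule est[OF f Gc1 Gnn c1])
      fix z assume "\<epsilon> \<le> dist (f z) (f t)"
      from r1(2)[OF this] show "G z t = 0" using r(2) by (intro G0) blast
    qed
    show "cmod ((\<integral>t. g t * translate h (invol H z) t \<partial>lam) - g z * c) \<le> \<epsilon> * c" for z
      unfolding G
    proof (rule est[OF g Gc2 Gnn c2])
      fix t assume "\<epsilon> \<le> dist (g t) (g z)"
      then have "\<epsilon> \<le> dist (g z) (g t)" by (simp add: dist_commute)
      from r2(2)[OF this] show "G z t = 0" using r(3) by (intro G0) blast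
    qed
  qed
qed

text \<open>The total mass 1 keeps a uniform error at its size when averaged.\<close>

lemma cmod_integral_diff_le:
  fixes u v :: "'a \<Rightarrow> complex"
  assumes M: "finite_measure M" "sets M = sets borel" "measure M UNIV = 1"
    and u: "continuous_on UNIV u" and v: "continuous_on UNIV v"
    and le: "\<And>t. cmod (u t - v t * c) \<le> \<delta>"
  shows "cmod ((\<integral>t. u t \<partial>M) - (\<integral>t. v t \<partial>M) * c) \<le> \<delta>"
proof -
  note int = integrable_continuous_compact[OF K _ M(1,2)]
  have "(\<integral>t. u t \<partial>M) - (\<integral>t. v t \<partial>M) * c = (\<integral>t. u t - v t * c \<partial>M)"
    by (subst Bochner_Integration.integral_diff) (auto intro!: int u v continuous_intros)
  also have "cmod \<dots> \<le> (\<integral>t. \<delta> \<partial>M)"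
    by (intro cmod_integral_le int continuous_intros u v le finite_measure.integrable_const[OF M(1)])
  also have "\<dots> = \<delta>" using M sets_eq_imp_space_eq[OF M(2)] by simp
  finally show ?thesis .
qed

text \<open>The integral of \<open>f(z) g(y) h(z\<^sup>- * x * y)\<close> over \<open>y\<close> and \<open>z\<close> is computed in two ways, for a bump
  \<open>h\<close> at the unit.\<close>

lemma haar_adjoint:
  assumes f: "continuous_on UNIV f" and g: "continuous_on UNIV g"
  shows "(\<integral>y. translate f x y * g y \<partial>lam) = (\<integral>z. f z * translate g (invol H x) z \<partial>lam)"
    (is "?L = ?R")
proof -
  obtain Bf where Bf: "Bf > 0" "\<And>x. cmod (f x) \<le> Bf" using continuous_compact_bounded[OF K f] by blast
  obtain Bg where Bg: "Bg > 0" "\<And>x. cmod (g x) \<le> Bg" using continuous_compact_bounded[OF K g] by blast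
  have "cmod (?L - ?R) \<le> 0 + \<epsilon>" if "\<epsilon> > 0" for \<epsilon>
  proof -
    \<comment> \<open>The two errors below are at most \<open>Bg * (\<eta> * c)\<close> and
      \<open>Bf * (\<eta> * c)\<close>; together they make up \<epsilon> times c.\<close>
    define \<eta> where "\<eta> = \<epsilon> / (Bf + Bg)"
    have \<eta>: "\<eta> > 0" unfolding \<eta>_def using that Bf Bg by simp
    obtain h :: "'a \<Rightarrow> complex" and c where h: "continuous_on UNIV h" and c: "c > 0"
      and a1: "\<And>t. cmod ((\<integral>z. f z * translate h (invol H z) t \<partial>lam) - f t * c) \<le> \<eta> * c"
      and a2: "\<And>z. cmod ((\<integral>t. g t * translate h (invol H z) t \<partial>lam) - g z * c) \<le> \<eta> * c"
      using approximate_identity[OF f g \<eta>] by blast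
    \<comment> \<open>This is h(z^- * x * y), bracketed with x * y together.\<close>
    define W where "W z y = (\<integral>t. translate h (invol H z) t \<partial>to_measure (conv H (dirac x) (dirac y)))" for z y
    have W1: "W z y = (\<integral>t. h t \<partial>to_measure (conv H (dirac (invol H z)) (conv H (dirac x) (dirac y))))" for z y
      unfolding W_def translate_def
      by (rule integral_conv_right[OF h dirac_pos_cmeasures conv_dirac_pos, symmetric])
    have Wc: "continuous_on UNIV (\<lambda>p. W (fst p) (snd p))"
    proof -
      have "continuous_map euclidean euclidean (\<lambda>p :: 'a \<times> 'a. W (fst p) (snd p))"
        unfolding W1
        by (intro continuous_map_integral[OF h] continuous_map_conv continuous_map_dirac
            continuous_on_compose2[OF invol_continuous continuous_on_fst[OF continuous_on_id]]
            continuous_on_snd continuous_on_id continuous_on_const) auto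
      then show ?thesis by simp
    qed
    \<comment> \<open>The other bracketing: z^- * x is the reflection of x^- * z.\<close>
    have W2: "W z y = (\<integral>s. translate h (invol H s) y \<partial>to_measure (conv H (dirac (invol H x)) (dirac z)))" for z y
    proof -
      have "W z y = translate (\<lambda>s. translate h s y) (invol H z) x"
        unfolding W_def translate_assoc[OF h] unfolding translate_def ..
      also have "\<dots> = translate (\<lambda>s. translate h (invol H s) y) (invol H x) z"
        using translate_invol[OF continuous_translate[OF h continuous_on_id continuous_on_const], of y "invol H x" z]
        by (simp add: invol_invol)
      finally show ?thesis unfolding translate_def .
    qed
    have fst': "continuous_on UNIV (\<lambda>p :: 'a \<times> 'a. f (fst p))" "continuous_on UNIV (\<lambda>p :: 'a \<times> 'a. g (snd p))"
      "continuous_on UNIV (\<lambda>p :: 'a \<times> 'a. g (fst p))"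
      using continuous_on_compose2[OF f continuous_on_fst[OF continuous_on_id]]
        continuous_on_compose2[OF g continuous_on_snd[OF continuous_on_id]]
        continuous_on_compose2[OF g continuous_on_fst[OF continuous_on_id]] by auto
    have sw: "continuous_on UNIV (\<lambda>p :: 'a \<times> 'a. (snd p, fst p))" by (intro continuous_intros)
    define A1 where "A1 y = (\<integral>z. f z * W z y \<partial>lam)" for y
    define A2 where "A2 z = (\<integral>y. g y * W z y \<partial>lam)" for z
    have fW: "continuous_on UNIV (\<lambda>(y, z). f z * W z y)"
      using continuous_on_compose2[OF continuous_on_mult[OF fst'(1) Wc] sw] by (simp add: case_prod_unfold)
    have gW: "continuous_on UNIV (\<lambda>(z, y). g y * W z y)"
      using continuous_on_mult[OF fst'(2) Wc] by (simp add: case_prod_unfold)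
    have A1c: "continuous_on UNIV A1"
      unfolding A1_def by (rule Fubini_continuous_compact(2)[OF K fW finite_lam sets_lam finite_lam sets_lam])
    have A2c: "continuous_on UNIV A2"
      unfolding A2_def by (rule Fubini_continuous_compact(2)[OF K gW finite_lam sets_lam finite_lam sets_lam])
    \<comment> \<open>With z integrated first, the kernel reproduces c f(t) up to the error;
      averaging t over x * y yields c f(x * y).\<close>
    have A1e: "cmod (A1 y - translate f x y * c) \<le> \<eta> * c" for y
    proof -
      let ?M = "to_measure (conv H (dirac x) (dirac y))"
      have F: "continuous_on UNIV (\<lambda>(t, z). f z * translate h (invol H z) t)"
        using continuous_on_compose2[OF continuous_on_mult[OF fst'(1) continuous_kernel[OF h]] sw]
        by (simp add: case_prod_unfold)
      have "A1 y = (\<integral>z. (\<integral>t. f z * translate h (invol H z) t \<partial>?M) \<partial>lam)"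
        unfolding A1_def W_def by simp
      also have "\<dots> = (\<integral>t. (\<integral>z. f z * translate h (invol H z) t \<partial>lam) \<partial>?M)"
        by (rule Fubini_continuous_compact(1)[OF K F conv_dirac_finite sets_to_measure finite_lam sets_lam, symmetric])
      finally show ?thesis
        unfolding translate_def[of f]
        by (simp only:) (intro cmod_integral_diff_le conv_dirac_finite sets_to_measure conv_dirac_mass f a1
          Fubini_continuous_compact(2)[OF K F conv_dirac_finite sets_to_measure finite_lam sets_lam])
    qed
    \<comment> \<open>The bracketing \<open>W2\<close> lets y be integrated first, so the average
      runs over x^- * z and yields c g(x^- * z).\<close>
    have A2e: "cmod (A2 z - translate g (invol H x) z * c) \<le> \<eta> * c" for z
    proof -
      let ?M = "to_measure (conv H (dirac (invol H x)) (dirac z))"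
      have F: "continuous_on UNIV (\<lambda>(s, y). g y * translate h (invol H s) y)"
        using continuous_on_mult[OF fst'(2) continuous_kernel[OF h]]
        by (simp add: case_prod_unfold)
      have "A2 z = (\<integral>y. (\<integral>s. g y * translate h (invol H s) y \<partial>?M) \<partial>lam)"
        unfolding A2_def W2 by simp
      also have "\<dots> = (\<integral>s. (\<integral>y. g y * translate h (invol H s) y \<partial>lam) \<partial>?M)"
        by (rule Fubini_continuous_compact(1)[OF K F conv_dirac_finite sets_to_measure finite_lam sets_lam, symmetric])
      finally show ?thesis
        unfolding translate_def[of g]
        by (simp only:) (intro cmod_integral_diff_le conv_dirac_finite sets_to_measure conv_dirac_mass g a2
          Fubini_continuous_compact(2)[OF K F conv_dirac_finite sets_to_measure finite_lam sets_lam])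
    qed
    have "(\<integral>y. g y * A1 y \<partial>lam) = (\<integral>y. (\<integral>z. g y * f z * W z y \<partial>lam) \<partial>lam)"
      unfolding A1_def by (simp add: mult.assoc)
    also have "\<dots> = (\<integral>z. (\<integral>y. g y * f z * W z y \<partial>lam) \<partial>lam)"
    proof (rule Fubini_continuous_compact(1)[OF K _ finite_lam sets_lam finite_lam sets_lam])
      show "continuous_on UNIV (\<lambda>(y, z). g y * f z * W z y)"
        using continuous_on_mult[OF fst'(3) fW[unfolded case_prod_unfold]]
        by (simp add: case_prod_unfold mult.assoc)
    qed
    also have "\<dots> = (\<integral>z. f z * A2 z \<partial>lam)"
    proof -
      have "g y * f z * W z y = f z * (g y * W z y)" for y z by (simp add: mult_ac)
      then have "(\<integral>z. (\<integral>y. g y * f z * W z y \<partial>lam) \<partial>lam) = (\<integral>z. (\<integral>y. f z * (g y * W z y) \<partial>lam) \<partial>lam)"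
        by (simp only:)
      then show ?thesis unfolding A2_def by simp
    qed
    finally have A: "(\<integral>y. g y * A1 y \<partial>lam) = (\<integral>z. f z * A2 z \<partial>lam)" .
    have E: "cmod ((\<integral>y. v y * A y \<partial>lam) - (\<integral>y. v y * u y \<partial>lam) * c) \<le> B * (\<eta> * c)"
      if "continuous_on UNIV v" "\<And>y. cmod (v y) \<le> B" "continuous_on UNIV u" "continuous_on UNIV A"
        "\<And>y. cmod (A y - u y * c) \<le> \<eta> * c" "B > 0" for v u A :: "'a \<Rightarrow> complex" and B
    proof (rule cmod_integral_diff_le[OF finite_lam sets_lam measure_lam])
      show "cmod (v y * A y - v y * u y * c) \<le> B * (\<eta> * c)" for y
      proof -
        have "v y * A y - v y * u y * c = v y * (A y - u y * c)" by (simp add: algebra_simps)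
        then show ?thesis using that(2,5)[of y] \<open>B > 0\<close> by (simp add: norm_mult mult_mono)
      qed
    qed (intro continuous_intros that)+
    have "cmod ((\<integral>y. g y * A1 y \<partial>lam) - (\<integral>y. g y * translate f x y \<partial>lam) * c) \<le> Bg * (\<eta> * c)"
      by (intro E g Bg A1c A1e continuous_translate[OF f] continuous_on_const continuous_on_id)
    then have E1: "cmod ((\<integral>y. g y * A1 y \<partial>lam) - ?L * c) \<le> Bg * (\<eta> * c)" by (simp add: mult.commute)
    have E2: "cmod ((\<integral>z. f z * A2 z \<partial>lam) - ?R * c) \<le> Bf * (\<eta> * c)"
      by (intro E f Bf A2c A2e continuous_translate[OF g] continuous_on_const continuous_on_id)
    \<comment> \<open>Both sides times \<open>c\<close> are close to the same double integral, and
      the factor \<open>c\<close>, whose size is unknown, cancels.\<close>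
    have "cmod (?L - ?R) * c = cmod (?L * c - ?R * c)"
      using c by (simp add: left_diff_distrib[symmetric] norm_mult)
    also have "\<dots> \<le> cmod ((\<integral>y. g y * A1 y \<partial>lam) - ?L * c) + cmod ((\<integral>z. f z * A2 z \<partial>lam) - ?R * c)"
      using norm_triangle_ineq4[of "(\<integral>z. f z * A2 z \<partial>lam) - ?R * c" "(\<integral>z. f z * A2 z \<partial>lam) - ?L * c"]
      by (simp add: A add.commute)
    also have "\<dots> \<le> (Bf + Bg) * \<eta> * c" using E1 E2 by (simp add: algebra_simps)
    finally have "cmod (?L - ?R) \<le> (Bf + Bg) * \<eta>" using c by simp
    then show ?thesis unfolding \<eta>_def using Bf Bg by simp
  qed
  then have "cmod (?L - ?R) \<le> 0" by (rule field_le_epsilon)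
  then show ?thesis by simp
qed

end

section \<open>Paley inequality for orthogonal systems\<close>

text \<open>Let m be the largest value of \<phi> not above w. The layer m/2 < \<phi> \<le> m
  contributes at most m^2 (2/m) M = 2 m M by the assumption at y = m/2, and repeated halving leads
  to the geometric series 2 m + m + ... = 4 m.\<close>

lemma paley_weight_bound:
  fixes v \<phi> :: "'c \<Rightarrow> real"
  assumes F: "finite F" and v: "\<And>c. c \<in> F \<Longrightarrow> 0 \<le> v c" and \<phi>: "\<And>c. c \<in> F \<Longrightarrow> 0 < \<phi> c"
    and M: "\<And>y. y > 0 \<Longrightarrow> y * (\<Sum>c | c \<in> F \<and> y \<le> \<phi> c. v c) \<le> M"
    and w: "w > 0"
  shows "(\<Sum>c | c \<in> F \<and> \<phi> c \<le> w. v c * (\<phi> c)\<^sup>2) \<le> 4 * w * M"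
  using w
proof (induction "card {c \<in> F. \<phi> c \<le> w}" arbitrary: w rule: less_induct)
  case less
  have M0: "M \<ge> 0"
    using M[of 1] v by (force intro: order_trans[rotated] sum_nonneg)
  let ?S = "\<lambda>w. {c \<in> F. \<phi> c \<le> w}"
  have fin: "finite (?S w)" for w using F by auto
  show ?case
  proof (cases "?S w = {}")
    case True
    show ?thesis unfolding True using M0 less.prems by simp
  next
    case False
    define m where "m = Max (\<phi> ` ?S w)"
    have "m \<in> \<phi> ` ?S w" unfolding m_def using fin False by (intro Max_in) auto
    then obtain c0 where c0: "c0 \<in> F" "\<phi> c0 = m" "m \<le> w" by auto
    have m: "m > 0" using \<phi> c0 by auto
    have le: "\<phi> c \<le> m" if "c \<in> ?S w" for c
      unfolding m_def using fin that by (intro Max_ge) auto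
    \<comment> \<open>The induction counts the indices below the level; the maximizer
      \<open>c0\<close> is lost on passing to \<open>m/2\<close>.\<close>
    have "c0 \<in> ?S w - ?S (m/2)" "?S (m/2) \<subseteq> ?S w" using c0 m by auto
    then have "card (?S (m/2)) < card (?S w)"
      using fin by (intro psubset_card_mono) blast+
    then have IH: "(\<Sum>c \<in> ?S (m/2). v c * (\<phi> c)\<^sup>2) \<le> 4 * (m/2) * M"
      using less.hyps[of "m/2"] m by simp
    have "(\<Sum>c | c \<in> F \<and> m/2 < \<phi> c \<and> \<phi> c \<le> m. v c * (\<phi> c)\<^sup>2)
        \<le> (\<Sum>c | c \<in> F \<and> m/2 < \<phi> c \<and> \<phi> c \<le> m. v c * m\<^sup>2)"
      using v \<phi> by (intro sum_mono mult_left_mono power_mono) (auto intro: less_imp_le)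
    also have "\<dots> \<le> (\<Sum>c | c \<in> F \<and> m/2 \<le> \<phi> c. v c * m\<^sup>2)"
      using v F by (intro sum_mono2) auto
    also have "\<dots> = 2 * m * ((m/2) * (\<Sum>c | c \<in> F \<and> m/2 \<le> \<phi> c. v c))"
      by (simp add: sum_distrib_right[symmetric] power2_eq_square)
    also have "\<dots> \<le> 2 * m * M" using m M[of "m/2"] by (intro mult_left_mono) auto
    finally have up: "(\<Sum>c | c \<in> F \<and> m/2 < \<phi> c \<and> \<phi> c \<le> m. v c * (\<phi> c)\<^sup>2) \<le> 2 * m * M" .
    have "?S w = {c \<in> F. m/2 < \<phi> c \<and> \<phi> c \<le> m} \<union> ?S (m/2)"
      using le c0 m by force
    then have "(\<Sum>c \<in> ?S w. v c * (\<phi> c)\<^sup>2) =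
        (\<Sum>c \<in> {c \<in> F. m/2 < \<phi> c \<and> \<phi> c \<le> m} \<union> ?S (m/2). v c * (\<phi> c)\<^sup>2)"
      by simp
    also have "\<dots> = (\<Sum>c | c \<in> F \<and> m/2 < \<phi> c \<and> \<phi> c \<le> m. v c * (\<phi> c)\<^sup>2) + (\<Sum>c \<in> ?S (m/2). v c * (\<phi> c)\<^sup>2)"
      using F by (intro sum.union_disjoint) auto
    also have "\<dots> \<le> 4 * m * M" using up IH by simp
    also have "\<dots> \<le> 4 * w * M" using c0 M0 by (intro mult_right_mono) auto
    finally show ?thesis .
  qed
qed

text \<open>Layer-cake formula, put as a nonnegative integral so that it can be exchanged with sums
  and with the integral over the space.\<close>

lemma ennreal_powr_eq_nn_integral:
  assumes "p > 0" "b \<ge> 0"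
  shows "ennreal (b powr p) = (\<integral>\<^sup>+t. ennreal (indicator {0..b} t * (p * t powr (p - 1))) \<partial>lborel)"
proof -
  have "((\<lambda>t. p * t powr (p - 1)) has_integral p * (b powr (p - 1 + 1) / (p - 1 + 1))) {0..b}"
    using assms by (intro has_integral_mult_right has_integral_powr_from_0) auto
  then have "(\<integral>\<^sup>+t. ennreal (indicator {0..b} t * (p * t powr (p - 1))) \<partial>lborel) =
      ennreal (p * (b powr (p - 1 + 1) / (p - 1 + 1)))"
    using assms by (intro nn_integral_has_integral_lebesgue) auto
  then show ?thesis using assms by simp
qed

text \<open>The t-integral belonging to the large part of the function. It ends at t = u / M and
  converges at 0 because p > 1; this is the source of the factor 1 / (p - 1).\<close>

lemma nn_integral_powr_below:
  assumes "1 < p" "0 < M" "0 \<le> u"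
  shows "(\<integral>\<^sup>+t. ennreal (if 0 < t \<and> M * t < u then 8 * M * p * t powr (p - 2) * u else 0) \<partial>lborel)
    \<le> ennreal (8 * p / (p - 1) * M powr (2 - p) * u powr p)"
proof (cases "u = 0")
  case True
  have "(if 0 < t \<and> M * t < u then 8 * M * p * t powr (p - 2) * u else 0) = 0" for t
    using True by simp
  then show ?thesis using True by simp
next
  case False
  have "((\<lambda>t. (8 * M * p * u) * t powr (p - 2)) has_integral
      (8 * M * p * u) * ((u / M) powr (p - 2 + 1) / (p - 2 + 1))) {0..u / M}"
    using assms by (intro has_integral_mult_right has_integral_powr_from_0) auto
  then have "(\<integral>\<^sup>+t. ennreal (indicator {0..u / M} t * ((8 * M * p * u) * t powr (p - 2))) \<partial>lborel) =
      ennreal ((8 * M * p * u) * ((u / M) powr (p - 2 + 1) / (p - 2 + 1)))"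
    using assms by (intro nn_integral_has_integral_lebesgue) auto
  also have "(8 * M * p * u) * ((u / M) powr (p - 2 + 1) / (p - 2 + 1)) =
      8 * p / (p - 1) * M powr (2 - p) * u powr p"
  proof -
    have 1: "u * u powr (p - 1) = u powr p"
      using assms False powr_add[of u 1 "p - 1"] by simp
    have 2: "M / M powr (p - 1) = M powr (2 - p)"
      using assms powr_diff[of M 1 "p - 1"] by (simp add: algebra_simps)
    have "(8 * M * p * u) * ((u / M) powr (p - 2 + 1) / (p - 2 + 1)) =
        8 * p / (p - 1) * (M / M powr (p - 1)) * (u * u powr (p - 1))"
      using assms by (simp add: powr_divide mult_ac)
    then show ?thesis unfolding 1 2 .
  qed
  finally have "(\<integral>\<^sup>+t. ennreal (indicator {0..u / M} t * ((8 * M * p * u) * t powr (p - 2))) \<partial>lborel) =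
      ennreal (8 * p / (p - 1) * M powr (2 - p) * u powr p)" .
  moreover have "(\<integral>\<^sup>+t. ennreal (if 0 < t \<and> M * t < u then 8 * M * p * t powr (p - 2) * u else 0) \<partial>lborel)
      \<le> (\<integral>\<^sup>+t. ennreal (indicator {0..u / M} t * ((8 * M * p * u) * t powr (p - 2))) \<partial>lborel)"
    using assms by (intro nn_integral_mono ennreal_leI) (auto simp: indicator_def field_simps)
  ultimately show ?thesis by simp
qed

text \<open>The t-integral belonging to the small part. It begins at t = u / M and converges at
  infinity because p < 2; this is the source of the factor 1 / (2 - p).\<close>

lemma nn_integral_powr_above:
  assumes "1 < p" "p < 2" "0 < M" "0 \<le> u"
  shows "(\<integral>\<^sup>+t. ennreal (if 0 < t \<and> u \<le> M * t then 4 * p * t powr (p - 3) * u\<^sup>2 else 0) \<partial>lborel)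
    \<le> ennreal (4 * p / (2 - p) * M powr (2 - p) * u powr p)"
\<comment> \<open>For \<open>u = 0\<close> the range of t reaches 0, where
  \<open>t powr (p - 3)\<close> is not integrable; the factor \<open>u\<^sup>2\<close> saves this
  case.\<close>
proof (cases "u = 0")
  case True
  have "(if 0 < t \<and> u \<le> M * t then 4 * p * t powr (p - 3) * u\<^sup>2 else 0) = 0" for t
    using True by simp
  then show ?thesis using True by simp
next
  case False
  have "((\<lambda>t. (4 * p * u\<^sup>2) * t powr (p - 3)) has_integral
      (4 * p * u\<^sup>2) * (- ((u / M) powr (p - 3 + 1)) / (p - 3 + 1))) {u / M..}"
    using assms False by (intro has_integral_mult_right has_integral_powr_to_inf) auto
  then have "(\<integral>\<^sup>+t. ennreal (indicator {u / M..} t * ((4 * p * u\<^sup>2) * t powr (p - 3))) \<partial>lborel) =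
      ennreal ((4 * p * u\<^sup>2) * (- ((u / M) powr (p - 3 + 1)) / (p - 3 + 1)))"
    using assms by (intro nn_integral_has_integral_lebesgue) auto
  also have "(4 * p * u\<^sup>2) * (- ((u / M) powr (p - 3 + 1)) / (p - 3 + 1)) =
      4 * p / (2 - p) * M powr (2 - p) * u powr p"
  proof -
    have 1: "u\<^sup>2 * u powr (p - 2) = u powr p"
      using assms False powr_add[of u 2 "p - 2"] by (simp add: powr_numeral)
    have 2: "1 / M powr (p - 2) = M powr (2 - p)"
      using powr_minus_divide[of M "p - 2"] by simp
    have 3: "- x / (p - 2) = x / (2 - p)" for x
      using assms by (simp add: field_simps)
    have "(4 * p * u\<^sup>2) * (- ((u / M) powr (p - 3 + 1)) / (p - 3 + 1)) =
        4 * p / (2 - p) * (1 / M powr (p - 2)) * (u\<^sup>2 * u powr (p - 2))"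
      using assms 3[of "(u / M) powr (p - 2)"] by (simp add: powr_divide mult_ac)
    then show ?thesis unfolding 1 2 .
  qed
  finally have "(\<integral>\<^sup>+t. ennreal (indicator {u / M..} t * ((4 * p * u\<^sup>2) * t powr (p - 3))) \<partial>lborel) =
      ennreal (4 * p / (2 - p) * M powr (2 - p) * u powr p)" .
  moreover have "(\<integral>\<^sup>+t. ennreal (if 0 < t \<and> u \<le> M * t then 4 * p * t powr (p - 3) * u\<^sup>2 else 0) \<partial>lborel)
      \<le> (\<integral>\<^sup>+t. ennreal (indicator {u / M..} t * ((4 * p * u\<^sup>2) * t powr (p - 3))) \<partial>lborel)"
    using assms by (intro nn_integral_mono ennreal_leI) (auto simp: indicator_def field_simps)
  ultimately show ?thesis by simp
qed

lemma Lp_imp_integrable: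
  assumes "finite_measure M" "in_Lp M p f" "1 < p"
  shows "integrable M f"
proof -
  interpret finite_measure M by fact
  have f [measurable]: "f \<in> borel_measurable M" and fp: "integrable M (\<lambda>x. cmod (f x) powr p)"
    using assms by (auto simp: in_Lp_def)
  show ?thesis
  proof (rule Bochner_Integration.integrable_bound)
    show "integrable M (\<lambda>x. 1 + cmod (f x) powr p)" using fp by simp
    have "u \<le> 1 + u powr p" if "u \<ge> 0" for u :: real
    proof (cases "u \<le> 1")
      case False
      then have "u powr 1 \<le> u powr p" using assms by (intro powr_mono) auto
      then show ?thesis using False by simp
    qed (simp add: add_increasing2)
    then show "AE x in M. norm (f x) \<le> norm (1 + cmod (f x) powr p)" by simp
  qed simp
qed

text \<open>Where t \<phi> \<le> T1 + T2, one summand is at least t \<phi> / 2. For T1 this forces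
  \<phi> \<le> 2 a / t, and \<open>W\<close> at that level gives 8 M a / t; for T2 it is Chebyshev's
  inequality with squares, giving 4 b / t^2.\<close>

lemma level_set_bound:
  fixes T T1 T2 :: "'c \<Rightarrow> real"
  assumes F: "finite F" and v: "\<And>c. c \<in> F \<Longrightarrow> 0 \<le> v c" and \<phi>: "\<And>c. c \<in> F \<Longrightarrow> 0 < \<phi> c"
    and W: "\<And>w. w > 0 \<Longrightarrow> (\<Sum>c | c \<in> F \<and> \<phi> c \<le> w. v c * (\<phi> c)\<^sup>2) \<le> 4 * w * M"
    and T: "\<And>c. c \<in> F \<Longrightarrow> T c \<le> T1 c + T2 c"
    and T1: "\<And>c. c \<in> F \<Longrightarrow> T1 c \<le> a"
    and T2: "(\<Sum>c\<in>F. v c * (T2 c)\<^sup>2) \<le> b" "\<And>c. c \<in> F \<Longrightarrow> 0 \<le> T2 c"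
    and t: "t > 0" and M: "M \<ge> 0" and a: "a \<ge> 0"
  shows "(\<Sum>c | c \<in> F \<and> t \<le> T c / \<phi> c. v c * (\<phi> c)\<^sup>2) \<le> 8 * M / t * a + 4 / t\<^sup>2 * b"
proof -
  let ?A = "{c \<in> F. t / 2 * \<phi> c \<le> T1 c}" and ?B = "{c \<in> F. t / 2 * \<phi> c \<le> T2 c}"
  have nn: "0 \<le> v c * (\<phi> c)\<^sup>2" if "c \<in> F" for c using v that by simp
  have sub: "{c \<in> F. t \<le> T c / \<phi> c} \<subseteq> ?A \<union> ?B"
  proof
    fix c assume c: "c \<in> {c \<in> F. t \<le> T c / \<phi> c}"
    then have "t * \<phi> c \<le> T c" using \<phi>[of c] by (simp add: field_simps)
    then have "t * \<phi> c \<le> T1 c + T2 c" using T[of c] c by simp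
    then show "c \<in> ?A \<union> ?B" using c by force
  qed
  have "(\<Sum>c | c \<in> F \<and> t \<le> T c / \<phi> c. v c * (\<phi> c)\<^sup>2) \<le> (\<Sum>c\<in>?A \<union> ?B. v c * (\<phi> c)\<^sup>2)"
    using F sub nn by (intro sum_mono2) auto
  also have "\<dots> \<le> (\<Sum>c\<in>?A. v c * (\<phi> c)\<^sup>2) + (\<Sum>c\<in>?B. v c * (\<phi> c)\<^sup>2)"
    using F nn by (subst sum.union_inter[symmetric]) (auto intro!: sum_nonneg)
  also have "(\<Sum>c\<in>?A. v c * (\<phi> c)\<^sup>2) \<le> 8 * M / t * a"
  \<comment> \<open>\<open>W\<close> speaks of positive levels only.\<close>
  proof (cases "a = 0")
    case True
    have False if "c \<in> ?A" for c
    proof -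
      have "t / 2 * \<phi> c \<le> 0" using T1[of c] True that by simp
      moreover have "t / 2 * \<phi> c > 0" using \<phi> that t by auto
      ultimately show False by simp
    qed
    then have e: "?A = {}" by blast
    show ?thesis unfolding e using True by simp
  next
    case False
    have "\<phi> c \<le> 2 * a / t" if "c \<in> ?A" for c
      using T1[of c] that t by (simp add: field_simps)
    then have "(\<Sum>c\<in>?A. v c * (\<phi> c)\<^sup>2) \<le> (\<Sum>c | c \<in> F \<and> \<phi> c \<le> 2 * a / t. v c * (\<phi> c)\<^sup>2)"
      using F nn by (intro sum_mono2) auto
    also have "\<dots> \<le> 4 * (2 * a / t) * M" using False a t by (intro W) auto
    finally show ?thesis by (simp add: mult_ac)
  qed
  also have "(\<Sum>c\<in>?B. v c * (\<phi> c)\<^sup>2) \<le> 4 / t\<^sup>2 * b"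
  proof -
    have "(\<Sum>c\<in>?B. v c * (\<phi> c)\<^sup>2) \<le> (\<Sum>c\<in>?B. v c * (4 / t\<^sup>2 * (T2 c)\<^sup>2))"
    proof (intro sum_mono mult_left_mono)
      fix c assume c: "c \<in> ?B"
      then have "(t / 2 * \<phi> c)\<^sup>2 \<le> (T2 c)\<^sup>2" using \<phi>[of c] t by (intro power_mono) auto
      then show "(\<phi> c)\<^sup>2 \<le> 4 / t\<^sup>2 * (T2 c)\<^sup>2"
        using t by (simp add: power_mult_distrib power_divide field_simps)
    qed (use v in auto)
    also have "\<dots> \<le> (\<Sum>c\<in>F. v c * (4 / t\<^sup>2 * (T2 c)\<^sup>2))"
      using F v by (intro sum_mono2) auto
    also have "\<dots> = 4 / t\<^sup>2 * (\<Sum>c\<in>F. v c * (T2 c)\<^sup>2)"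
      by (simp add: sum_distrib_left mult_ac)
    also have "\<dots> \<le> 4 / t\<^sup>2 * b" using T2(1) by (intro mult_left_mono) auto
    finally show ?thesis .
  qed
  finally show ?thesis by simp
qed

text \<open>Marcinkiewicz interpolation between a weak type $(1,1)$ and a strong type $(2,2)$ estimate for
  \<open>f \<mapsto> T f / \<phi>\<close> with respect to the weights \<open>v \<phi>\<^sup>2\<close>. Cutting \<open>f\<close> at height \<open>M t\<close> instead of \<open>t\<close>
  makes both halves scale like \<open>M powr (2 - p)\<close>.\<close>

lemma paley_interpolation:
  fixes T :: "('a \<Rightarrow> complex) \<Rightarrow> 'c \<Rightarrow> real"
  assumes N: "finite_measure N"
    and F: "finite F" and v: "\<And>c. c \<in> F \<Longrightarrow> 0 \<le> v c" and \<phi>: "\<And>c. c \<in> F \<Longrightarrow> 0 < \<phi> c"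
    and W: "\<And>w. w > 0 \<Longrightarrow> (\<Sum>c | c \<in> F \<and> \<phi> c \<le> w. v c * (\<phi> c)\<^sup>2) \<le> 4 * w * M"
    and M: "M > 0"
    and T_nonneg: "\<And>f c. c \<in> F \<Longrightarrow> 0 \<le> T f c"
    and T_add: "\<And>f g c. integrable N f \<Longrightarrow> integrable N g \<Longrightarrow> c \<in> F \<Longrightarrow>
      T (\<lambda>x. f x + g x) c \<le> T f c + T g c"
    and T_L1: "\<And>f c. integrable N f \<Longrightarrow> c \<in> F \<Longrightarrow> T f c \<le> (\<integral>x. cmod (f x) \<partial>N)"
    and T_L2: "\<And>f. f \<in> borel_measurable N \<Longrightarrow> integrable N (\<lambda>x. (cmod (f x))\<^sup>2) \<Longrightarrow>
      (\<Sum>c\<in>F. v c * (T f c)\<^sup>2) \<le> (\<integral>x. (cmod (f x))\<^sup>2 \<partial>N)"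
    and p: "1 < p" "p < 2" and f: "in_Lp N p f"
  shows "(\<Sum>c\<in>F. v c * T f c powr p * \<phi> c powr (2 - p))
    \<le> (8 * p / (p - 1) + 4 * p / (2 - p)) * M powr (2 - p) * (\<integral>x. cmod (f x) powr p \<partial>N)"
proof -
  interpret finite_measure N by fact
  interpret L: pair_sigma_finite lborel N ..
  have fm [measurable]: "f \<in> borel_measurable N" and fp: "integrable N (\<lambda>x. cmod (f x) powr p)"
    using f by (auto simp: in_Lp_def)
  have fi: "integrable N f" by (rule Lp_imp_integrable[OF N f p(1)])
  let ?w = "\<lambda>c. v c * (\<phi> c)\<^sup>2"
  have w: "0 \<le> ?w c" if "c \<in> F" for c using v that by simp
  \<comment> \<open>The two terms of the level estimate times \<open>p * t powr (p - 1)\<close>,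
    with the parts of \<open>f\<close> above and below height \<open>M * t\<close> written out;
    division by t and by t^2 leaves the exponents p - 2 and p - 3.\<close>
  define G1 where "G1 t x = (if 0 < t \<and> M * t < cmod (f x) then 8 * M * p * t powr (p - 2) * cmod (f x) else 0)" for t x
  define G2 where "G2 t x = (if 0 < t \<and> cmod (f x) \<le> M * t then 4 * p * t powr (p - 3) * (cmod (f x))\<^sup>2 else 0)" for t x
  have G1m [measurable]: "(\<lambda>(t, x). ennreal (G1 t x)) \<in> borel_measurable (lborel \<Otimes>\<^sub>M N)"
    unfolding G1_def by measurable
  have G2m [measurable]: "(\<lambda>(t, x). ennreal (G2 t x)) \<in> borel_measurable (lborel \<Otimes>\<^sub>M N)"
    unfolding G2_def by measurable
  have G0: "G1 t x \<ge> 0" "G2 t x \<ge> 0" for t x using p M by (auto simp: G1_def G2_def)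
  have level: "ennreal (\<Sum>c\<in>F. ?w c * (indicator {0..T f c / \<phi> c} t * (p * t powr (p - 1))))
      \<le> (\<integral>\<^sup>+x. ennreal (G1 t x) \<partial>N) + (\<integral>\<^sup>+x. ennreal (G2 t x) \<partial>N)" for t
  proof (cases "t > 0")
    case False
    then have "(\<Sum>c\<in>F. ?w c * (indicator {0..T f c / \<phi> c} t * (p * t powr (p - 1)))) = 0"
      by (intro sum.neutral) (auto simp: indicator_def)
    then show ?thesis by simp
  next
    case t: True
    define f1 where "f1 x = (if M * t < cmod (f x) then f x else 0)" for x
    define f2 where "f2 x = (if M * t < cmod (f x) then 0 else f x)" for x
    have [measurable]: "f1 \<in> borel_measurable N" "f2 \<in> borel_measurable N"
      unfolding f1_def f2_def by measurable
    have f1: "integrable N f1"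
      by (rule Bochner_Integration.integrable_bound[OF fi]) (auto simp: f1_def)
    have f2: "integrable N f2"
      by (rule Bochner_Integration.integrable_bound[OF fi]) (auto simp: f2_def)
    have f2sq: "integrable N (\<lambda>x. (cmod (f2 x))\<^sup>2)"
    proof (rule integrable_const_bound[where B = "(M * t)\<^sup>2"])
      have "(cmod (f2 x))\<^sup>2 \<le> (M * t)\<^sup>2" for x
        using M t by (intro power_mono) (auto simp: f2_def)
      then show "AE x in N. norm ((cmod (f2 x))\<^sup>2) \<le> (M * t)\<^sup>2" by simp
    qed simp
    have split: "f = (\<lambda>x. f1 x + f2 x)" by (auto simp: f1_def f2_def)
    \<comment> \<open>The large part is controlled by the L1 bound, the small part by the L2
      bound.\<close>
    have bd: "(\<Sum>c | c \<in> F \<and> t \<le> T f c / \<phi> c. ?w c) \<le>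
        8 * M / t * (\<integral>x. cmod (f1 x) \<partial>N) + 4 / t\<^sup>2 * (\<integral>x. (cmod (f2 x))\<^sup>2 \<partial>N)"
    proof (rule level_set_bound[OF F v \<phi> W])
      show "T f c \<le> T f1 c + T f2 c" if "c \<in> F" for c
        using T_add[OF f1 f2 that] split by simp
    qed (use T_L1[OF f1] T_L2[OF _ f2sq] T_nonneg t M in auto)
    have "(\<Sum>c\<in>F. ?w c * (indicator {0..T f c / \<phi> c} t * (p * t powr (p - 1)))) =
        p * t powr (p - 1) * (\<Sum>c | c \<in> F \<and> t \<le> T f c / \<phi> c. ?w c)"
      unfolding sum_distrib_left using F t
      by (intro sum.mono_neutral_cong_right) (auto simp: indicator_def)
    also have "\<dots> \<le> p * t powr (p - 1) *
        (8 * M / t * (\<integral>x. cmod (f1 x) \<partial>N) + 4 / t\<^sup>2 * (\<integral>x. (cmod (f2 x))\<^sup>2 \<partial>N))"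
      using p by (intro mult_left_mono bd) auto
    also have "\<dots> = 8 * M * p * (t powr (p - 1) / t) * (\<integral>x. cmod (f1 x) \<partial>N) +
        4 * p * (t powr (p - 1) / t\<^sup>2) * (\<integral>x. (cmod (f2 x))\<^sup>2 \<partial>N)"
      by (simp add: algebra_simps)
    also have "t powr (p - 1) / t = t powr (p - 2)"
      using t powr_diff[of t "p - 1" 1] by (simp add: algebra_simps)
    also have "t powr (p - 1) / t\<^sup>2 = t powr (p - 3)"
      using t powr_diff[of t "p - 1" 2] by (simp add: algebra_simps powr_numeral)
    also have "8 * M * p * t powr (p - 2) * (\<integral>x. cmod (f1 x) \<partial>N) +
        4 * p * t powr (p - 3) * (\<integral>x. (cmod (f2 x))\<^sup>2 \<partial>N) =
        (\<integral>x. G1 t x \<partial>N) + (\<integral>x. G2 t x \<partial>N)"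
      unfolding Bochner_Integration.integral_mult_right_zero[symmetric]
      by (intro arg_cong2[where f = "(+)"] Bochner_Integration.integral_cong)
        (use t in \<open>auto simp: f1_def f2_def G1_def G2_def\<close>)
    finally have *: "(\<Sum>c\<in>F. ?w c * (indicator {0..T f c / \<phi> c} t * (p * t powr (p - 1))))
      \<le> (\<integral>x. G1 t x \<partial>N) + (\<integral>x. G2 t x \<partial>N)" .
    have i1: "integrable N (\<lambda>x. G1 t x)"
    proof -
      have "integrable N (\<lambda>x. 8 * M * p * t powr (p - 2) * cmod (f1 x))" using f1 by simp
      moreover have "(\<lambda>x. 8 * M * p * t powr (p - 2) * cmod (f1 x)) = (\<lambda>x. G1 t x)"
        using t by (auto simp: f1_def G1_def)
      ultimately show ?thesis by simp
    qed
    have i2: "integrable N (\<lambda>x. G2 t x)"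
    proof -
      have "integrable N (\<lambda>x. 4 * p * t powr (p - 3) * (cmod (f2 x))\<^sup>2)" using f2sq by simp
      moreover have "(\<lambda>x. 4 * p * t powr (p - 3) * (cmod (f2 x))\<^sup>2) = (\<lambda>x. G2 t x)"
        using t by (auto simp: f2_def G2_def)
      ultimately show ?thesis by simp
    qed
    show ?thesis
      using * by (subst (1 2) nn_integral_eq_integral)
        (auto simp: i1 i2 G0 ennreal_plus[symmetric] integral_nonneg intro!: ennreal_leI simp del: ennreal_plus)
  qed
  \<comment> \<open>The sum is the p-th power of the norm of T f / \<phi> for the weights v
    \<phi>^2, which is what the level sets control.\<close>
  have "(\<Sum>c\<in>F. v c * T f c powr p * \<phi> c powr (2 - p)) = (\<Sum>c\<in>F. ?w c * (T f c / \<phi> c) powr p)"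
  proof (rule sum.cong)
    fix c assume c: "c \<in> F"
    have "(\<phi> c)\<^sup>2 * (T f c / \<phi> c) powr p = T f c powr p * ((\<phi> c) powr 2 / \<phi> c powr p)"
      using \<phi>[OF c] T_nonneg[OF c, of f] by (simp add: powr_divide powr_numeral)
    also have "(\<phi> c) powr 2 / \<phi> c powr p = \<phi> c powr (2 - p)" by (simp add: powr_diff)
    finally show "v c * T f c powr p * \<phi> c powr (2 - p) = ?w c * (T f c / \<phi> c) powr p"
      by (simp add: mult_ac)
  qed simp
  then have "ennreal (\<Sum>c\<in>F. v c * T f c powr p * \<phi> c powr (2 - p)) =
      (\<Sum>c\<in>F. ennreal (?w c) * ennreal ((T f c / \<phi> c) powr p))"
    using w by (simp add: sum_ennreal[symmetric] ennreal_mult)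
  also have "\<dots> = (\<Sum>c\<in>F. ennreal (?w c) *
      (\<integral>\<^sup>+t. ennreal (indicator {0..T f c / \<phi> c} t * (p * t powr (p - 1))) \<partial>lborel))"
    using p T_nonneg \<phi> by (intro sum.cong refl arg_cong2[where f = "(*)"] ennreal_powr_eq_nn_integral)
      (auto intro!: divide_nonneg_pos)
  also have "\<dots> = (\<Sum>c\<in>F. \<integral>\<^sup>+t. ennreal (?w c) *
      ennreal (indicator {0..T f c / \<phi> c} t * (p * t powr (p - 1))) \<partial>lborel)"
    by (intro sum.cong refl nn_integral_cmult[symmetric]) measurable
  also have "\<dots> = (\<integral>\<^sup>+t. (\<Sum>c\<in>F. ennreal (?w c) *
      ennreal (indicator {0..T f c / \<phi> c} t * (p * t powr (p - 1)))) \<partial>lborel)"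
    by (intro nn_integral_sum[symmetric]) measurable
  also have "\<dots> = (\<integral>\<^sup>+t. ennreal (\<Sum>c\<in>F. ?w c *
      (indicator {0..T f c / \<phi> c} t * (p * t powr (p - 1)))) \<partial>lborel)"
    using w p by (intro nn_integral_cong) (simp add: sum_ennreal[symmetric] ennreal_mult)
  also have "\<dots> \<le> (\<integral>\<^sup>+t. ((\<integral>\<^sup>+x. ennreal (G1 t x) \<partial>N) + (\<integral>\<^sup>+x. ennreal (G2 t x) \<partial>N)) \<partial>lborel)"
    by (intro nn_integral_mono level)
  also have "\<dots> = (\<integral>\<^sup>+t. (\<integral>\<^sup>+x. ennreal (G1 t x) \<partial>N) \<partial>lborel) + (\<integral>\<^sup>+t. (\<integral>\<^sup>+x. ennreal (G2 t x) \<partial>N) \<partial>lborel)"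
    by (intro nn_integral_add) measurable
  \<comment> \<open>Tonelli's theorem: the t-integrals can now be computed for each x
    separately.\<close>
  also have "(\<integral>\<^sup>+t. (\<integral>\<^sup>+x. ennreal (G1 t x) \<partial>N) \<partial>lborel) = (\<integral>\<^sup>+x. (\<integral>\<^sup>+t. ennreal (G1 t x) \<partial>lborel) \<partial>N)"
    by (rule L.Fubini'[symmetric]) measurable
  also have "(\<integral>\<^sup>+t. (\<integral>\<^sup>+x. ennreal (G2 t x) \<partial>N) \<partial>lborel) = (\<integral>\<^sup>+x. (\<integral>\<^sup>+t. ennreal (G2 t x) \<partial>lborel) \<partial>N)"
    by (rule L.Fubini'[symmetric]) measurable
  also have "(\<integral>\<^sup>+x. (\<integral>\<^sup>+t. ennreal (G1 t x) \<partial>lborel) \<partial>N) + (\<integral>\<^sup>+x. (\<integral>\<^sup>+t. ennreal (G2 t x) \<partial>lborel) \<partial>N)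
      \<le> (\<integral>\<^sup>+x. ennreal (8 * p / (p - 1) * M powr (2 - p) * cmod (f x) powr p) \<partial>N) +
        (\<integral>\<^sup>+x. ennreal (4 * p / (2 - p) * M powr (2 - p) * cmod (f x) powr p) \<partial>N)"
    unfolding G1_def G2_def using p M
    by (intro add_mono nn_integral_mono nn_integral_powr_below nn_integral_powr_above) auto
  also have "\<dots> = ennreal (\<integral>x. 8 * p / (p - 1) * M powr (2 - p) * cmod (f x) powr p \<partial>N) +
        ennreal (\<integral>x. 4 * p / (2 - p) * M powr (2 - p) * cmod (f x) powr p \<partial>N)"
    using fp p M by (intro arg_cong2[where f = "(+)"] nn_integral_eq_integral) auto
  also have "\<dots> = ennreal ((8 * p / (p - 1) + 4 * p / (2 - p)) * M powr (2 - p) * (\<integral>x. cmod (f x) powr p \<partial>N))"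
    using p by (subst ennreal_plus[symmetric]) (auto simp: algebra_simps)
  finally show ?thesis
    using p by (subst (asm) ennreal_le_iff) auto
qed

section \<open>Bessel's inequality and abstract systems of matrix coefficients\<close>

lemma borel_measurable_cnj:
  "f \<in> borel_measurable M \<Longrightarrow> (\<lambda>x. cnj (f x)) \<in> borel_measurable M"
  by (rule measurable_compose[OF _ borel_measurable_continuous_onI[OF continuous_on_cnj[OF continuous_on_id]]])

text \<open>As \<open>e i\<close> has squared norm \<open>1 / k i\<close>, the projection of
  \<open>f\<close> is the sum \<open>g\<close> of the terms \<open>k i * a i * e i\<close>; the
  claim is the expansion of the integral of |f - g|^2. The bounds on \<open>e\<close> make all the
  products integrable.\<close>

lemma bessel_inequality:
  fixes e :: "'i \<Rightarrow> 'a \<Rightarrow> complex" and k :: "'i \<Rightarrow> real"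
  assumes N: "finite_measure N" and I: "finite I"
    and em: "\<And>i. i \<in> I \<Longrightarrow> e i \<in> borel_measurable N"
    and eb: "\<And>i x. i \<in> I \<Longrightarrow> cmod (e i x) \<le> b i"
    and k: "\<And>i. i \<in> I \<Longrightarrow> 0 < k i"
    and orth: "\<And>i j. i \<in> I \<Longrightarrow> j \<in> I \<Longrightarrow>
      (\<integral>x. e i x * cnj (e j x) \<partial>N) = (if i = j then complex_of_real (1 / k i) else 0)"
    and f: "f \<in> borel_measurable N" "integrable N (\<lambda>x. (cmod (f x))\<^sup>2)"
  shows "(\<Sum>i\<in>I. k i * (cmod (\<integral>x. f x * cnj (e i x) \<partial>N))\<^sup>2) \<le> (\<integral>x. (cmod (f x))\<^sup>2 \<partial>N)"
proof -
  interpret finite_measure N by fact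
  note [measurable] = f(1)
  have fi: "integrable N f"
  proof (rule Bochner_Integration.integrable_bound)
    show "integrable N (\<lambda>x. 1 + (cmod (f x))\<^sup>2)" using f(2) by simp
    have "u \<le> 1 + u\<^sup>2" for u :: real
      using zero_le_power2[of "u - 1/2"] by (simp add: power2_eq_square algebra_simps)
    then show "AE x in N. norm (f x) \<le> norm (1 + (cmod (f x))\<^sup>2)" by simp
  qed simp
  have fe: "integrable N (\<lambda>x. f x * cnj (e i x))" if i: "i \<in> I" for i
  proof (rule Bochner_Integration.integrable_bound)
    show "integrable N (\<lambda>x. b i * cmod (f x))" using fi by simp
    show "AE x in N. norm (f x * cnj (e i x)) \<le> norm (b i * cmod (f x))"
    proof (rule AE_I2)
      fix x
      have "cmod (f x) * cmod (e i x) \<le> cmod (f x) * b i" using eb[OF i] by (rule mult_left_mono) simp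
      moreover have "0 \<le> b i" using norm_ge_zero order_trans eb[OF i, of x] by blast
      ultimately show "norm (f x * cnj (e i x)) \<le> norm (b i * cmod (f x))"
        by (simp add: norm_mult mult_ac)
    qed
  qed (intro borel_measurable_times borel_measurable_cnj em i f(1))
  have ee: "integrable N (\<lambda>x. e i x * cnj (e j x))" if ij: "i \<in> I" "j \<in> I" for i j
  proof (rule integrable_const_bound[where B = "b i * b j"])
    have "cmod (e i x) * cmod (e j x) \<le> b i * b j" for x
      using eb ij by (intro mult_mono order_trans[OF norm_ge_zero eb]) auto
    then show "AE x in N. norm (e i x * cnj (e j x)) \<le> b i * b j" by (simp add: norm_mult)
  qed (intro borel_measurable_times borel_measurable_cnj em ij)
  define a where "a i = (\<integral>x. f x * cnj (e i x) \<partial>N)" for i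
  define g where "g x = (\<Sum>i\<in>I. complex_of_real (k i) * a i * e i x)" for x
  define S where "S = (\<Sum>i\<in>I. k i * (cmod (a i))\<^sup>2)"
  have fg_eq: "f x * cnj (g x) = (\<Sum>i\<in>I. complex_of_real (k i) * cnj (a i) * (f x * cnj (e i x)))" for x
    by (simp add: g_def sum_distrib_left mult_ac)
  have gg_eq: "g x * cnj (g x) = (\<Sum>i\<in>I. \<Sum>j\<in>I. complex_of_real (k i) * a i * (complex_of_real (k j) * cnj (a j)) * (e i x * cnj (e j x)))" for x
    by (simp add: g_def sum_product mult_ac)
  have fg: "integrable N (\<lambda>x. f x * cnj (g x))"
    unfolding fg_eq by (intro Bochner_Integration.integrable_sum integrable_mult_right fe)
  have gg: "integrable N (\<lambda>x. g x * cnj (g x))"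
    unfolding gg_eq by (intro Bochner_Integration.integrable_sum integrable_mult_right ee)
  have "(\<integral>x. f x * cnj (g x) \<partial>N) = (\<Sum>i\<in>I. complex_of_real (k i) * cnj (a i) * a i)"
    unfolding fg_eq a_def
    by (subst Bochner_Integration.integral_sum) (auto intro!: integrable_mult_right fe)
  also have "\<dots> = complex_of_real S"
    unfolding S_def of_real_sum of_real_mult complex_norm_square by (simp add: mult_ac)
  finally have ifg: "(\<integral>x. f x * cnj (g x) \<partial>N) = complex_of_real S" .
  have "(\<integral>x. g x * cnj (g x) \<partial>N) =
      (\<Sum>i\<in>I. \<Sum>j\<in>I. complex_of_real (k i) * a i * (complex_of_real (k j) * cnj (a j)) * (\<integral>x. e i x * cnj (e j x) \<partial>N))"
    unfolding gg_eq
    by (subst Bochner_Integration.integral_sum,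
        intro Bochner_Integration.integrable_sum integrable_mult_right ee; simp?)
      (intro sum.cong refl, subst Bochner_Integration.integral_sum,
        auto intro!: integrable_mult_right ee)
  also have "\<dots> = (\<Sum>i\<in>I. complex_of_real (k i) * a i * (complex_of_real (k i) * cnj (a i)) * complex_of_real (1 / k i))"
  proof (rule sum.cong)
    fix i assume i: "i \<in> I"
    let ?X = "\<lambda>j. complex_of_real (k i) * a i * (complex_of_real (k j) * cnj (a j))"
    have "(\<Sum>j\<in>I. ?X j * (\<integral>x. e i x * cnj (e j x) \<partial>N)) = (\<Sum>j\<in>I. if i = j then ?X i * complex_of_real (1 / k i) else 0)"
      using i by (intro sum.cong) (simp_all only: orth, auto)
    also have "\<dots> = ?X i * complex_of_real (1 / k i)" using I i by (subst sum.delta') auto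
    finally show "(\<Sum>j\<in>I. ?X j * (\<integral>x. e i x * cnj (e j x) \<partial>N)) = ?X i * complex_of_real (1 / k i)" .
  qed simp
  also have "\<dots> = (\<Sum>i\<in>I. complex_of_real (k i) * (a i * cnj (a i)))"
    using k by (intro sum.cong refl) (simp add: field_simps less_imp_neq[THEN not_sym])
  also have "\<dots> = complex_of_real S"
    unfolding S_def of_real_sum of_real_mult complex_norm_square by simp
  finally have igg: "(\<integral>x. g x * cnj (g x) \<partial>N) = complex_of_real S" .
  have gsq: "(cmod (g x))\<^sup>2 = Re (g x * cnj (g x))" for x
    by (metis Re_complex_of_real complex_norm_square)
  have ig2: "integrable N (\<lambda>x. (cmod (g x))\<^sup>2)" "(\<integral>x. (cmod (g x))\<^sup>2 \<partial>N) = S"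
    unfolding gsq using integrable_Re[OF gg] integral_Re[OF gg] igg
    by (simp_all only: Re_complex_of_real)
  have eq: "(cmod (f x - g x))\<^sup>2 = (cmod (f x))\<^sup>2 - 2 * Re (f x * cnj (g x)) + (cmod (g x))\<^sup>2" for x
    unfolding cmod_power2 by (simp add: power2_eq_square algebra_simps)
  have "0 \<le> (\<integral>x. (cmod (f x - g x))\<^sup>2 \<partial>N)" by (intro Bochner_Integration.integral_nonneg) auto
  also have "\<dots> = (\<integral>x. (cmod (f x))\<^sup>2 \<partial>N) - 2 * (\<integral>x. Re (f x * cnj (g x)) \<partial>N) + (\<integral>x. (cmod (g x))\<^sup>2 \<partial>N)"
    unfolding eq
  proof -
    have i: "integrable N (\<lambda>x. 2 * Re (f x * cnj (g x)))"
      by (intro integrable_mult_right integrable_Re fg)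
    show "(\<integral>x. (cmod (f x))\<^sup>2 - 2 * Re (f x * cnj (g x)) + (cmod (g x))\<^sup>2 \<partial>N) =
        (\<integral>x. (cmod (f x))\<^sup>2 \<partial>N) - 2 * (\<integral>x. Re (f x * cnj (g x)) \<partial>N) + (\<integral>x. (cmod (g x))\<^sup>2 \<partial>N)"
      using Bochner_Integration.integral_add[OF Bochner_Integration.integrable_diff[OF f(2) i] ig2(1)]
        Bochner_Integration.integral_diff[OF f(2) i] by (simp only: Bochner_Integration.integral_mult_right_zero)
  qed
  also have "(\<integral>x. Re (f x * cnj (g x)) \<partial>N) = S" using integral_Re[OF fg] ifg by simp
  finally show ?thesis unfolding ig2(2) S_def a_def by simp
qed

text \<open>What the interpolation uses of the dual: \<open>e\<close> stands for the matrix
  coefficients and \<open>k\<close> for the hyperdimensions. \<open>e_bound\<close> condenses the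
  Hilbert-Schmidt bound by d and the inequality d \<le> k.\<close>

locale orthogonal_matrix_system =
  fixes N :: "'a measure" and D :: "'c set" and d :: "'c \<Rightarrow> nat" and k :: "'c \<Rightarrow> real"
    and e :: "'c \<Rightarrow> nat \<Rightarrow> nat \<Rightarrow> 'a \<Rightarrow> complex"
  assumes finite_N: "finite_measure N"
    and e_measurable: "c \<in> D \<Longrightarrow> i < d c \<Longrightarrow> j < d c \<Longrightarrow> e c i j \<in> borel_measurable N"
    and e_bound: "c \<in> D \<Longrightarrow> (\<Sum>i<d c. \<Sum>j<d c. (cmod (e c i j x))\<^sup>2) \<le> k c"
    and k_pos: "c \<in> D \<Longrightarrow> 0 < k c"
    and orth: "c \<in> D \<Longrightarrow> c' \<in> D \<Longrightarrow> i < d c \<Longrightarrow> j < d c \<Longrightarrow> m < d c' \<Longrightarrow> l < d c' \<Longrightarrow>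
      (\<integral>x. e c i j x * cnj (e c' m l x) \<partial>N) =
        (if i = m \<and> j = l \<and> c = c' then complex_of_real (1 / k c) else 0)"
begin

definition coeff :: "('a \<Rightarrow> complex) \<Rightarrow> 'c \<Rightarrow> nat \<Rightarrow> nat \<Rightarrow> complex" where
  "coeff f c i j = (\<integral>x. f x * cnj (e c i j x) \<partial>N)"

definition coeff_norm :: "('a \<Rightarrow> complex) \<Rightarrow> 'c \<Rightarrow> real" where
  "coeff_norm f c = sqrt (\<Sum>i<d c. \<Sum>j<d c. (cmod (coeff f c i j))\<^sup>2)"

lemma coeff_norm_L2_set:
  "coeff_norm f c = L2_set (\<lambda>(i, j). cmod (coeff f c i j)) ({..<d c} \<times> {..<d c})"
  by (simp add: coeff_norm_def L2_set_def sum.cartesian_product case_prod_unfold)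

lemma coeff_norm_nonneg: "0 \<le> coeff_norm f c"
  unfolding coeff_norm_L2_set by (rule L2_set_nonneg)

lemma e_L2_set: "c \<in> D \<Longrightarrow> L2_set (\<lambda>(i, j). cmod (e c i j x)) ({..<d c} \<times> {..<d c}) \<le> sqrt (k c)"
  using e_bound[of c x] by (simp add: L2_set_def sum.cartesian_product case_prod_unfold)

lemma e_norm_le:
  assumes "c \<in> D" "i < d c" "j < d c"
  shows "cmod (e c i j x) \<le> sqrt (k c)"
proof -
  have "cmod (e c i j x) = (\<lambda>(i, j). cmod (e c i j x)) (i, j)" by simp
  also have "\<dots> \<le> L2_set (\<lambda>(i, j). cmod (e c i j x)) ({..<d c} \<times> {..<d c})"
    using assms by (intro member_le_L2_set) auto
  finally show ?thesis using e_L2_set[OF assms(1), of x] by simp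
qed

lemma integrable_mult_e:
  assumes f: "integrable N f" and c: "c \<in> D" "i < d c" "j < d c"
  shows "integrable N (\<lambda>x. f x * cnj (e c i j x))"
proof (rule Bochner_Integration.integrable_bound)
  show "integrable N (\<lambda>x. sqrt (k c) * cmod (f x))" using f by simp
  show "AE x in N. norm (f x * cnj (e c i j x)) \<le> norm (sqrt (k c) * cmod (f x))"
    using e_norm_le[OF c] k_pos[OF c(1)]
    by (intro AE_I2) (simp add: norm_mult mult.commute[of "cmod (f _)"] mult_right_mono)
qed (intro borel_measurable_times borel_measurable_cnj borel_measurable_integrable[OF f] e_measurable c)

lemma coeff_norm_add:
  assumes f: "integrable N f" and g: "integrable N g" and c: "c \<in> D"
  shows "coeff_norm (\<lambda>x. f x + g x) c \<le> coeff_norm f c + coeff_norm g c"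
proof -
  have eq: "coeff (\<lambda>x. f x + g x) c i j = coeff f c i j + coeff g c i j" if "i < d c" "j < d c" for i j
    unfolding coeff_def distrib_right
    by (intro Bochner_Integration.integral_add integrable_mult_e f g c that)
  have "coeff_norm (\<lambda>x. f x + g x) c \<le>
      L2_set (\<lambda>z. (case z of (i, j) \<Rightarrow> cmod (coeff f c i j)) + (case z of (i, j) \<Rightarrow> cmod (coeff g c i j)))
        ({..<d c} \<times> {..<d c})"
    unfolding coeff_norm_L2_set by (intro L2_set_mono) (auto simp: eq norm_triangle_ineq)
  also have "\<dots> \<le> coeff_norm f c + coeff_norm g c"
    unfolding coeff_norm_L2_set by (rule L2_set_triangle_ineq)
  finally show ?thesis .
qed

text \<open>Duality: \<open>f\<close> is tested against the function \<open>h\<close> that pairs its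
  own coefficient matrix with \<open>e\<close>. The integral of f h is the squared norm,
  Cauchy-Schwarz bounds |h| by the norm times \<open>sqrt (k c)\<close>, and one factor
  cancels.\<close>

lemma coeff_norm_le_L1:
  assumes f: "integrable N f" and c: "c \<in> D"
  shows "coeff_norm f c \<le> sqrt (k c) * (\<integral>x. cmod (f x) \<partial>N)"
proof -
  let ?P = "{..<d c} \<times> {..<d c}"
  define h where "h x = (\<Sum>(i, j)\<in>?P. cnj (coeff f c i j) * cnj (e c i j x))" for x
  have h: "cmod (h x) \<le> coeff_norm f c * sqrt (k c)" for x
  proof -
    have "cmod (h x) \<le> (\<Sum>z\<in>?P. \<bar>case z of (i, j) \<Rightarrow> cmod (coeff f c i j)\<bar> * \<bar>case z of (i, j) \<Rightarrow> cmod (e c i j x)\<bar>)"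
      unfolding h_def by (rule order_trans[OF norm_sum]) (auto intro!: sum_mono simp: norm_mult)
    also have "\<dots> \<le> coeff_norm f c * L2_set (\<lambda>(i, j). cmod (e c i j x)) ?P"
      unfolding coeff_norm_L2_set by (rule L2_set_mult_ineq)
    also have "\<dots> \<le> coeff_norm f c * sqrt (k c)"
      by (intro mult_left_mono e_L2_set c coeff_norm_nonneg)
    finally show ?thesis .
  qed
  have fh_eq: "f x * h x = (\<Sum>(i, j)\<in>?P. cnj (coeff f c i j) * (f x * cnj (e c i j x)))" for x
    unfolding h_def sum_distrib_left by (intro sum.cong) (auto simp: mult_ac)
  have fh: "integrable N (\<lambda>x. f x * h x)"
    unfolding fh_eq by (intro Bochner_Integration.integrable_sum)
      (auto intro!: integrable_mult_right integrable_mult_e f c)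
  have "(\<integral>x. f x * h x \<partial>N) = (\<Sum>z\<in>?P. \<integral>x. (case z of (i, j) \<Rightarrow> cnj (coeff f c i j) * (f x * cnj (e c i j x))) \<partial>N)"
    unfolding fh_eq by (intro Bochner_Integration.integral_sum)
      (auto intro!: integrable_mult_right integrable_mult_e f c)
  also have "\<dots> = (\<Sum>(i, j)\<in>?P. complex_of_real ((cmod (coeff f c i j))\<^sup>2))"
    by (intro sum.cong) (auto simp: coeff_def complex_norm_square mult.commute[of "cnj _"]
        Bochner_Integration.integral_mult_right_zero[symmetric] simp del: of_real_power)
  also have "\<dots> = complex_of_real ((coeff_norm f c)\<^sup>2)"
    unfolding coeff_norm_def
    by (simp add: sum_nonneg sum.cartesian_product case_prod_unfold)
  finally have "complex_of_real ((coeff_norm f c)\<^sup>2) = (\<integral>x. f x * h x \<partial>N)" ..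
  then have "cmod (complex_of_real ((coeff_norm f c)\<^sup>2)) = cmod (\<integral>x. f x * h x \<partial>N)" by simp
  then have "(coeff_norm f c)\<^sup>2 = cmod (\<integral>x. f x * h x \<partial>N)" by (simp add: norm_power)
  also have "\<dots> \<le> (\<integral>x. cmod (f x * h x) \<partial>N)" by (rule integral_norm_bound)
  also have "\<dots> \<le> (\<integral>x. (coeff_norm f c * sqrt (k c)) * cmod (f x) \<partial>N)"
  proof (rule integral_mono)
    show "integrable N (\<lambda>x. cmod (f x * h x))" using fh by (rule integrable_norm)
    show "integrable N (\<lambda>x. (coeff_norm f c * sqrt (k c)) * cmod (f x))" using f by simp
    show "cmod (f x * h x) \<le> (coeff_norm f c * sqrt (k c)) * cmod (f x)" for x
      using h[of x] by (simp add: norm_mult mult.commute[of "cmod (f x)"] mult_right_mono)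
  qed
  also have "\<dots> = coeff_norm f c * (sqrt (k c) * (\<integral>x. cmod (f x) \<partial>N))" by simp
  finally have "coeff_norm f c * coeff_norm f c \<le> coeff_norm f c * (sqrt (k c) * (\<integral>x. cmod (f x) \<partial>N))"
    by (simp add: power2_eq_square)
  moreover have "0 \<le> sqrt (k c) * (\<integral>x. cmod (f x) \<partial>N)"
    using k_pos[OF c] by (intro mult_nonneg_nonneg integral_nonneg) auto
  \<comment> \<open>A norm 0 cannot be cancelled; there the claim is the nonnegativity just
    shown.\<close>
  ultimately show ?thesis
    using coeff_norm_nonneg[of f c] by (cases "coeff_norm f c = 0") auto
qed

text \<open>Bessel's inequality for the entries of all classes in \<open>F\<close> at once, indexed
  by class, row and column.\<close>

lemma coeff_norm_L2:
  assumes F: "finite F" "F \<subseteq> D" and f: "f \<in> borel_measurable N" "integrable N (\<lambda>x. (cmod (f x))\<^sup>2)"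
  shows "(\<Sum>c\<in>F. k c * (coeff_norm f c)\<^sup>2) \<le> (\<integral>x. (cmod (f x))\<^sup>2 \<partial>N)"
proof -
  let ?I = "SIGMA c:F. {..<d c} \<times> {..<d c}"
  have "(\<Sum>c\<in>F. k c * (coeff_norm f c)\<^sup>2) =
      (\<Sum>c\<in>F. \<Sum>z\<in>{..<d c} \<times> {..<d c}. k c * (cmod (coeff f c (fst z) (snd z)))\<^sup>2)"
    by (simp add: coeff_norm_def sum_nonneg sum.cartesian_product case_prod_unfold sum_distrib_left)
  also have "\<dots> = (\<Sum>t\<in>?I. k (fst t) * (cmod (\<integral>x. f x * cnj (e (fst t) (fst (snd t)) (snd (snd t)) x) \<partial>N))\<^sup>2)"
    using F by (subst sum.Sigma) (auto simp: case_prod_unfold coeff_def)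
  also have "\<dots> \<le> (\<integral>x. (cmod (f x))\<^sup>2 \<partial>N)"
  proof (rule bessel_inequality[OF finite_N, where b = "\<lambda>t. sqrt (k (fst t))"])
    show "finite ?I" using F by auto
    fix t assume t: "t \<in> ?I"
    then have t': "fst t \<in> D" "fst (snd t) < d (fst t)" "snd (snd t) < d (fst t)" using F by auto
    show "e (fst t) (fst (snd t)) (snd (snd t)) \<in> borel_measurable N" by (rule e_measurable[OF t'])
    show "cmod (e (fst t) (fst (snd t)) (snd (snd t)) x) \<le> sqrt (k (fst t))" for x by (rule e_norm_le[OF t'])
    show "0 < k (fst t)" by (rule k_pos[OF t'(1)])
    fix u assume u: "u \<in> ?I"
    then have u': "fst u \<in> D" "fst (snd u) < d (fst u)" "snd (snd u) < d (fst u)" using F by auto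
    show "(\<integral>x. e (fst t) (fst (snd t)) (snd (snd t)) x * cnj (e (fst u) (fst (snd u)) (snd (snd u)) x) \<partial>N) =
      (if t = u then complex_of_real (1 / k (fst t)) else 0)"
      unfolding orth[OF t'(1) u'(1) t'(2,3) u'(2,3)] by (auto simp: prod_eq_iff)
  qed (use f in auto)
  finally show ?thesis .
qed

text \<open>The constant is fixed before \<phi>, \<open>M\<close>, \<open>F\<close> and
  \<open>f\<close>. The interpolated operator is the coefficient norm divided by the root of k, with
  v = k^2.\<close>

lemma paley_finite:
  assumes p: "1 < p" "p \<le> 2"
  obtains C where "C > 0"
    "\<And>\<phi> M F f. finite F \<Longrightarrow> F \<subseteq> D \<Longrightarrow> (\<And>c. c \<in> F \<Longrightarrow> 0 < \<phi> c) \<Longrightarrow> 0 < M \<Longrightarrow>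
      (\<And>y. y > 0 \<Longrightarrow> y * (\<Sum>c | c \<in> F \<and> y \<le> \<phi> c. (k c)\<^sup>2) \<le> M) \<Longrightarrow> in_Lp N p f \<Longrightarrow>
      (\<Sum>c\<in>F. (k c)\<^sup>2 * (coeff_norm f c / sqrt (k c)) powr p * \<phi> c powr (2 - p))
        \<le> C * M powr (2 - p) * (\<integral>x. cmod (f x) powr p \<partial>N)"
proof -
  have L2: "(\<Sum>c\<in>F. (k c)\<^sup>2 * (coeff_norm f c / sqrt (k c))\<^sup>2) \<le> (\<integral>x. (cmod (f x))\<^sup>2 \<partial>N)"
    if "finite F" "F \<subseteq> D" "f \<in> borel_measurable N" "integrable N (\<lambda>x. (cmod (f x))\<^sup>2)" for F f
  proof -
    have "(\<Sum>c\<in>F. (k c)\<^sup>2 * (coeff_norm f c / sqrt (k c))\<^sup>2) = (\<Sum>c\<in>F. k c * (coeff_norm f c)\<^sup>2)"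
    proof (rule sum.cong)
      fix c assume "c \<in> F"
      then have "k c > 0" using that k_pos by auto
      then show "(k c)\<^sup>2 * (coeff_norm f c / sqrt (k c))\<^sup>2 = k c * (coeff_norm f c)\<^sup>2"
        by (simp add: power_divide power2_eq_square)
    qed simp
    then show ?thesis using coeff_norm_L2[OF that] by simp
  qed
  show ?thesis
  proof (cases "p = 2")
    \<comment> \<open>The endpoint is Bessel's inequality alone; the interpolation constant blows up
      as p tends to 2.\<close>
    case True
    show ?thesis
    proof (rule that[of 1])
      fix \<phi> :: "'c \<Rightarrow> real" and M :: real and F f
      assume *: "finite F" "F \<subseteq> D" "\<And>c. c \<in> F \<Longrightarrow> 0 < \<phi> c" "0 < M" "in_Lp N p f"
      have "(\<Sum>c\<in>F. (k c)\<^sup>2 * (coeff_norm f c / sqrt (k c)) powr p * \<phi> c powr (2 - p)) =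
          (\<Sum>c\<in>F. (k c)\<^sup>2 * (coeff_norm f c / sqrt (k c))\<^sup>2)"
      proof (rule sum.cong)
        fix c assume c: "c \<in> F"
        then have "0 \<le> coeff_norm f c / sqrt (k c)"
          using coeff_norm_nonneg[of f c] k_pos[of c] *(2) by auto
        then show "(k c)\<^sup>2 * (coeff_norm f c / sqrt (k c)) powr p * \<phi> c powr (2 - p) =
            (k c)\<^sup>2 * (coeff_norm f c / sqrt (k c))\<^sup>2"
          using *(3)[OF c] True by (simp add: powr_numeral)
      qed simp
      also have "\<dots> \<le> (\<integral>x. (cmod (f x))\<^sup>2 \<partial>N)"
        using * True by (intro L2) (auto simp: in_Lp_def powr_numeral)
      finally show "(\<Sum>c\<in>F. (k c)\<^sup>2 * (coeff_norm f c / sqrt (k c)) powr p * \<phi> c powr (2 - p))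
        \<le> 1 * M powr (2 - p) * (\<integral>x. cmod (f x) powr p \<partial>N)"
        using *(4) True by (simp add: powr_numeral)
    qed simp
  next
    case False
    with p have p': "p < 2" by simp
    show ?thesis
    proof (rule that[of "8 * p / (p - 1) + 4 * p / (2 - p)"])
      show "0 < 8 * p / (p - 1) + 4 * p / (2 - p)" using p p' by (intro add_pos_pos divide_pos_pos) auto
      fix \<phi> :: "'c \<Rightarrow> real" and M :: real and F f
      assume *: "finite F" "F \<subseteq> D" "\<And>c. c \<in> F \<Longrightarrow> 0 < \<phi> c" "0 < M"
        "\<And>y. y > 0 \<Longrightarrow> y * (\<Sum>c | c \<in> F \<and> y \<le> \<phi> c. (k c)\<^sup>2) \<le> M" "in_Lp N p f"
      have k: "0 < k c" if "c \<in> F" for c using k_pos *(2) that by auto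
      show "(\<Sum>c\<in>F. (k c)\<^sup>2 * (coeff_norm f c / sqrt (k c)) powr p * \<phi> c powr (2 - p))
        \<le> (8 * p / (p - 1) + 4 * p / (2 - p)) * M powr (2 - p) * (\<integral>x. cmod (f x) powr p \<partial>N)"
      proof (rule paley_interpolation[OF finite_N *(1) _ *(3) _ *(4) _ _ _ _ p(1) p' *(6)])
        show "(\<Sum>c | c \<in> F \<and> \<phi> c \<le> w. (k c)\<^sup>2 * (\<phi> c)\<^sup>2) \<le> 4 * w * M" if "w > 0" for w
          by (rule paley_weight_bound[OF *(1) _ *(3) *(5) that]) auto
      next
        fix f g :: "'a \<Rightarrow> complex" and c assume fg: "integrable N f" "integrable N g" "c \<in> F"
        then show "coeff_norm (\<lambda>x. f x + g x) c / sqrt (k c) \<le> coeff_norm f c / sqrt (k c) + coeff_norm g c / sqrt (k c)"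
          using coeff_norm_add[OF fg(1,2), of c] *(2) k[of c]
          by (auto simp: add_divide_distrib[symmetric] intro!: divide_right_mono)
      next
        fix f :: "'a \<Rightarrow> complex" and c assume fg: "integrable N f" "c \<in> F"
        then show "coeff_norm f c / sqrt (k c) \<le> (\<integral>x. cmod (f x) \<partial>N)"
          using coeff_norm_le_L1[OF fg(1), of c] *(2) k[of c]
          by (auto simp: pos_divide_le_eq mult_ac)
      next
        show "0 \<le> coeff_norm f c / sqrt (k c)" if "c \<in> F" for c and f :: "'a \<Rightarrow> complex"
          using coeff_norm_nonneg[of f c] k[OF that] by simp
      qed (use L2[OF *(1,2)] in auto)
    qed
  qed
qed

lemma paley_inequality:
  assumes p: "1 < p" "p \<le> 2"
  shows "\<exists>C>0. \<forall>\<phi> M f. (\<forall>c\<in>D. 0 < \<phi> c) \<longrightarrow> 0 < M \<longrightarrow>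
    (\<forall>y F. 0 < y \<longrightarrow> finite F \<longrightarrow> F \<subseteq> {c\<in>D. y \<le> \<phi> c} \<longrightarrow> y * (\<Sum>c\<in>F. (k c)\<^sup>2) \<le> M) \<longrightarrow> in_Lp N p f \<longrightarrow>
      (\<lambda>c. (k c)\<^sup>2 * (coeff_norm f c / sqrt (k c)) powr p * \<phi> c powr (2 - p)) summable_on D \<and>
      (\<Sum>\<^sub>\<infinity>c\<in>D. (k c)\<^sup>2 * (coeff_norm f c / sqrt (k c)) powr p * \<phi> c powr (2 - p)) powr (1 / p)
        \<le> C * M powr ((2 - p) / p) * Lp_norm N p f"
proof -
  show ?thesis
  proof (rule paley_finite[OF p])
    fix C :: real
    assume C: "C > 0"
    "\<And>\<phi> M F f. finite F \<Longrightarrow> F \<subseteq> D \<Longrightarrow> (\<And>c. c \<in> F \<Longrightarrow> 0 < \<phi> c) \<Longrightarrow> 0 < M \<Longrightarrow>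
      (\<And>y. y > 0 \<Longrightarrow> y * (\<Sum>c | c \<in> F \<and> y \<le> \<phi> c. (k c)\<^sup>2) \<le> M) \<Longrightarrow> in_Lp N p f \<Longrightarrow>
      (\<Sum>c\<in>F. (k c)\<^sup>2 * (coeff_norm f c / sqrt (k c)) powr p * \<phi> c powr (2 - p))
        \<le> C * M powr (2 - p) * (\<integral>x. cmod (f x) powr p \<partial>N)"
  show ?thesis
  \<comment> \<open>The finite estimate is for p-th powers, so its constant enters with exponent 1 /
    p.\<close>
  proof (intro exI[of _ "C powr (1 / p)"] conjI allI impI)
    show "0 < C powr (1 / p)" using C by simp
    fix \<phi> :: "'c \<Rightarrow> real" and M f
    assume *: "\<forall>c\<in>D. 0 < \<phi> c" "0 < M"
      "\<forall>y F. 0 < y \<longrightarrow> finite F \<longrightarrow> F \<subseteq> {c\<in>D. y \<le> \<phi> c} \<longrightarrow> y * (\<Sum>c\<in>F. (k c)\<^sup>2) \<le> M" "in_Lp N p f"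
    let ?g = "\<lambda>c. (k c)\<^sup>2 * (coeff_norm f c / sqrt (k c)) powr p * \<phi> c powr (2 - p)"
    let ?R = "C * M powr (2 - p) * (\<integral>x. cmod (f x) powr p \<partial>N)"
    have g: "0 \<le> ?g c" for c by simp
    have bd: "sum ?g F \<le> ?R" if "finite F" "F \<subseteq> D" for F
    proof (rule C(2)[OF that _ *(2) _ *(4)])
      show "0 < \<phi> c" if "c \<in> F" for c using * that \<open>F \<subseteq> D\<close> by auto
      show "y * (\<Sum>c | c \<in> F \<and> y \<le> \<phi> c. (k c)\<^sup>2) \<le> M" if "y > 0" for y
        using that \<open>finite F\<close> \<open>F \<subseteq> D\<close> by (intro *(3)[rule_format]) auto
    qed
    show s: "?g summable_on D"
      using g bd by (intro nonneg_bdd_above_summable_on bdd_aboveI2[where M = ?R]) auto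
    have le: "infsum ?g D \<le> ?R" using s bd by (rule infsum_le_finite_sums)
    have "infsum ?g D powr (1 / p) \<le> ?R powr (1 / p)"
      using le p g by (intro powr_mono2 infsum_nonneg) auto
    also have "\<dots> = C powr (1 / p) * M powr ((2 - p) / p) * Lp_norm N p f"
      using C(1) by (simp add: Lp_norm_def powr_mult powr_powr)
    finally show "infsum ?g D powr (1 / p) \<le> C powr (1 / p) * M powr ((2 - p) / p) * Lp_norm N p f" .
  qed
  qed
qed

end

section \<open>Schur orthogonality\<close>

lemma
  fixes A :: "complex mat"
  shows dim_mat_adjoint [simp]: "dim_row (mat_adjoint A) = dim_col A" "dim_col (mat_adjoint A) = dim_row A"
    and index_mat_adjoint [simp]: "i < dim_col A \<Longrightarrow> j < dim_row A \<Longrightarrow> mat_adjoint A $$ (i, j) = cnj (A $$ (j, i))"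
  by (auto simp: mat_adjoint_def mat_of_rows_def)

lemma mat_adjoint_carrier: "A \<in> carrier_mat n m \<Longrightarrow> mat_adjoint (A :: complex mat) \<in> carrier_mat m n"
  by auto

lemma index_mult_mat_sum:
  assumes "A \<in> carrier_mat n k" "B \<in> carrier_mat k m" "i < n" "j < m"
  shows "(A * B) $$ (i, j) = (\<Sum>l<k. A $$ (i, l) * B $$ (l, j))"
  using assms by (auto simp: scalar_prod_def atLeast0LessThan intro!: sum.cong)

lemma mat_adjoint_mult:
  assumes "A \<in> carrier_mat n k" "B \<in> carrier_mat k m"
  shows "mat_adjoint (A * B) = mat_adjoint B * mat_adjoint (A :: complex mat)"
proof (rule eq_matI)
  fix i j assume "i < dim_row (mat_adjoint B * mat_adjoint A)" "j < dim_col (mat_adjoint B * mat_adjoint A)"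
  then have ij: "i < m" "j < n" using assms by auto
  have "mat_adjoint (A * B) $$ (i, j) = cnj ((A * B) $$ (j, i))" using ij assms by simp
  also have "\<dots> = (\<Sum>l<k. cnj (A $$ (j, l)) * cnj (B $$ (l, i)))"
    using index_mult_mat_sum[OF assms ij(2,1)] by simp
  also have "\<dots> = (\<Sum>l<k. mat_adjoint B $$ (i, l) * mat_adjoint A $$ (l, j))"
    using ij assms by (intro sum.cong) (auto simp: mult.commute)
  also have "\<dots> = (mat_adjoint B * mat_adjoint A) $$ (i, j)"
    using index_mult_mat_sum[OF mat_adjoint_carrier[OF assms(2)] mat_adjoint_carrier[OF assms(1)] ij] by simp
  finally show "mat_adjoint (A * B) $$ (i, j) = (mat_adjoint B * mat_adjoint A) $$ (i, j)" .
qed (use assms in auto)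

lemma mat_adjoint_adjoint: "mat_adjoint (mat_adjoint A) = (A :: complex mat)"
  by (rule eq_matI) auto

lemma mat_adjoint_one: "mat_adjoint (1\<^sub>m n) = (1\<^sub>m n :: complex mat)"
  by (rule eq_matI) auto

text \<open>Turns the weak continuity of inner products in \<open>representation\<close> into
  continuity of the entries.\<close>

lemma mult_mat_vec_unit_inner:
  assumes "A \<in> carrier_mat n n" "i < n" "j < n"
  shows "(A *\<^sub>v unit_vec n j) \<bullet>c unit_vec n i = (A $$ (i, j) :: complex)"
proof -
  have c: "conjugate (unit_vec n i) = (unit_vec n i :: complex Matrix.vec)"
    using assms by (intro eq_vecI) (auto simp: unit_vec_def)
  have "A *\<^sub>v unit_vec n j \<in> carrier_vec n" using assms by auto
  then have "(A *\<^sub>v unit_vec n j) \<bullet>c unit_vec n i = (A *\<^sub>v unit_vec n j) $ i"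
    unfolding c using assms by (simp add: scalar_prod_right_unit)
  also have "\<dots> = A $$ (i, j)" using assms by (simp add: scalar_prod_right_unit)
  finally show ?thesis .
qed

section \<open>Unitary equivalence and the classes of the dual\<close>

lemma representationD:
  assumes "representation H \<pi>"
  shows "\<mu> \<in> cmeasures \<Longrightarrow> \<pi> \<mu> \<in> carrier_mat (rdim H \<pi>) (rdim H \<pi>)"
    and "\<mu> \<in> cmeasures \<Longrightarrow> \<nu> \<in> cmeasures \<Longrightarrow> \<pi> (\<lambda>A. \<mu> A + \<nu> A) = \<pi> \<mu> + \<pi> \<nu>"
    and "\<mu> \<in> cmeasures \<Longrightarrow> \<pi> (\<lambda>A. c * \<mu> A) = c \<cdot>\<^sub>m \<pi> \<mu>"
    and "\<mu> \<in> cmeasures \<Longrightarrow> \<nu> \<in> cmeasures \<Longrightarrow> \<pi> (conv H \<mu> \<nu>) = \<pi> \<mu> * \<pi> \<nu>"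
    and "\<mu> \<in> cmeasures \<Longrightarrow> \<pi> (star_measure H \<mu>) = mat_adjoint (\<pi> \<mu>)"
    and "\<pi> (dirac (unit H)) = 1\<^sub>m (rdim H \<pi>)"
    and "u \<in> carrier_vec (rdim H \<pi>) \<Longrightarrow> v \<in> carrier_vec (rdim H \<pi>) \<Longrightarrow>
        continuous_map weak_cone euclidean (\<lambda>\<mu>. (\<pi> \<mu> *\<^sub>v u) \<bullet>c v)"
  using assms unfolding representation_def by blast+

definition unitary_equiv_rel :: "('a::t2_space, 'b) hypergroup_scheme \<Rightarrow> ('a mrep \<times> 'a mrep) set" where
  "unitary_equiv_rel H = {(\<pi>, \<rho>). irreducible_rep H \<pi> \<and> irreducible_rep H \<rho> \<and> equivalent_reps H \<pi> \<rho>}"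

lemma equivalent_reps_sym:
  assumes \<pi>: "representation H \<pi>" and \<rho>: "representation H \<rho>" and eq: "equivalent_reps H \<pi> \<rho>"
  shows "equivalent_reps H \<rho> \<pi>"
proof -
  let ?d = "rdim H \<pi>"
  obtain U where d: "rdim H \<pi> = rdim H \<rho>" and U: "U \<in> carrier_mat ?d ?d"
    "U * mat_adjoint U = 1\<^sub>m ?d" "mat_adjoint U * U = 1\<^sub>m ?d"
    "\<And>\<mu>. \<mu> \<in> cmeasures \<Longrightarrow> \<rho> \<mu> = U * \<pi> \<mu> * mat_adjoint U"
    using eq unfolding equivalent_reps_def by blast
  note U' = mat_adjoint_carrier[OF U(1)]
  have "\<pi> \<mu> = mat_adjoint U * \<rho> \<mu> * mat_adjoint (mat_adjoint U)" if \<mu>: "\<mu> \<in> cmeasures" for \<mu>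
  proof -
    note P = representationD(1)[OF \<pi> \<mu>]
    have "mat_adjoint U * (U * \<pi> \<mu> * mat_adjoint U) * U = (mat_adjoint U * U) * \<pi> \<mu> * (mat_adjoint U * U)"
      using U(1) U' P by (simp add: assoc_mult_mat[of _ ?d ?d _ ?d _ ?d])
    also have "\<dots> = \<pi> \<mu>" using P by (simp add: U(3))
    finally show ?thesis by (simp add: U(4)[OF \<mu>] mat_adjoint_adjoint)
  qed
  then show ?thesis
    unfolding equivalent_reps_def d[symmetric] using U' U(2,3)
    by (intro conjI refl bexI[of _ "mat_adjoint U"]) (simp_all add: mat_adjoint_adjoint)
qed

lemma equivalent_reps_trans:
  assumes \<pi>: "representation H \<pi>" and "equivalent_reps H \<pi> \<rho>" "equivalent_reps H \<rho> \<sigma>"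
  shows "equivalent_reps H \<pi> \<sigma>"
proof -
  let ?d = "rdim H \<pi>"
  obtain U where d: "rdim H \<rho> = ?d" and U: "U \<in> carrier_mat ?d ?d"
    "U * mat_adjoint U = 1\<^sub>m ?d" "mat_adjoint U * U = 1\<^sub>m ?d"
    "\<And>\<mu>. \<mu> \<in> cmeasures \<Longrightarrow> \<rho> \<mu> = U * \<pi> \<mu> * mat_adjoint U"
    using assms(2) unfolding equivalent_reps_def by metis
  obtain V where d': "rdim H \<sigma> = ?d" and V: "V \<in> carrier_mat ?d ?d"
    "V * mat_adjoint V = 1\<^sub>m ?d" "mat_adjoint V * V = 1\<^sub>m ?d"
    "\<And>\<mu>. \<mu> \<in> cmeasures \<Longrightarrow> \<sigma> \<mu> = V * \<rho> \<mu> * mat_adjoint V"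
    using assms(3) unfolding equivalent_reps_def d by metis
  note U' = mat_adjoint_carrier[OF U(1)] and V' = mat_adjoint_carrier[OF V(1)]
  note assoc = assoc_mult_mat[of _ ?d ?d _ ?d _ ?d]
  note adj = mat_adjoint_mult[OF V(1) U(1)]
  have 1: "(V * U) * mat_adjoint (V * U) = 1\<^sub>m ?d"
  proof -
    have "(V * U) * (mat_adjoint U * mat_adjoint V) = V * (U * mat_adjoint U) * mat_adjoint V"
      using U(1) V(1) U' V' by (simp add: assoc)
    then show ?thesis using V(1) by (simp add: adj U(2) V(2))
  qed
  have 2: "mat_adjoint (V * U) * (V * U) = 1\<^sub>m ?d"
  proof -
    have "(mat_adjoint U * mat_adjoint V) * (V * U) = mat_adjoint U * (mat_adjoint V * V) * U"
      using U(1) V(1) U' V' by (simp add: assoc)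
    then show ?thesis unfolding adj V(3) right_mult_one_mat[OF U'] U(3) .
  qed
  have 3: "\<sigma> \<mu> = (V * U) * \<pi> \<mu> * mat_adjoint (V * U)" if \<mu>: "\<mu> \<in> cmeasures" for \<mu>
    using U(1) V(1) U' V' representationD(1)[OF \<pi> \<mu>]
    by (simp add: assoc adj U(4)[OF \<mu>] V(4)[OF \<mu>])
  show ?thesis unfolding equivalent_reps_def d'
    using 1 2 3 U(1) V(1) by (intro conjI refl bexI[of _ "V * U"]) auto
qed

lemma equivalent_reps_refl:
  assumes \<pi>: "representation H \<pi>"
  shows "equivalent_reps H \<pi> \<pi>"
proof -
  have "\<pi> \<mu> = 1\<^sub>m (rdim H \<pi>) * \<pi> \<mu> * mat_adjoint (1\<^sub>m (rdim H \<pi>))" if "\<mu> \<in> cmeasures" for \<mu>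
    using representationD(1)[OF \<pi> that] by (simp add: mat_adjoint_one)
  then show ?thesis
    unfolding equivalent_reps_def by (intro conjI refl bexI[of _ "1\<^sub>m (rdim H \<pi>)"]) (simp_all add: mat_adjoint_one)
qed

lemma equiv_unitary_equiv_rel: "equiv {\<pi>. irreducible_rep H \<pi>} (unitary_equiv_rel H)"
proof (rule equivI)
  have rep: "representation H \<pi>" if "irreducible_rep H \<pi>" for \<pi>
    using that by (simp add: irreducible_rep_def)
  show "refl_on {\<pi>. irreducible_rep H \<pi>} (unitary_equiv_rel H)"
    by (rule refl_onI) (simp add: unitary_equiv_rel_def equivalent_reps_refl[OF rep])
  show "sym (unitary_equiv_rel H)"
    by (rule symI) (auto simp: unitary_equiv_rel_def intro: equivalent_reps_sym[OF rep rep])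
  show "trans (unitary_equiv_rel H)"
    by (rule transI) (auto simp: unitary_equiv_rel_def intro: equivalent_reps_trans[OF rep])
qed (auto simp: unitary_equiv_rel_def)

lemma dual_eq_quotient: "dual H = {\<pi>. irreducible_rep H \<pi>} // unitary_equiv_rel H"
  by (simp add: dual_def unitary_equiv_rel_def)

lemma rep_of_in:
  assumes "c \<in> dual H"
  shows "rep_of c \<in> c"
proof -
  obtain \<pi> where "c = unitary_equiv_rel H `` {\<pi>}" "irreducible_rep H \<pi>"
    using assms unfolding dual_eq_quotient by (auto elim: quotientE)
  then have "\<pi> \<in> c"
    using equiv_class_self[OF equiv_unitary_equiv_rel, of \<pi> H] by simp
  then show ?thesis unfolding rep_of_def by (rule someI[of "\<lambda>\<pi>. \<pi> \<in> c"])
qed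

lemma irreducible_rep_of: "c \<in> dual H \<Longrightarrow> irreducible_rep H (rep_of c)"
  using rep_of_in[of c H] in_quotient_imp_subset[OF equiv_unitary_equiv_rel, of c H]
  by (auto simp: dual_eq_quotient)

lemma dual_eqI:
  assumes "c \<in> dual H" "c' \<in> dual H" "equivalent_reps H (rep_of c) (rep_of c')"
  shows "c = c'"
  using quotient_eq_iff[OF equiv_unitary_equiv_rel assms(1,2)[unfolded dual_eq_quotient]
      rep_of_in[OF assms(1)] rep_of_in[OF assms(2)]]
    assms(3) irreducible_rep_of[OF assms(1)] irreducible_rep_of[OF assms(2)]
  by (simp add: unitary_equiv_rel_def)

section \<open>Matrix entries as functions of the point, and Schur's lemma\<close>

context compact_metric_hypergroup
begin

lemma rep_entry_add:
  assumes \<pi>: "representation H \<pi>" and "\<mu> \<in> cmeasures" "\<nu> \<in> cmeasures" "i < rdim H \<pi>" "j < rdim H \<pi>"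
  shows "\<pi> (\<lambda>A. \<mu> A + \<nu> A) $$ (i, j) = \<pi> \<mu> $$ (i, j) + \<pi> \<nu> $$ (i, j)"
  using representationD(1,2)[OF \<pi>] assms by (metis carrier_matD index_add_mat(1))

lemma rep_entry_scale:
  assumes \<pi>: "representation H \<pi>" and "\<mu> \<in> cmeasures" "i < rdim H \<pi>" "j < rdim H \<pi>"
  shows "\<pi> (\<lambda>A. c * \<mu> A) $$ (i, j) = c * \<pi> \<mu> $$ (i, j)"
  using representationD(1,3)[OF \<pi>] assms by (metis carrier_matD index_smult_mat(1))

text \<open>An entry is an additive, homogeneous and weakly continuous functional on the cone, hence
  determined by its values at point masses.\<close>

lemma
  assumes \<pi>: "representation H \<pi>" and ij: "i < rdim H \<pi>" "j < rdim H \<pi>"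
  shows rep_entry_integral: "\<mu> \<in> pos_cmeasures \<Longrightarrow>
      \<pi> \<mu> $$ (i, j) = (\<integral>t. \<pi> (dirac t) $$ (i, j) \<partial>to_measure \<mu>)"
    and continuous_rep_entry: "continuous_on UNIV (\<lambda>t. \<pi> (dirac t) $$ (i, j))"
proof -
  let ?n = "rdim H \<pi>"
  have eq: "(\<pi> \<mu> *\<^sub>v unit_vec ?n j) \<bullet>c unit_vec ?n i = \<pi> \<mu> $$ (i, j)" if "\<mu> \<in> pos_cmeasures" for \<mu>
    using mult_mat_vec_unit_inner[OF representationD(1)[OF \<pi> pos_cmeasuresD[OF that]] ij] .
  have c: "continuous_map weak_cone euclidean (\<lambda>\<mu>. \<pi> \<mu> $$ (i, j))"
    by (rule continuous_map_eq[OF representationD(7)[OF \<pi>, of "unit_vec ?n j" "unit_vec ?n i"]])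
      (simp_all add: eq)
  note * = weak_cone_functional_eq_integral[OF K c]
  show "\<pi> \<mu> $$ (i, j) = (\<integral>t. \<pi> (dirac t) $$ (i, j) \<partial>to_measure \<mu>)" if "\<mu> \<in> pos_cmeasures"
    by (rule *(1)[OF _ _ that]) (simp_all add: rep_entry_add[OF \<pi> _ _ ij] rep_entry_scale[OF \<pi> _ ij] pos_cmeasuresD)
  show "continuous_on UNIV (\<lambda>t. \<pi> (dirac t) $$ (i, j))"
    by (rule *(2)[OF _ _ zero_pos_cmeasures]) (simp_all add: rep_entry_add[OF \<pi> _ _ ij] rep_entry_scale[OF \<pi> _ ij] pos_cmeasuresD)
qed

lemma rep_entry_translate:
  assumes \<pi>: "representation H \<pi>" and ij: "i < rdim H \<pi>" "j < rdim H \<pi>"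
  shows "translate (\<lambda>t. \<pi> (dirac t) $$ (i, j)) x y =
    (\<Sum>k<rdim H \<pi>. \<pi> (dirac x) $$ (i, k) * \<pi> (dirac y) $$ (k, j))"
  unfolding translate_def rep_entry_integral[OF \<pi> ij conv_dirac_pos, symmetric]
    representationD(4)[OF \<pi> dirac_cmeasures dirac_cmeasures]
  by (rule index_mult_mat_sum[OF representationD(1)[OF \<pi> dirac_cmeasures] representationD(1)[OF \<pi> dirac_cmeasures] ij])

lemma rep_entry_invol:
  assumes \<pi>: "representation H \<pi>" and ij: "i < rdim H \<pi>" "j < rdim H \<pi>"
  shows "\<pi> (dirac (invol H x)) $$ (i, j) = cnj (\<pi> (dirac x) $$ (j, i))"
proof -
  have "star_measure H (dirac x) = dirac (invol H x)"
    unfolding star_measure_def check_dirac by (simp add: dirac_def fun_eq_iff)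
  then have "\<pi> (dirac (invol H x)) = mat_adjoint (\<pi> (dirac x))"
    using representationD(5)[OF \<pi> dirac_cmeasures] by metis
  then show ?thesis using representationD(1)[OF \<pi> dirac_cmeasures, of x] ij by simp
qed

text \<open>If \<open>x\<close> maximizes the norm, then \<open>\<pi>(x)\<^sup>* \<pi>(x)\<close> is the mean of \<open>\<pi>\<close> with respect to the
  probability measure \<open>x\<^sup>- * x\<close>, so its trace is at most the square root of \<open>dim \<pi>\<close> times the maximum.\<close>

lemma rep_hs_bound:
  assumes \<pi>: "representation H \<pi>"
  shows "(\<Sum>i<rdim H \<pi>. \<Sum>j<rdim H \<pi>. (cmod (\<pi> (dirac x) $$ (i, j)))\<^sup>2) \<le> real (rdim H \<pi>)"
proof -
  let ?n = "rdim H \<pi>" and ?e = "\<lambda>x i j. \<pi> (dirac x) $$ (i, j)"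
  define s where "s x = (\<Sum>i<?n. \<Sum>j<?n. (cmod (?e x i j))\<^sup>2)" for x
  have cont: "continuous_on UNIV (\<lambda>t. ?e t i j)" if "i < ?n" "j < ?n" for i j
    by (rule continuous_rep_entry[OF \<pi> that])
  have "continuous_on UNIV s"
    unfolding s_def by (intro continuous_intros cont) auto
  then obtain x0 where x0: "\<And>x. s x \<le> s x0"
    using continuous_attains_sup[OF K] by (metis UNIV_I UNIV_not_empty)
  have s0: "0 \<le> s x" for x unfolding s_def by (intro sum_nonneg) auto
  let ?\<mu> = "to_measure (conv H (dirac (invol H x0)) (dirac x0))"
  \<comment> \<open>Cauchy-Schwarz along the diagonal, then maximality of \<open>x0\<close>.\<close>
  have tr: "cmod (\<Sum>j<?n. ?e t j j) \<le> sqrt (?n * s x0)" for t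
  proof -
    have "(cmod (\<Sum>j<?n. ?e t j j))\<^sup>2 \<le> (\<Sum>j<?n. cmod (?e t j j))\<^sup>2"
      by (intro power_mono norm_sum) auto
    also have "\<dots> \<le> (\<Sum>j<?n. (cmod (?e t j j))\<^sup>2) * ?n"
      using sum_squared_le_sum_of_squares[of "\<lambda>j. cmod (?e t j j)" "{..<?n}"] by simp
    also have "(\<Sum>j<?n. (cmod (?e t j j))\<^sup>2) \<le> s t"
      unfolding s_def by (intro sum_mono member_le_sum) auto
    also have "s t \<le> s x0" by (rule x0)
    finally show ?thesis by (intro real_le_rsqrt) (simp_all add: mult.commute mult_right_mono)
  qed
  have "complex_of_real (s x0) = (\<Sum>i<?n. \<Sum>j<?n. cnj (?e x0 i j) * ?e x0 i j)"
    by (simp add: s_def complex_norm_square mult.commute del: of_real_power)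
  also have "\<dots> = (\<Sum>j<?n. \<Sum>i<?n. cnj (?e x0 i j) * ?e x0 i j)" by (rule sum.swap)
  also have "\<dots> = (\<Sum>j<?n. translate (\<lambda>t. ?e t j j) (invol H x0) x0)"
    by (intro sum.cong refl) (simp add: rep_entry_translate[OF \<pi>] rep_entry_invol[OF \<pi>])
  also have "\<dots> = (\<integral>t. (\<Sum>j<?n. ?e t j j) \<partial>?\<mu>)"
    unfolding translate_def by (intro Bochner_Integration.integral_sum[symmetric])
      (auto intro!: integrable_to_measure[OF K _ conv_dirac_pos] cont)
  finally have "complex_of_real (s x0) = (\<integral>t. (\<Sum>j<?n. ?e t j j) \<partial>?\<mu>)" .
  then have "s x0 = cmod (\<integral>t. (\<Sum>j<?n. ?e t j j) \<partial>?\<mu>)"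
    using s0[of x0] by (metis norm_of_real abs_of_nonneg)
  also have "\<dots> \<le> (\<integral>t. sqrt (?n * s x0) \<partial>?\<mu>)"
    by (intro cmod_integral_le tr finite_measure.integrable_const[OF conv_dirac_finite]
        integrable_to_measure[OF K _ conv_dirac_pos] continuous_on_sum cont) auto
  also have "\<dots> = sqrt (?n * s x0)" by (simp add: conv_dirac_mass)
  finally have "s x0 \<le> sqrt (?n * s x0)" .
  then have "(s x0)\<^sup>2 \<le> (sqrt (?n * s x0))\<^sup>2" using s0 by (intro power_mono) auto
  then have "s x0 * s x0 \<le> ?n * s x0" using s0[of x0] by (simp add: power2_eq_square)
  then have "s x0 \<le> ?n" using s0[of x0] by (cases "s x0 = 0") (auto simp: mult_le_cancel_right)
  then show ?thesis using x0[of x] unfolding s_def by linarith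
qed

text \<open>Invariance of subspaces is tested against all measures, whereas integration over the
  group variable yields intertwining at points. The defect \<open>L\<close> is linear, at a positive
  measure it is the integral of its values at point masses, and positive measures span.\<close>

lemma intertwines_measures:
  assumes \<pi>: "representation H \<pi>" and \<rho>: "representation H \<rho>"
    and T: "T \<in> carrier_mat (rdim H \<pi>) (rdim H \<rho>)"
    and int: "\<And>x. \<pi> (dirac x) * T = T * \<rho> (dirac x)" and \<mu>: "\<mu> \<in> cmeasures"
  shows "\<pi> \<mu> * T = T * \<rho> \<mu>"
proof (rule eq_matI)
  let ?n = "rdim H \<pi>" and ?m = "rdim H \<rho>"
  note P = representationD(1)[OF \<pi>] and R = representationD(1)[OF \<rho>]
  show dims: "dim_row (\<pi> \<mu> * T) = dim_row (T * \<rho> \<mu>)" "dim_col (\<pi> \<mu> * T) = dim_col (T * \<rho> \<mu>)"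
    using P[OF \<mu>] R[OF \<mu>] T by auto
  fix i j assume "i < dim_row (T * \<rho> \<mu>)" "j < dim_col (T * \<rho> \<mu>)"
  then have ij: "i < ?n" "j < ?m" using R[OF \<mu>] T by auto
  define L where "L \<nu> = (\<Sum>k<?n. \<pi> \<nu> $$ (i, k) * T $$ (k, j)) - (\<Sum>k<?m. T $$ (i, k) * \<rho> \<nu> $$ (k, j))" for \<nu>
  have L: "L \<nu> = (\<pi> \<nu> * T) $$ (i, j) - (T * \<rho> \<nu>) $$ (i, j)" if "\<nu> \<in> cmeasures" for \<nu>
    unfolding L_def index_mult_mat_sum[OF P[OF that] T ij] index_mult_mat_sum[OF T R[OF that] ij] ..
  have add: "L (\<lambda>A. \<nu> A + \<nu>' A) = L \<nu> + L \<nu>'" if "\<nu> \<in> cmeasures" "\<nu>' \<in> cmeasures" for \<nu> \<nu>'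
    unfolding L_def using that ij
    by (simp add: rep_entry_add[OF \<pi>] rep_entry_add[OF \<rho>] algebra_simps sum.distrib)
  have scale: "L (\<lambda>A. c * \<nu> A) = c * L \<nu>" if "\<nu> \<in> cmeasures" for \<nu> c
    unfolding L_def using that ij
    by (simp add: rep_entry_scale[OF \<pi>] rep_entry_scale[OF \<rho>] algebra_simps sum_distrib_left)
  have pos: "L \<nu> = 0" if \<nu>: "\<nu> \<in> pos_cmeasures" for \<nu>
  proof -
    note int' = integrable_to_measure[OF K _ \<nu>]
    have "L \<nu> = (\<Sum>k<?n. \<integral>t. \<pi> (dirac t) $$ (i, k) * T $$ (k, j) \<partial>to_measure \<nu>) -
        (\<Sum>k<?m. \<integral>t. T $$ (i, k) * \<rho> (dirac t) $$ (k, j) \<partial>to_measure \<nu>)"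
      unfolding L_def using ij
      by (simp add: rep_entry_integral[OF \<pi> _ _ \<nu>] rep_entry_integral[OF \<rho> _ _ \<nu>])
    also have "(\<Sum>k<?n. \<integral>t. \<pi> (dirac t) $$ (i, k) * T $$ (k, j) \<partial>to_measure \<nu>) =
        (\<integral>t. (\<Sum>k<?n. \<pi> (dirac t) $$ (i, k) * T $$ (k, j)) \<partial>to_measure \<nu>)"
      using ij by (intro Bochner_Integration.integral_sum[symmetric] int' continuous_on_mult continuous_rep_entry[OF \<pi>]) auto
    also have "(\<Sum>k<?m. \<integral>t. T $$ (i, k) * \<rho> (dirac t) $$ (k, j) \<partial>to_measure \<nu>) =
        (\<integral>t. (\<Sum>k<?m. T $$ (i, k) * \<rho> (dirac t) $$ (k, j)) \<partial>to_measure \<nu>)"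
      using ij by (intro Bochner_Integration.integral_sum[symmetric] int' continuous_on_mult continuous_rep_entry[OF \<rho>]) auto
    also have "(\<lambda>t. \<Sum>k<?n. \<pi> (dirac t) $$ (i, k) * T $$ (k, j)) = (\<lambda>t. \<Sum>k<?m. T $$ (i, k) * \<rho> (dirac t) $$ (k, j))"
      unfolding index_mult_mat_sum[OF P[OF dirac_cmeasures] T ij, symmetric]
        index_mult_mat_sum[OF T R[OF dirac_cmeasures] ij, symmetric] int ..
    finally show ?thesis by simp
  qed
  obtain \<alpha> \<beta> \<gamma> where abc: "\<alpha> \<in> pos_cmeasures" "\<beta> \<in> pos_cmeasures" "\<gamma> \<in> pos_cmeasures"
    and eq: "\<mu> = (\<lambda>A. (\<alpha> A + \<i> * \<beta> A) + (- (1 + \<i>)) * \<gamma> A)"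
    using cmeasures_pos_decomposition[OF \<mu>] by blast
  note abc' = abc[THEN pos_cmeasuresD]
  have "L \<mu> = L (\<lambda>A. \<alpha> A + \<i> * \<beta> A) + L (\<lambda>A. (- (1 + \<i>)) * \<gamma> A)"
    unfolding eq by (intro add cmeasures_add cmeasures_scale abc')
  also have "\<dots> = L \<alpha> + L (\<lambda>A. \<i> * \<beta> A) + L (\<lambda>A. (- (1 + \<i>)) * \<gamma> A)"
    by (intro arg_cong2[where f = "(+)"] refl add cmeasures_scale abc')
  also have "\<dots> = 0" unfolding scale[OF abc'(2)] scale[OF abc'(3)] by (simp add: pos abc)
  finally show "(\<pi> \<mu> * T) $$ (i, j) = (T * \<rho> \<mu>) $$ (i, j)" using L[OF \<mu>] by simp
qed

text \<open>Take adjoints of the relation at x^-, where each representation is the adjoint of its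
  value at x.\<close>

lemma intertwines_adjoint:
  assumes \<pi>: "representation H \<pi>" and \<rho>: "representation H \<rho>"
    and T: "T \<in> carrier_mat (rdim H \<pi>) (rdim H \<rho>)"
    and int: "\<And>x. \<pi> (dirac x) * T = T * \<rho> (dirac x)"
  shows "\<rho> (dirac x) * mat_adjoint T = mat_adjoint T * \<pi> (dirac x)"
proof -
  have adj: "\<sigma> (dirac (invol H x)) = mat_adjoint (\<sigma> (dirac x))" if "representation H \<sigma>" for \<sigma>
    by (rule eq_matI)
      (simp_all add: carrier_matD[OF representationD(1)[OF that dirac_cmeasures]] rep_entry_invol[OF that])
  have "mat_adjoint (\<pi> (dirac (invol H x)) * T) = mat_adjoint (T * \<rho> (dirac (invol H x)))" by (simp add: int)
  then show ?thesis
    unfolding mat_adjoint_mult[OF representationD(1)[OF \<pi> dirac_cmeasures] T]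
      mat_adjoint_mult[OF T representationD(1)[OF \<rho> dirac_cmeasures]]
    by (simp add: adj \<pi> \<rho> mat_adjoint_adjoint)
qed

text \<open>An eigenspace of \<open>S\<close> is invariant and nonzero, hence everything.\<close>

lemma schur_scalar:
  assumes irr: "irreducible_rep H \<pi>" and S: "S \<in> carrier_mat (rdim H \<pi>) (rdim H \<pi>)"
    and int: "\<And>\<mu>. \<mu> \<in> cmeasures \<Longrightarrow> \<pi> \<mu> * S = S * \<pi> \<mu>"
  obtains a where "S = a \<cdot>\<^sub>m 1\<^sub>m (rdim H \<pi>)"
proof -
  let ?n = "rdim H \<pi>"
  have \<pi>: "representation H \<pi>" and n: "0 < ?n" using irr by (auto simp: irreducible_rep_def)
  obtain a where "eigenvalue S a" using spectrum_non_empty[OF S n] by (auto simp: spectrum_def)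
  then obtain v where v: "v \<in> carrier_vec ?n" "v \<noteq> 0\<^sub>v ?n" "S *\<^sub>v v = a \<cdot>\<^sub>v v"
    using S by (auto simp: eigenvalue_def eigenvector_def)
  define W where "W = {w \<in> carrier_vec ?n. S *\<^sub>v w = a \<cdot>\<^sub>v w}"
  have "invariant_subspace H \<pi> W"
    unfolding invariant_subspace_def
  proof (intro conjI ballI allI)
    show "0\<^sub>v ?n \<in> W" using S by (auto simp: W_def)
    show "u + w \<in> W" if "u \<in> W" "w \<in> W" for u w
      using that S by (auto simp: W_def mult_add_distrib_mat_vec[OF S] smult_add_distrib_vec)
    show "c \<cdot>\<^sub>v w \<in> W" if "w \<in> W" for c w
      using that S by (auto simp: W_def mult_mat_vec[OF S] smult_smult_assoc mult.commute)
    show "\<pi> \<mu> *\<^sub>v w \<in> W" if \<mu>: "\<mu> \<in> cmeasures" and w: "w \<in> W" for \<mu> w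
    proof -
      note P = representationD(1)[OF \<pi> \<mu>]
      have w': "w \<in> carrier_vec ?n" "S *\<^sub>v w = a \<cdot>\<^sub>v w" using w by (auto simp: W_def)
      have "S *\<^sub>v (\<pi> \<mu> *\<^sub>v w) = (S * \<pi> \<mu>) *\<^sub>v w" using S P w' by (simp add: assoc_mult_mat_vec)
      also have "\<dots> = \<pi> \<mu> *\<^sub>v (S *\<^sub>v w)" using S P w' by (simp add: int[OF \<mu>, symmetric] assoc_mult_mat_vec)
      also have "\<dots> = a \<cdot>\<^sub>v (\<pi> \<mu> *\<^sub>v w)" using P w' by (simp add: mult_mat_vec)
      finally show ?thesis using P w' by (auto simp: W_def)
    qed
  qed (auto simp: W_def)
  then have "W = {0\<^sub>v ?n} \<or> W = carrier_vec ?n" using irr by (auto simp: irreducible_rep_def)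
  moreover have "v \<in> W" using v by (simp add: W_def)
  ultimately have W: "W = carrier_vec ?n" using v by auto
  have "S = a \<cdot>\<^sub>m 1\<^sub>m ?n"
  proof (rule eq_matI)
    fix i j assume ij: "i < dim_row (a \<cdot>\<^sub>m 1\<^sub>m ?n)" "j < dim_col (a \<cdot>\<^sub>m 1\<^sub>m ?n :: complex mat)"
    then have ij': "i < ?n" "j < ?n" by auto
    have "unit_vec ?n j \<in> W" unfolding W by simp
    then have "(S *\<^sub>v unit_vec ?n j) $ i = (a \<cdot>\<^sub>v unit_vec ?n j) $ i" by (simp add: W_def)
    then show "S $$ (i, j) = (a \<cdot>\<^sub>m 1\<^sub>m ?n) $$ (i, j)"
      using ij' S by (simp add: scalar_prod_right_unit)
  qed (use S in auto)
  then show ?thesis by (rule that)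
qed

text \<open>The products of \<open>T\<close> with its adjoint in both orders commute with the
  representations and so are scalars \<open>a\<close> and \<open>b\<close>. These agree, as do the
  dimensions, and a multiple of the adjoint is the unitary matrix that
  \<open>equivalent_reps\<close> asks for.\<close>

lemma schur_intertwiner:
  assumes irr: "irreducible_rep H \<pi>" "irreducible_rep H \<rho>"
    and T: "T \<in> carrier_mat (rdim H \<pi>) (rdim H \<rho>)"
    and int: "\<And>x. \<pi> (dirac x) * T = T * \<rho> (dirac x)"
    and nz: "T \<noteq> 0\<^sub>m (rdim H \<pi>) (rdim H \<rho>)"
  shows "equivalent_reps H \<pi> \<rho>"
proof -
  let ?n = "rdim H \<pi>" and ?m = "rdim H \<rho>" and ?A = "mat_adjoint T"
  have \<pi>: "representation H \<pi>" and \<rho>: "representation H \<rho>" and m: "0 < ?m"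
    using irr by (auto simp: irreducible_rep_def)
  note A = mat_adjoint_carrier[OF T]
  note P = representationD(1)[OF \<pi>] and R = representationD(1)[OF \<rho>]
  have i1: "\<pi> \<mu> * T = T * \<rho> \<mu>" if "\<mu> \<in> cmeasures" for \<mu>
    by (rule intertwines_measures[OF \<pi> \<rho> T int that])
  have i2: "\<rho> \<mu> * ?A = ?A * \<pi> \<mu>" if "\<mu> \<in> cmeasures" for \<mu>
    by (rule intertwines_measures[OF \<rho> \<pi> A intertwines_adjoint[OF \<pi> \<rho> T int] that])
  have AT: "?A * T \<in> carrier_mat ?m ?m" and TA: "T * ?A \<in> carrier_mat ?n ?n" using T A by auto
  have "\<rho> \<mu> * (?A * T) = (?A * T) * \<rho> \<mu>" if \<mu>: "\<mu> \<in> cmeasures" for \<mu>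
  proof -
    have "\<rho> \<mu> * (?A * T) = (\<rho> \<mu> * ?A) * T" using R[OF \<mu>] A T by (simp add: assoc_mult_mat)
    also have "\<dots> = ?A * (\<pi> \<mu> * T)" using P[OF \<mu>] A T by (simp add: i2[OF \<mu>] assoc_mult_mat)
    also have "\<dots> = (?A * T) * \<rho> \<mu>" using R[OF \<mu>] A T by (simp add: i1[OF \<mu>] assoc_mult_mat)
    finally show ?thesis .
  qed
  then obtain a where a: "?A * T = a \<cdot>\<^sub>m 1\<^sub>m ?m" using schur_scalar[OF irr(2) AT] by blast
  have "\<pi> \<mu> * (T * ?A) = (T * ?A) * \<pi> \<mu>" if \<mu>: "\<mu> \<in> cmeasures" for \<mu>
  proof -
    have "\<pi> \<mu> * (T * ?A) = (\<pi> \<mu> * T) * ?A" using P[OF \<mu>] A T by (simp add: assoc_mult_mat)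
    also have "\<dots> = T * (\<rho> \<mu> * ?A)" using R[OF \<mu>] A T by (simp add: i1[OF \<mu>] assoc_mult_mat)
    also have "\<dots> = (T * ?A) * \<pi> \<mu>" using P[OF \<mu>] A T by (simp add: i2[OF \<mu>] assoc_mult_mat)
    finally show ?thesis .
  qed
  then obtain b where b: "T * ?A = b \<cdot>\<^sub>m 1\<^sub>m ?n" using schur_scalar[OF irr(1) TA] by blast
  obtain i0 j0 where ij0: "i0 < ?n" "j0 < ?m" "T $$ (i0, j0) \<noteq> 0"
  proof (rule ccontr)
    assume "\<not> thesis"
    then have "T = 0\<^sub>m ?n ?m" using T that by (intro eq_matI) auto
    then show False using nz by simp
  qed
  have col: "(\<Sum>i<?n. (cmod (T $$ (i, j)))\<^sup>2) = a" if "j < ?m" for j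
  proof -
    have "a = (?A * T) $$ (j, j)" using that by (simp add: a)
    also have "\<dots> = (\<Sum>i<?n. ?A $$ (j, i) * T $$ (i, j))" by (rule index_mult_mat_sum[OF A T that that])
    also have "\<dots> = (\<Sum>i<?n. complex_of_real ((cmod (T $$ (i, j)))\<^sup>2))"
      using T that by (intro sum.cong) (auto simp: complex_norm_square mult.commute simp del: of_real_power)
    finally show ?thesis by simp
  qed
  have row: "(\<Sum>j<?m. (cmod (T $$ (i, j)))\<^sup>2) = b" if "i < ?n" for i
  proof -
    have "b = (T * ?A) $$ (i, i)" using that by (simp add: b)
    also have "\<dots> = (\<Sum>j<?m. T $$ (i, j) * ?A $$ (j, i))" by (rule index_mult_mat_sum[OF T A that that])
    also have "\<dots> = (\<Sum>j<?m. complex_of_real ((cmod (T $$ (i, j)))\<^sup>2))"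
      using T that by (intro sum.cong) (auto simp: complex_norm_square simp del: of_real_power)
    finally show ?thesis by simp
  qed
  define r where "r = (\<Sum>i<?n. (cmod (T $$ (i, j0)))\<^sup>2)"
  have ar: "a = complex_of_real r" using col[OF ij0(2)] by (simp add: r_def)
  have "0 < (cmod (T $$ (i0, j0)))\<^sup>2" using ij0 by simp
  also have "\<dots> \<le> r" unfolding r_def using ij0 by (intro member_le_sum) auto
  finally have r: "r > 0" .
  \<comment> \<open>Associativity of the product of \<open>T\<close>, its adjoint and
    \<open>T\<close>, read at a nonzero entry.\<close>
  have "b = a"
  proof -
    have "(T * ?A) * T = T * (?A * T)" using T A by (simp add: assoc_mult_mat)
    moreover have "(b \<cdot>\<^sub>m 1\<^sub>m ?n) * T = b \<cdot>\<^sub>m T" "T * (a \<cdot>\<^sub>m 1\<^sub>m ?m) = a \<cdot>\<^sub>m T"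
      using T mult_smult_assoc_mat[OF one_carrier_mat T] mult_smult_distrib[OF T one_carrier_mat] by simp_all
    ultimately have "b \<cdot>\<^sub>m T = a \<cdot>\<^sub>m T" unfolding a b by simp
    then have "(b \<cdot>\<^sub>m T) $$ (i0, j0) = (a \<cdot>\<^sub>m T) $$ (i0, j0)" by simp
    then show ?thesis using ij0 T by simp
  qed
  \<comment> \<open>The squared entries of \<open>T\<close> are added up by columns and by
    rows.\<close>
  have nm: "?n = ?m"
  proof -
    have "complex_of_real (?m * r) = (\<Sum>j<?m. a)" by (simp add: ar)
    also have "\<dots> = (\<Sum>j<?m. \<Sum>i<?n. complex_of_real ((cmod (T $$ (i, j)))\<^sup>2))"
      by (intro sum.cong refl) (simp add: col[symmetric])
    also have "\<dots> = (\<Sum>i<?n. \<Sum>j<?m. complex_of_real ((cmod (T $$ (i, j)))\<^sup>2))" by (rule sum.swap)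
    also have "\<dots> = (\<Sum>i<?n. b)"
      by (intro sum.cong refl) (simp add: row[symmetric])
    also have "\<dots> = complex_of_real (?n * r)" by (simp add: \<open>b = a\<close> ar)
    finally have "real ?m * r = real ?n * r" by (simp only: of_real_eq_iff)
    then show ?thesis using r by simp
  qed
  \<comment> \<open>Both products are the positive number \<open>r\<close> times the identity;
    scaling by \<open>1 / sqrt r\<close> normalizes them.\<close>
  define q where "q = complex_of_real (1 / sqrt r)"
  have q: "cnj q = q" "q * q * a = 1" using r by (auto simp: q_def ar of_real_mult[symmetric] simp del: of_real_mult)
  then have q': "q * (q * a) = 1" by (simp add: mult.assoc)
  define U where "U = q \<cdot>\<^sub>m ?A"
  have U: "U \<in> carrier_mat ?n ?n" using A nm by (simp add: U_def)
  have adjU: "mat_adjoint U = q \<cdot>\<^sub>m T" using T by (intro eq_matI) (auto simp: U_def q(1))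
  have U1: "U * mat_adjoint U = 1\<^sub>m ?n"
  proof -
    have "U * mat_adjoint U = q \<cdot>\<^sub>m (q \<cdot>\<^sub>m (?A * T))"
      unfolding adjU unfolding U_def using A T by (simp add: mult_smult_assoc_mat[of _ ?m ?n] mult_smult_distrib[of _ ?m ?n])
    also have "\<dots> = 1\<^sub>m ?n" unfolding a nm using q' by (intro eq_matI) auto
    finally show ?thesis .
  qed
  have U2: "mat_adjoint U * U = 1\<^sub>m ?n"
  proof -
    have "mat_adjoint U * U = q \<cdot>\<^sub>m (q \<cdot>\<^sub>m (T * ?A))"
      unfolding adjU unfolding U_def using A T by (simp add: mult_smult_assoc_mat[of _ ?n ?m] mult_smult_distrib[of _ ?n ?m])
    also have "\<dots> = 1\<^sub>m ?n" unfolding b \<open>b = a\<close> using q' by (intro eq_matI) auto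
    finally show ?thesis .
  qed
  have "\<rho> \<mu> = U * \<pi> \<mu> * mat_adjoint U" if \<mu>: "\<mu> \<in> cmeasures" for \<mu>
  proof -
    have "U * \<pi> \<mu> * mat_adjoint U = q \<cdot>\<^sub>m (q \<cdot>\<^sub>m (?A * \<pi> \<mu> * T))"
      unfolding adjU unfolding U_def using A T P[OF \<mu>]
      by (simp add: mult_smult_assoc_mat[of _ ?m ?n _ ?n] mult_smult_assoc_mat[of _ ?m ?n _ ?m] mult_smult_distrib[of _ ?m ?n _ ?m])
    also have "?A * \<pi> \<mu> * T = (?A * T) * \<rho> \<mu>"
      using A T P[OF \<mu>] R[OF \<mu>] by (simp add: assoc_mult_mat i1[OF \<mu>])
    also have "q \<cdot>\<^sub>m (q \<cdot>\<^sub>m ((?A * T) * \<rho> \<mu>)) = \<rho> \<mu>"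
    proof -
      have "(?A * T) * \<rho> \<mu> = a \<cdot>\<^sub>m \<rho> \<mu>" unfolding a using R[OF \<mu>] by (simp add: mult_smult_assoc_mat[of _ ?m ?m])
      then show ?thesis using q(2) by (intro eq_matI) (auto simp: mult.assoc[symmetric])
    qed
    finally show ?thesis ..
  qed
  then show ?thesis unfolding equivalent_reps_def using nm U U1 U2 by blast
qed

end

section \<open>Orthogonality of matrix coefficients and the hyperdimension\<close>

context haar_hypergroup
begin

definition coeff_inner :: "'a mrep \<Rightarrow> 'a mrep \<Rightarrow> nat \<Rightarrow> nat \<Rightarrow> nat \<Rightarrow> nat \<Rightarrow> complex" where
  "coeff_inner \<pi> \<rho> i j m l = (\<integral>x. \<pi> (dirac x) $$ (i, j) * cnj (\<rho> (dirac x) $$ (m, l)) \<partial>lam)"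

text \<open>The Haar integral of \<pi>(x) E \<rho>(x)^* where E is the matrix unit at position (j,
  l).\<close>

definition coeff_matrix :: "'a mrep \<Rightarrow> 'a mrep \<Rightarrow> nat \<Rightarrow> nat \<Rightarrow> complex mat" where
  "coeff_matrix \<pi> \<rho> j l = Matrix.mat (rdim H \<pi>) (rdim H \<rho>) (\<lambda>(i, m). coeff_inner \<pi> \<rho> i j m l)"

text \<open>Left multiplication by \<pi>(x) translates the entry of \<pi> by x. The adjoint identity
  turns this into a translation of the conjugate entry of \<rho> by x^-, which amounts to right
  multiplication by \<rho>(x).\<close>

lemma coeff_matrix_intertwines:
  assumes \<pi>: "representation H \<pi>" and \<rho>: "representation H \<rho>"
    and jl: "j < rdim H \<pi>" "l < rdim H \<rho>"
  shows "\<pi> (dirac x) * coeff_matrix \<pi> \<rho> j l = coeff_matrix \<pi> \<rho> j l * \<rho> (dirac x)"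
proof (rule eq_matI)
  let ?n = "rdim H \<pi>" and ?m = "rdim H \<rho>" and ?T = "coeff_matrix \<pi> \<rho> j l"
  let ?e = "\<lambda>i j x. \<pi> (dirac x) $$ (i, j)" and ?f = "\<lambda>i j x. \<rho> (dirac x) $$ (i, j)"
  note P = representationD(1)[OF \<pi> dirac_cmeasures, of x] and R = representationD(1)[OF \<rho> dirac_cmeasures, of x]
  have T: "?T \<in> carrier_mat ?n ?m" by (simp add: coeff_matrix_def)
  show "dim_row (\<pi> (dirac x) * ?T) = dim_row (?T * \<rho> (dirac x))" "dim_col (\<pi> (dirac x) * ?T) = dim_col (?T * \<rho> (dirac x))"
    using P R T by auto
  fix i m assume "i < dim_row (?T * \<rho> (dirac x))" "m < dim_col (?T * \<rho> (dirac x))"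
  then have im: "i < ?n" "m < ?m" using R T by auto
  have ce: "continuous_on UNIV (?e i j)" if "i < ?n" "j < ?n" for i j by (rule continuous_rep_entry[OF \<pi> that])
  have cf: "continuous_on UNIV (\<lambda>y. cnj (?f i j y))" if "i < ?m" "j < ?m" for i j
    by (intro continuous_on_cnj continuous_rep_entry[OF \<rho> that])
  \<comment> \<open>Conjugation and involution combine to a transposition: the conjugate of
    \<rho>(x^-) at (m, k) is \<rho>(x) at (k, m).\<close>
  have tr: "translate (\<lambda>y. cnj (?f m l y)) (invol H x) z = (\<Sum>k<?m. ?f k m x * cnj (?f k l z))" for z
  proof -
    have "translate (\<lambda>y. cnj (?f m l y)) (invol H x) z = cnj (translate (?f m l) (invol H x) z)"
      unfolding translate_def by simp
    also have "\<dots> = (\<Sum>k<?m. ?f k m x * cnj (?f k l z))"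
      using im jl by (simp add: rep_entry_translate[OF \<rho>] rep_entry_invol[OF \<rho>])
    finally show ?thesis .
  qed
  have "(\<pi> (dirac x) * ?T) $$ (i, m) = (\<Sum>k<?n. ?e i k x * coeff_inner \<pi> \<rho> k j m l)"
    unfolding index_mult_mat_sum[OF P T im] using im by (intro sum.cong) (auto simp: coeff_matrix_def)
  also have "\<dots> = (\<Sum>k<?n. \<integral>y. ?e i k x * (?e k j y * cnj (?f m l y)) \<partial>lam)"
    by (simp add: coeff_inner_def)
  also have "\<dots> = (\<integral>y. (\<Sum>k<?n. ?e i k x * (?e k j y * cnj (?f m l y))) \<partial>lam)"
    using im jl by (intro Bochner_Integration.integral_sum[symmetric] integrable_lam continuous_on_mult continuous_on_const ce cf) auto
  also have "\<dots> = (\<integral>y. translate (?e i j) x y * cnj (?f m l y) \<partial>lam)"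
    using im jl by (simp add: rep_entry_translate[OF \<pi>] sum_distrib_right mult.assoc)
  also have "\<dots> = (\<integral>z. ?e i j z * translate (\<lambda>y. cnj (?f m l y)) (invol H x) z \<partial>lam)"
    using im jl by (intro haar_adjoint ce cf) auto
  also have "\<dots> = (\<integral>z. (\<Sum>k<?m. (?e i j z * cnj (?f k l z)) * ?f k m x) \<partial>lam)"
    unfolding tr by (simp add: sum_distrib_left mult_ac)
  also have "\<dots> = (\<Sum>k<?m. \<integral>z. (?e i j z * cnj (?f k l z)) * ?f k m x \<partial>lam)"
    using im jl by (intro Bochner_Integration.integral_sum integrable_lam continuous_on_mult continuous_on_const ce cf) auto
  also have "\<dots> = (\<Sum>k<?m. coeff_inner \<pi> \<rho> i j k l * ?f k m x)"
    by (simp add: coeff_inner_def)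
  also have "\<dots> = (?T * \<rho> (dirac x)) $$ (i, m)"
    unfolding index_mult_mat_sum[OF T R im] using im by (intro sum.cong) (auto simp: coeff_matrix_def)
  finally show "(\<pi> (dirac x) * ?T) $$ (i, m) = (?T * \<rho> (dirac x)) $$ (i, m)" .
qed

lemma coeff_inner_inequivalent:
  assumes irr: "irreducible_rep H \<pi>" "irreducible_rep H \<rho>" and "\<not> equivalent_reps H \<pi> \<rho>"
    and "i < rdim H \<pi>" "j < rdim H \<pi>" "m < rdim H \<rho>" "l < rdim H \<rho>"
  shows "coeff_inner \<pi> \<rho> i j m l = 0"
proof -
  have \<pi>: "representation H \<pi>" and \<rho>: "representation H \<rho>"
    using irr by (auto simp: irreducible_rep_def)
  have T: "coeff_matrix \<pi> \<rho> j l \<in> carrier_mat (rdim H \<pi>) (rdim H \<rho>)" by (simp add: coeff_matrix_def)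
  have "coeff_matrix \<pi> \<rho> j l = 0\<^sub>m (rdim H \<pi>) (rdim H \<rho>)"
    using schur_intertwiner[OF irr T coeff_matrix_intertwines[OF \<pi> \<rho>]] assms by blast
  then have "coeff_matrix \<pi> \<rho> j l $$ (i, m) = 0" using assms by simp
  then show ?thesis using assms by (simp add: coeff_matrix_def)
qed

text \<open>By Schur's lemma only i = m survives, with a scalar \<open>b j l\<close>. Replacing x by
  x^- exchanges the roles of row and column indices, so j = l is forced as well and the scalar is
  the same for all entries; its inverse is the hyperdimension.\<close>

lemma coeff_inner_self:
  assumes irr: "irreducible_rep H \<pi>"
  obtains k where "real (rdim H \<pi>) \<le> k" "0 < k"
    "\<And>i j m l. i < rdim H \<pi> \<Longrightarrow> j < rdim H \<pi> \<Longrightarrow> m < rdim H \<pi> \<Longrightarrow> l < rdim H \<pi> \<Longrightarrow>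
      coeff_inner \<pi> \<pi> i j m l = (if i = m \<and> j = l then complex_of_real (1 / k) else 0)"
proof -
  let ?n = "rdim H \<pi>" and ?e = "\<lambda>i j x. \<pi> (dirac x) $$ (i, j)"
  have \<pi>: "representation H \<pi>" and n: "0 < ?n"
    using irr by (auto simp: irreducible_rep_def)
  have ce: "continuous_on UNIV (?e i j)" if "i < ?n" "j < ?n" for i j by (rule continuous_rep_entry[OF \<pi> that])
  have T: "coeff_matrix \<pi> \<pi> j l \<in> carrier_mat ?n ?n" for j l by (simp add: coeff_matrix_def)
  have "\<exists>b. \<forall>i<?n. \<forall>m<?n. coeff_inner \<pi> \<pi> i j m l = (if i = m then b else 0)" if jl: "j < ?n" "l < ?n" for j l
  proof -
    obtain b where b: "coeff_matrix \<pi> \<pi> j l = b \<cdot>\<^sub>m 1\<^sub>m ?n"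
      using schur_scalar[OF irr T intertwines_measures[OF \<pi> \<pi> T coeff_matrix_intertwines[OF \<pi> \<pi> jl]]] by blast
    have "coeff_inner \<pi> \<pi> i j m l = (if i = m then b else 0)" if "i < ?n" "m < ?n" for i m
    proof -
      have "coeff_inner \<pi> \<pi> i j m l = coeff_matrix \<pi> \<pi> j l $$ (i, m)" using that by (simp add: coeff_matrix_def)
      then show ?thesis using that by (simp add: b)
    qed
    then show ?thesis by blast
  qed
  then obtain b where b: "\<And>i j m l. i < ?n \<Longrightarrow> j < ?n \<Longrightarrow> m < ?n \<Longrightarrow> l < ?n \<Longrightarrow>
      coeff_inner \<pi> \<pi> i j m l = (if i = m then b j l else 0)" by metis
  have flip: "coeff_inner \<pi> \<pi> i j m l = coeff_inner \<pi> \<pi> l m j i"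
    if ijml: "i < ?n" "j < ?n" "m < ?n" "l < ?n" for i j m l
  proof -
    have "coeff_inner \<pi> \<pi> i j m l = (\<integral>x. ?e i j (invol H x) * cnj (?e m l (invol H x)) \<partial>lam)"
      unfolding coeff_inner_def using ijml
      by (intro haar_invol[symmetric] continuous_on_mult continuous_on_cnj ce)
    also have "\<dots> = coeff_inner \<pi> \<pi> l m j i"
      unfolding coeff_inner_def using ijml by (simp add: rep_entry_invol[OF \<pi>] mult.commute)
    finally show ?thesis .
  qed
  have eq: "coeff_inner \<pi> \<pi> i j m l = (if i = m \<and> j = l then b 0 0 else 0)"
    if ijml: "i < ?n" "j < ?n" "m < ?n" "l < ?n" for i j m l
  proof (cases "i = m \<and> j = l")
    case True
    \<comment> \<open>\<open>b j j\<close> is evaluated with row index 0, flipped, and so identified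
      with \<open>b 0 0\<close>.\<close>
    then show ?thesis using b[OF ijml] b[OF n ijml(2) n ijml(2)] flip[OF n ijml(2) n ijml(2)] b[OF ijml(2) n ijml(2) n] by simp
  next
    case False
    then show ?thesis using b[OF ijml] flip[OF ijml] b[OF ijml(4,3,2,1)] by auto
  qed
  define \<beta> where "\<beta> = (\<integral>x. (cmod (?e 0 0 x))\<^sup>2 \<partial>lam)"
  have beta: "(\<integral>x. (cmod (?e i j x))\<^sup>2 \<partial>lam) = Re (coeff_inner \<pi> \<pi> i j i j)"
    "complex_of_real (\<integral>x. (cmod (?e i j x))\<^sup>2 \<partial>lam) = coeff_inner \<pi> \<pi> i j i j" for i j
  proof -
    have "coeff_inner \<pi> \<pi> i j i j = (\<integral>x. complex_of_real ((cmod (?e i j x))\<^sup>2) \<partial>lam)"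
      unfolding coeff_inner_def complex_norm_square ..
    also have "\<dots> = complex_of_real (\<integral>x. (cmod (?e i j x))\<^sup>2 \<partial>lam)" by (rule integral_complex_of_real)
    finally show "complex_of_real (\<integral>x. (cmod (?e i j x))\<^sup>2 \<partial>lam) = coeff_inner \<pi> \<pi> i j i j"
      "(\<integral>x. (cmod (?e i j x))\<^sup>2 \<partial>lam) = Re (coeff_inner \<pi> \<pi> i j i j)" by simp_all
  qed
  have b\<beta>: "b 0 0 = complex_of_real \<beta>" unfolding \<beta>_def beta(2) using eq[OF n n n n] by simp
  \<comment> \<open>The (0, 0) entry equals 1 at the unit, and the Haar integral detects
    this.\<close>
  have \<beta>: "\<beta> > 0"
    unfolding \<beta>_def
  proof (rule haar_integral_pos)
    show "continuous_on UNIV (\<lambda>x. (cmod (?e 0 0 x))\<^sup>2)" using n by (intro continuous_intros ce)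
    show "0 < (cmod (?e 0 0 (unit H)))\<^sup>2" using n by (simp add: representationD(6)[OF \<pi>])
  qed simp
  \<comment> \<open>Each of the d^2 entries has squared norm \<beta>, while the squares add up to at
    most d at every point; hence d \<beta> \<le> 1.\<close>
  have "real ?n * real ?n * \<beta> = (\<Sum>i<?n. \<Sum>j<?n. \<integral>x. (cmod (?e i j x))\<^sup>2 \<partial>lam)"
    by (simp add: beta(1) eq b\<beta>)
  also have "\<dots> = (\<integral>x. (\<Sum>i<?n. \<Sum>j<?n. (cmod (?e i j x))\<^sup>2) \<partial>lam)"
  proof -
    have int: "integrable lam (\<lambda>x. (cmod (?e i j x))\<^sup>2)" if "i < ?n" "j < ?n" for i j
      using that by (intro integrable_continuous_compact_real[OF K _ finite_lam sets_lam] continuous_intros ce)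
    then have int2: "integrable lam (\<lambda>x. \<Sum>j<?n. (cmod (?e i j x))\<^sup>2)" if "i < ?n" for i
      using that by (intro Bochner_Integration.integrable_sum) auto
    have "(\<integral>x. (\<Sum>i<?n. \<Sum>j<?n. (cmod (?e i j x))\<^sup>2) \<partial>lam) = (\<Sum>i<?n. \<integral>x. (\<Sum>j<?n. (cmod (?e i j x))\<^sup>2) \<partial>lam)"
      using int2 by (intro Bochner_Integration.integral_sum) auto
    also have "\<dots> = (\<Sum>i<?n. \<Sum>j<?n. \<integral>x. (cmod (?e i j x))\<^sup>2 \<partial>lam)"
      using int by (intro sum.cong refl Bochner_Integration.integral_sum) auto
    finally show ?thesis ..
  qed
  also have "\<dots> \<le> (\<integral>x. real ?n \<partial>lam)"
    by (intro integral_mono rep_hs_bound[OF \<pi>] finite_measure.integrable_const[OF finite_lam]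
        integrable_continuous_compact_real[OF K _ finite_lam sets_lam] continuous_intros ce) auto
  also have "\<dots> = real ?n" by (simp add: measure_lam)
  finally have "real ?n * (real ?n * \<beta>) \<le> real ?n * 1" by (simp add: mult.assoc)
  then have "real ?n * \<beta> \<le> 1" using n by (subst (asm) mult_le_cancel_left_pos) auto
  then have "real ?n \<le> 1 / \<beta>" using \<beta> by (simp add: field_simps)
  then show ?thesis
    using \<beta> by (intro that[of "1 / \<beta>"]) (simp_all add: eq b\<beta>)
qed

text \<open>Justifies the definite description in \<open>hyperdim\<close>: a value exists by
  \<open>coeff_inner_self\<close>, and the (0, 0) entry determines it because the dimension is
  positive.\<close>

lemma mcoeff_orthogonality:
  assumes c: "c \<in> dual H"
  shows "0 < hyperdim H lam c" "real (class_dim H c) \<le> hyperdim H lam c"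
    and "\<And>c' i j m l. c' \<in> dual H \<Longrightarrow> i < class_dim H c \<Longrightarrow> j < class_dim H c \<Longrightarrow>
      m < class_dim H c' \<Longrightarrow> l < class_dim H c' \<Longrightarrow>
      (\<integral>x. mcoeff c i j x * cnj (mcoeff c' m l x) \<partial>lam) =
        (if i = m \<and> j = l \<and> c = c' then complex_of_real (1 / hyperdim H lam c) else 0)"
proof -
  let ?Q = "\<lambda>k. 0 < k \<and>
     (\<forall>c'\<in>dual H. \<forall>i<class_dim H c. \<forall>j<class_dim H c. \<forall>m<class_dim H c'. \<forall>l<class_dim H c'.
        (\<integral>x. mcoeff c i j x * cnj (mcoeff c' m l x) \<partial>lam) =
          (if i = m \<and> j = l \<and> c = c' then complex_of_real (1 / k) else 0))"
  note irr = irreducible_rep_of[OF c]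
  have n: "0 < class_dim H c" using irr by (simp add: class_dim_def irreducible_rep_def)
  obtain k where k: "real (class_dim H c) \<le> k" "0 < k"
    "\<And>i j m l. i < class_dim H c \<Longrightarrow> j < class_dim H c \<Longrightarrow> m < class_dim H c \<Longrightarrow> l < class_dim H c \<Longrightarrow>
      coeff_inner (rep_of c) (rep_of c) i j m l = (if i = m \<and> j = l then complex_of_real (1 / k) else 0)"
    using coeff_inner_self[OF irr] unfolding class_dim_def by blast
  have Q: "?Q k"
  proof (intro conjI ballI allI impI)
    fix c' i j m l assume c': "c' \<in> dual H"
      and ij: "i < class_dim H c" "j < class_dim H c" "m < class_dim H c'" "l < class_dim H c'"
    have I: "(\<integral>x. mcoeff c i j x * cnj (mcoeff c' m l x) \<partial>lam) = coeff_inner (rep_of c) (rep_of c') i j m l"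
      by (simp add: coeff_inner_def mcoeff_def)
    show "(\<integral>x. mcoeff c i j x * cnj (mcoeff c' m l x) \<partial>lam) =
          (if i = m \<and> j = l \<and> c = c' then complex_of_real (1 / k) else 0)"
    proof (cases "c = c'")
      case True
      then show ?thesis unfolding I using k(3) ij by simp
    next
      case False
      then have "\<not> equivalent_reps H (rep_of c) (rep_of c')" using dual_eqI[OF c c'] by blast
      then show ?thesis unfolding I using False ij
        by (simp add: coeff_inner_inequivalent[OF irr irreducible_rep_of[OF c']] class_dim_def)
    qed
  qed (rule k)
  moreover have "k' = k" if "?Q k'" for k'
  proof -
    have "(\<integral>x. mcoeff c 0 0 x * cnj (mcoeff c 0 0 x) \<partial>lam) = complex_of_real (1 / k')"
      using that c n by simp
    moreover have "(\<integral>x. mcoeff c 0 0 x * cnj (mcoeff c 0 0 x) \<partial>lam) = complex_of_real (1 / k)"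
      using Q c n by simp
    ultimately have "1 / k' = 1 / k" by (metis of_real_eq_iff)
    then show ?thesis using that k(2) by (simp add: field_simps)
  qed
  ultimately have "hyperdim H lam c = k" unfolding hyperdim_def by (rule the_equality)
  then show "0 < hyperdim H lam c" "real (class_dim H c) \<le> hyperdim H lam c"
    "\<And>c' i j m l. c' \<in> dual H \<Longrightarrow> i < class_dim H c \<Longrightarrow> j < class_dim H c \<Longrightarrow>
      m < class_dim H c' \<Longrightarrow> l < class_dim H c' \<Longrightarrow>
      (\<integral>x. mcoeff c i j x * cnj (mcoeff c' m l x) \<partial>lam) =
        (if i = m \<and> j = l \<and> c = c' then complex_of_real (1 / hyperdim H lam c) else 0)"
    using k Q by auto
qed

sublocale orthogonal_matrix_system lam "dual H" "class_dim H" "hyperdim H lam" mcoeff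
proof (rule orthogonal_matrix_system.intro)
  fix c assume c: "c \<in> dual H"
  have \<pi>: "representation H (rep_of c)" using irreducible_rep_of[OF c] by (simp add: irreducible_rep_def)
  show "0 < hyperdim H lam c" by (rule mcoeff_orthogonality(1)[OF c])
  show "mcoeff c i j \<in> borel_measurable lam" if "i < class_dim H c" "j < class_dim H c" for i j
    unfolding mcoeff_def[abs_def] using that
    by (intro measurable_continuous_borel[OF sets_lam] continuous_rep_entry[OF \<pi>]) (auto simp: class_dim_def)
  \<comment> \<open>The Hilbert-Schmidt bound gives the dimension, which the hyperdimension
    dominates.\<close>
  show "(\<Sum>i<class_dim H c. \<Sum>j<class_dim H c. (cmod (mcoeff c i j x))\<^sup>2) \<le> hyperdim H lam c" for x
    using rep_hs_bound[OF \<pi>, of x] mcoeff_orthogonality(2)[OF c] by (simp add: class_dim_def mcoeff_def)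
qed (rule finite_lam mcoeff_orthogonality(3); assumption)+

lemma hs_norm_fourier: "hs_norm (fourier H lam f c) = coeff_norm f c"
  by (simp add: hs_norm_def fourier_def coeff_norm_def coeff_def)

end

text \<open>Passes from the supremum of infinite sums in \<open>ennreal\<close> to the real
  estimates over finite sets that \<open>paley_inequality\<close> takes as input; finiteness keeps
  \<open>enn2real\<close> from sending the supremum to 0.\<close>

lemma weight_sum_le_M_weight:
  assumes "0 < y" "finite F" "F \<subseteq> {c \<in> dual H. y \<le> \<phi> c}" "M_weight H lam \<phi> < \<infinity>"
  shows "y * (\<Sum>c\<in>F. (hyperdim H lam c)\<^sup>2) \<le> enn2real (M_weight H lam \<phi>)"
proof -
  let ?g = "\<lambda>c. ennreal ((hyperdim H lam c)\<^sup>2)"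
  have "ennreal (y * (\<Sum>c\<in>F. (hyperdim H lam c)\<^sup>2)) = ennreal y * (\<Sum>\<^sub>\<infinity>c\<in>F. ?g c)"
    using assms by (simp add: ennreal_mult sum_nonneg)
  also have "\<dots> \<le> ennreal y * (\<Sum>\<^sub>\<infinity>c\<in>{c \<in> dual H. y \<le> \<phi> c}. ?g c)"
    using assms by (intro mult_left_mono infsum_mono_neutral nonneg_summable_on_complete) auto
  also have "\<dots> \<le> M_weight H lam \<phi>"
    unfolding M_weight_def using assms(1) by (intro SUP_upper) auto
  finally have "ennreal (y * (\<Sum>c\<in>F. (hyperdim H lam c)\<^sup>2)) \<le> M_weight H lam \<phi>" .
  then have "enn2real (ennreal (y * (\<Sum>c\<in>F. (hyperdim H lam c)\<^sup>2))) \<le> enn2real (M_weight H lam \<phi>)"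
    using assms(4) by (intro enn2real_mono) auto
  then show ?thesis using assms by (simp add: sum_nonneg)
qed

text \<open>Summability is asserted along with the bound, since \<open>infsum\<close> is 0 on a
  family that is not summable and the bound would then say nothing.\<close>

theorem theorem1p4:
  fixes H :: "'a::metric_space hypergroup" and lam :: "'a measure" and p :: real
  assumes "compact_hypergroup H"
    and "is_haar_measure H lam"
    and "1 < p" and "p \<le> 2"
  shows "\<exists>C>0. \<forall>(\<phi> :: 'a mrep set \<Rightarrow> real) (f :: 'a \<Rightarrow> complex).
    (\<forall>c\<in>dual H. 0 < \<phi> c) \<longrightarrow> M_weight H lam \<phi> < \<infinity> \<longrightarrow> in_Lp lam p f \<longrightarrow>
      (\<lambda>c. (hyperdim H lam c)\<^sup>2 * (hs_norm (fourier H lam f c) / sqrt (hyperdim H lam c)) powr p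
            * \<phi> c powr (2 - p)) summable_on dual H \<and>
      (\<Sum>\<^sub>\<infinity>c\<in>dual H.
          (hyperdim H lam c)\<^sup>2 * (hs_norm (fourier H lam f c) / sqrt (hyperdim H lam c)) powr p
            * \<phi> c powr (2 - p)) powr (1 / p)
        \<le> C * enn2real (M_weight H lam \<phi>) powr ((2 - p) / p) * Lp_norm lam p f"
proof -
  interpret haar_hypergroup H lam
    using assms(1,2) by (simp add: haar_hypergroup_def haar_hypergroup_axioms_def compact_metric_hypergroup_def)
  from paley_inequality[OF assms(3,4)] obtain C where C: "C > 0"
    and paley: "\<And>\<phi> M f. \<forall>c\<in>dual H. 0 < \<phi> c \<Longrightarrow> 0 < M \<Longrightarrow>
    \<forall>y F. 0 < y \<longrightarrow> finite F \<longrightarrow> F \<subseteq> {c\<in>dual H. y \<le> \<phi> c} \<longrightarrow> y * (\<Sum>c\<in>F. (hyperdim H lam c)\<^sup>2) \<le> M \<Longrightarrow> in_Lp lam p f \<Longrightarrow>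
      (\<lambda>c. (hyperdim H lam c)\<^sup>2 * (coeff_norm f c / sqrt (hyperdim H lam c)) powr p * \<phi> c powr (2 - p)) summable_on dual H \<and>
      (\<Sum>\<^sub>\<infinity>c\<in>dual H. (hyperdim H lam c)\<^sup>2 * (coeff_norm f c / sqrt (hyperdim H lam c)) powr p * \<phi> c powr (2 - p)) powr (1 / p)
        \<le> C * M powr ((2 - p) / p) * Lp_norm lam p f"
    by blast
  show ?thesis
  proof (intro exI[of _ C] conjI[OF C] allI impI)
    fix \<phi> :: "'a mrep set \<Rightarrow> real" and f :: "'a \<Rightarrow> complex"
    assume \<phi>: "\<forall>c\<in>dual H. 0 < \<phi> c" and M: "M_weight H lam \<phi> < \<infinity>" and f: "in_Lp lam p f"
    note W = weight_sum_le_M_weight[OF _ _ _ M]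
    show "(\<lambda>c. (hyperdim H lam c)\<^sup>2 * (hs_norm (fourier H lam f c) / sqrt (hyperdim H lam c)) powr p
            * \<phi> c powr (2 - p)) summable_on dual H \<and>
      (\<Sum>\<^sub>\<infinity>c\<in>dual H.
          (hyperdim H lam c)\<^sup>2 * (hs_norm (fourier H lam f c) / sqrt (hyperdim H lam c)) powr p
            * \<phi> c powr (2 - p)) powr (1 / p)
        \<le> C * enn2real (M_weight H lam \<phi>) powr ((2 - p) / p) * Lp_norm lam p f"
    \<comment> \<open>\<open>paley_inequality\<close> wants a positive bound. Without classes the
      sum is 0; otherwise the level y = \<open>\<phi> c\<close> of any class \<open>c\<close> shows
      that the supremum is positive.\<close>
    proof (cases "dual H = {}")
      case True
      have "0 \<le> Lp_norm lam p f" by (simp add: Lp_norm_def)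
      then show ?thesis using True C by simp
    next
      case False
      then obtain c where c: "c \<in> dual H" by blast
      have "0 < \<phi> c * (hyperdim H lam c)\<^sup>2" using \<phi> c k_pos[OF c] by simp
      also have "\<dots> \<le> enn2real (M_weight H lam \<phi>)" using W[of "\<phi> c" "{c}"] \<phi> c by simp
      finally have "0 < enn2real (M_weight H lam \<phi>)" .
      from paley[OF \<phi> this _ f] W show ?thesis unfolding hs_norm_fourier by blast
    qed
  qed
qed

end
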